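(* Let $X$, $Y$, $G$, $D$, $\mathcal{Y}_t$, $\widehat X$, $\widetilde X$ and $H$ be as described in the context. Then: (i) The best estimate $\widehat X(t)=\mathbb{E}[X(t)\mid\mathcal{Y}_t]$ of $X(t)$ given the observations $Y(s)$, $s\le t$, satisfies, for every $t\ge 0$, the stochastic integral equation $$\widehat X(t)=\mathbb{E}[X(t)]-\int_0^t\frac{G^2(s)}{D^2(s)}H(t,s)\widehat X(s)\,ds+\int_0^t\frac{G(s)}{D^2(s)}H(t,s)\,dY(s),$$ where $H(t,s)=\mathbb{E}[X(t)\widetilde X(s)]$ for $0\le s\le t$. (ii) The error function $H(t,s)=\mathbb{E}[X(t)\widetilde X(s)]$ satisfies the Riccati integral equation $$H(t,s)=\operatorname{Cov}(X(t),X(s))-\int_0^s\frac{G^2(r)}{D^2(r)}H(t,r)H(s,r)\,dr,\qquad 0\le s\le t.$$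
   Context: Setting. $B_1$ and $B_2$ are independent one-dimensional Brownian motions on a probability space with probability $\mathbb{P}$ and expectation $\mathbb{E}$. $X_0$ is a Gaussian random variable independent of $(B_1,B_2)$. The signal $X=\{X(t)\}_{t\ge0}$ is a real-valued (jointly measurable) Gaussian process with $X(0)=X_0$, adapted to the filtration generated by $B_1$ and $X_0$, and square-integrable in the sense that $\int_0^T\mathbb{E}[X(t)^2]\,dt<\infty$ for every $T>0$. The coefficients $G,D:[0,\infty)\to\mathbb{R}$ are bounded Borel measurable deterministic functions, and $|D|$ is bounded below by a positive constant. The observation process $Y$ is $$dY(t)=G(t)X(t)\,dt+D(t)\,dB_2(t),\qquad Y(0)=\mathbb{E}[X_0].$$ $\mathcal{Y}=\{\mathcal{Y}_t\}_{t\ge0}$ is the filtration generated by $Y$, i.e. $\mathcal{Y}_t$ is the sigma-algebra generated by $\{Y(s):s\le t\}$. Define $\widehat X(t)=\mathbb{E}[X(t)\mid\mathcal{Y}_t]$ (a measurable version in $t$ is used in the integrals), $\widetilde X(t)=X(t)-\widehat X(t)$, and $H(t,s)=\mathbb{E}[X(t)\widetilde X(s)]$ for $0\le s\le t$. Integrals with respect to $dY(s)$ mean integrals with respect to $G(s)X(s)\,ds+D(s)\,dB_2(s)$; identities between random variables hold almost surely for each fixed $t$. *)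

theory Defs
  imports "HOL-Probability.Probability"
begin

definition covariance :: "'a measure \<Rightarrow> ('a \<Rightarrow> real) \<Rightarrow> ('a \<Rightarrow> real) \<Rightarrow> real" where
  "covariance M U V =
     (LINT \<omega>|M. (U \<omega> - (LINT \<omega>'|M. U \<omega>')) * (V \<omega> - (LINT \<omega>'|M. V \<omega>')))"

text \<open>Raw (not augmented by null sets) generated sigma-algebra.\<close>

definition generated_sigma :: "'a measure \<Rightarrow> ('a \<Rightarrow> real) set \<Rightarrow> 'a measure" where
  "generated_sigma M S =
     sigma (space M) (\<Union>Z\<in>S. {Z -` A \<inter> space M | A. A \<in> sets borel})"

text \<open>As usual for Gaussian processes, almost surely constant variables count as Gaussian.\<close>

definition gaussian_rv :: "'a measure \<Rightarrow> ('a \<Rightarrow> real) \<Rightarrow> bool" where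
  "gaussian_rv M Z \<longleftrightarrow> Z \<in> borel_measurable M \<and>
     (\<exists>\<mu>. (AE \<omega> in M. Z \<omega> = \<mu>) \<or>
          (\<exists>\<sigma>>0. distributed M lborel Z (\<lambda>x. ennreal (normal_density \<mu> \<sigma> x))))"

definition gaussian_process :: "'a measure \<Rightarrow> (real \<Rightarrow> 'a \<Rightarrow> real) \<Rightarrow> bool" where
  "gaussian_process M X \<longleftrightarrow>
     (\<forall>J c. finite J \<and> J \<subseteq> {0..} \<longrightarrow> gaussian_rv M (\<lambda>\<omega>. \<Sum>t\<in>J. c t * X t \<omega>))"

definition brownian_motion :: "'a measure \<Rightarrow> (real \<Rightarrow> 'a \<Rightarrow> real) \<Rightarrow> bool" where
  "brownian_motion M B \<longleftrightarrow>
     (\<forall>t\<ge>0. B t \<in> borel_measurable M) \<and>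
     (AE \<omega> in M. B 0 \<omega> = 0) \<and>
     (\<forall>s t. 0 \<le> s \<and> s < t \<longrightarrow>
        distributed M lborel (\<lambda>\<omega>. B t \<omega> - B s \<omega>)
          (\<lambda>x. ennreal (normal_density 0 (sqrt (t - s)) x))) \<and>
     (\<forall>(n::nat) p. 0 \<le> p 0 \<and> (\<forall>i<n. p i < p (Suc i)) \<longrightarrow>
        prob_space.indep_vars M (\<lambda>_. borel) (\<lambda>i \<omega>. B (p (Suc i)) \<omega> - B (p i) \<omega>) {..<n}) \<and>
     (AE \<omega> in M. continuous_on {0..} (\<lambda>t. B t \<omega>))"

text \<open>Jointly measurable in time \<open>t \<ge> 0\<close> and \<open>\<omega>\<close>; values at negative times are irrelevant.\<close>

definition jointly_measurable :: "'a measure \<Rightarrow> (real \<Rightarrow> 'a \<Rightarrow> real) \<Rightarrow> bool" where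
  "jointly_measurable M X \<longleftrightarrow>
     (\<lambda>(t, \<omega>). X t \<omega>) \<in> borel_measurable (restrict_space borel {0..} \<Otimes>\<^sub>M M)"

text \<open>
  The Ito integral of a deterministic square-integrable \<open>f\<close> over \<open>[0,t]\<close> (Wiener integral):
  the limit in \<open>L\<^sup>2(M)\<close> of the elementary integrals of step functions converging to \<open>f\<close> in
  \<open>L\<^sup>2([0,t])\<close>. A step function is given by \<open>n\<close>, break points \<open>p 0 \<le> \<dots> \<le> p n\<close> and
  values \<open>c i\<close> on \<open>(p i, p (i+1)]\<close>.
\<close>

definition step_fun :: "nat \<Rightarrow> (nat \<Rightarrow> real) \<Rightarrow> (nat \<Rightarrow> real) \<Rightarrow> real \<Rightarrow> real" where
  "step_fun n p c s = (\<Sum>i<n. c i * indicator {p i<..p (Suc i)} s)"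

definition step_integral ::
    "(real \<Rightarrow> 'a \<Rightarrow> real) \<Rightarrow> nat \<Rightarrow> (nat \<Rightarrow> real) \<Rightarrow> (nat \<Rightarrow> real) \<Rightarrow> 'a \<Rightarrow> real" where
  "step_integral B n p c \<omega> = (\<Sum>i<n. c i * (B (p (Suc i)) \<omega> - B (p i) \<omega>))"

definition has_wiener_integral ::
    "'a measure \<Rightarrow> (real \<Rightarrow> 'a \<Rightarrow> real) \<Rightarrow> (real \<Rightarrow> real) \<Rightarrow> real \<Rightarrow> ('a \<Rightarrow> real) \<Rightarrow> bool" where
  "has_wiener_integral M B f t Z \<longleftrightarrow>
     set_borel_measurable borel {0..t} f \<and> Z \<in> borel_measurable M \<and>
     (\<exists>n p c.
        (\<forall>k. 0 \<le> p k 0 \<and> (\<forall>i<n k. p k i \<le> p k (Suc i)) \<and> p k (n k) \<le> t) \<and>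
        (\<lambda>k. \<integral>\<^sup>+s\<in>{0..t}. ennreal ((f s - step_fun (n k) (p k) (c k) s)\<^sup>2) \<partial>lborel)
          \<longlonglongrightarrow> 0 \<and>
        (\<lambda>k. \<integral>\<^sup>+\<omega>. ennreal ((Z \<omega> - step_integral B (n k) (p k) (c k) \<omega>)\<^sup>2) \<partial>M)
          \<longlonglongrightarrow> 0)"

text \<open>The integral is determined up to a null set; an arbitrary version is chosen.\<close>

definition wiener_integral ::
    "'a measure \<Rightarrow> (real \<Rightarrow> 'a \<Rightarrow> real) \<Rightarrow> (real \<Rightarrow> real) \<Rightarrow> real \<Rightarrow> 'a \<Rightarrow> real" where
  "wiener_integral M B f t = (SOME Z. has_wiener_integral M B f t Z)"

text \<open>
  Integral over \<open>[0,t]\<close> of a deterministic \<open>f\<close> against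
  \<open>dY(s) = G(s) X(s) ds + D(s) dB(s)\<close>.
\<close>

definition obs_integral ::
    "'a measure \<Rightarrow> (real \<Rightarrow> real) \<Rightarrow> (real \<Rightarrow> real) \<Rightarrow> (real \<Rightarrow> 'a \<Rightarrow> real) \<Rightarrow> (real \<Rightarrow> 'a \<Rightarrow> real) \<Rightarrow>
     (real \<Rightarrow> real) \<Rightarrow> real \<Rightarrow> 'a \<Rightarrow> real" where
  "obs_integral M G D X B f t \<omega> =
     (LINT s:{0..t}|lborel. f s * (G s * X s \<omega>)) + wiener_integral M B (\<lambda>s. f s * D s) t \<omega>"

definition obs_filtration :: "'a measure \<Rightarrow> (real \<Rightarrow> 'a \<Rightarrow> real) \<Rightarrow> real \<Rightarrow> 'a measure" where
  "obs_filtration M Y t = generated_sigma M (Y ` {0..t})"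

text \<open>
  A jointly measurable version of \<open>t \<mapsto> E[X(t) | F t]\<close>.
\<close>

definition measurable_cond_exp ::
    "'a measure \<Rightarrow> (real \<Rightarrow> 'a measure) \<Rightarrow> (real \<Rightarrow> 'a \<Rightarrow> real) \<Rightarrow> (real \<Rightarrow> 'a \<Rightarrow> real) \<Rightarrow> bool" where
  "measurable_cond_exp M F X Xh \<longleftrightarrow>
     jointly_measurable M Xh \<and>
     (\<forall>t\<ge>0. AE \<omega> in M. Xh t \<omega> = real_cond_exp M (F t) (X t) \<omega>)"

definition error_fun ::
    "'a measure \<Rightarrow> (real \<Rightarrow> 'a \<Rightarrow> real) \<Rightarrow> (real \<Rightarrow> 'a \<Rightarrow> real) \<Rightarrow> real \<Rightarrow> real \<Rightarrow> real" where
  "error_fun M X Xh t s = (LINT \<omega>|M. X t \<omega> * (X s \<omega> - Xh s \<omega>))"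

end

(*
  Write X~ = X - Xhat for the filtering error. For a deterministic kernel f put
  nu(f) = int f G X~ ds + int f D dB2, the integral of f against the innovation process.

  By joint Gaussianity, Xhat(s) is the orthogonal projection of X(s) onto the closed linear span of
  1 and Y(u), u <= s. Hence X~(r) is orthogonal to every nu(f) with f supported in [0,r], and the cross
  terms in E[nu(f) nu(g)] cancel: E[nu(f) nu(g)] = int f g D^2 ds. Moreover, an element of the closed
  span of the observations up to time t that is orthogonal to 1 and to all nu(f), f supported in [0,t],
  vanishes: writing an approximating combination of the Y(u) as c + int f dY, its inner product with the
  element reduces to int f G E[element Xhat] ds, and a Gronwall argument applies. Both sides of
  Xhat(t) = E[X(t)] + nu(k) with k(s) = G(s)/D(s)^2 H(t,s) lie in this span and have the same inner
  products with 1 and all nu(f), so they agree; this is (i). Pairing the equation at time s with X(t)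
  gives (ii).
*)

theory Submission
  imports Defs
begin

section \<open>Square-integrable functions\<close>

text \<open>Nearly all of the argument uses second moments only; more is needed just to identify the
  projection on the observations with the conditional expectation. That is done with characteristic
  functions, which cover degenerate Gaussians and survive mean-square limits. Sigma-algebras are not
  completed by null sets, so a limit of observations must first be replaced by a measurable version
  before it can be compared with a conditional expectation. In the Gronwall argument E[X(t)^2] is
  integrable in time but has no assumed bound. The argument therefore becomes a contraction on
  intervals over which the integral of E[X^2] is small, continued by a supremum. Its quantitative
  input is that the noise part of c + int f dY is orthogonal to the rest, so the norm of this
  variable is at least \<delta> times the norm of f. This controls the kernels of approximating
  combinations, which a mean-square approximation alone would leave unbounded.\<close>

definition sqint :: "'a measure \<Rightarrow> ('a \<Rightarrow> real) \<Rightarrow> bool" where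
  "sqint M f \<longleftrightarrow> f \<in> borel_measurable M \<and> integrable M (\<lambda>x. (f x)\<^sup>2)"

text \<open>A semi-inner product on functions rather than on classes: a function of norm zero only
  vanishes almost everywhere, so almost sure identities are obtained below by showing that the
  \<open>norm_sq\<close> of a difference is 0. The integral of a non-integrable product is 0 by
  convention, which is why \<open>sqint\<close> is carried along explicitly.\<close>

definition ip :: "'a measure \<Rightarrow> ('a \<Rightarrow> real) \<Rightarrow> ('a \<Rightarrow> real) \<Rightarrow> real" where
  "ip M f g = (LINT x|M. f x * g x)"

abbreviation norm_sq :: "'a measure \<Rightarrow> ('a \<Rightarrow> real) \<Rightarrow> real" where
  "norm_sq M f \<equiv> ip M f f"

lemma sqint_measurable[measurable_dest]: "sqint M f \<Longrightarrow> f \<in> borel_measurable M"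
  by (simp add: sqint_def)

lemma sqint_integrable_mult:
  assumes "sqint M f" "sqint M g" shows "integrable M (\<lambda>x. f x * g x)"
proof (rule Bochner_Integration.integrable_bound)
  show "integrable M (\<lambda>x. (f x)\<^sup>2 + (g x)\<^sup>2)" using assms by (simp add: sqint_def)
  show "(\<lambda>x. f x * g x) \<in> borel_measurable M" using assms by (auto simp: sqint_def)
  have "\<bar>a * b\<bar> \<le> a\<^sup>2 + b\<^sup>2" for a b :: real
  proof -
    have "2 * \<bar>a * b\<bar> \<le> a\<^sup>2 + b\<^sup>2"
      using sum_squares_bound[of "\<bar>a\<bar>" "\<bar>b\<bar>"] by (simp add: abs_mult)
    then show ?thesis by linarith
  qed
  then show "AE x in M. norm (f x * g x) \<le> norm ((f x)\<^sup>2 + (g x)\<^sup>2)" by (simp add: abs_of_nonneg)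
qed

lemma sqint_cmult[intro, simp]: "sqint M f \<Longrightarrow> sqint M (\<lambda>x. c * f x)"
  by (auto simp: sqint_def power_mult_distrib)

lemma sqint_add[intro, simp]:
  assumes "sqint M f" "sqint M g" shows "sqint M (\<lambda>x. f x + g x)"
  using assms sqint_integrable_mult[OF assms] by (auto simp: sqint_def power2_sum mult.assoc)

lemma sqint_diff[intro, simp]:
  assumes "sqint M f" "sqint M g" shows "sqint M (\<lambda>x. f x - g x)"
  using sqint_add[OF assms(1) sqint_cmult[OF assms(2), of "-1"]] by simp

lemma sqint_zero[intro, simp]: "sqint M (\<lambda>x. 0)" by (simp add: sqint_def)

lemma sqint_sum[intro, simp]: "(\<And>i. i \<in> I \<Longrightarrow> sqint M (f i)) \<Longrightarrow> sqint M (\<lambda>x. \<Sum>i\<in>I. f i x)"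
  by (induction I rule: infinite_finite_induct) auto

lemma sqint_bound:
  assumes "sqint M f" "g \<in> borel_measurable M" "AE x in M. \<bar>g x\<bar> \<le> \<bar>f x\<bar>" shows "sqint M g"
  using assms Bochner_Integration.integrable_bound[of M "\<lambda>x. (f x)\<^sup>2" "\<lambda>x. (g x)\<^sup>2"]
  by (auto simp: sqint_def abs_le_square_iff)

lemma sqint_AE:
  assumes "sqint M f" "g \<in> borel_measurable M" "AE x in M. g x = f x" shows "sqint M g"
  using assms(3) by (intro sqint_bound[OF assms(1,2)]) auto

lemma ip_commute: "ip M f g = ip M g f" by (simp add: ip_def mult.commute)

lemma ip_add_left: "sqint M f \<Longrightarrow> sqint M g \<Longrightarrow> sqint M h \<Longrightarrow> ip M (\<lambda>x. f x + g x) h = ip M f h + ip M g h"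
  by (simp add: ip_def distrib_right sqint_integrable_mult)

lemma ip_diff_left: "sqint M f \<Longrightarrow> sqint M g \<Longrightarrow> sqint M h \<Longrightarrow> ip M (\<lambda>x. f x - g x) h = ip M f h - ip M g h"
  by (simp add: ip_def left_diff_distrib sqint_integrable_mult)

lemma ip_cmult_left: "ip M (\<lambda>x. c * f x) h = c * ip M f h"
  by (simp add: ip_def mult.assoc)

lemma ip_add_right: "sqint M f \<Longrightarrow> sqint M g \<Longrightarrow> sqint M h \<Longrightarrow> ip M h (\<lambda>x. f x + g x) = ip M h f + ip M h g"
  by (simp add: ip_commute[of M h] ip_add_left)

lemma ip_diff_right: "sqint M f \<Longrightarrow> sqint M g \<Longrightarrow> sqint M h \<Longrightarrow> ip M h (\<lambda>x. f x - g x) = ip M h f - ip M h g"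
  by (simp add: ip_commute[of M h] ip_diff_left)

lemma ip_cmult_right: "ip M h (\<lambda>x. c * f x) = c * ip M h f"
  by (simp add: ip_commute[of M h] ip_cmult_left)

lemma ip_zero[simp]: "ip M (\<lambda>x. 0) f = 0" "ip M f (\<lambda>x. 0) = 0" by (simp_all add: ip_def)

lemma ip_sum_left:
  assumes "\<And>i. i \<in> I \<Longrightarrow> sqint M (f i)" "sqint M h"
  shows "ip M (\<lambda>x. \<Sum>i\<in>I. f i x) h = (\<Sum>i\<in>I. ip M (f i) h)"
  using assms by (simp add: ip_def sum_distrib_right sqint_integrable_mult)

lemma ip_sum_right:
  assumes "\<And>i. i \<in> I \<Longrightarrow> sqint M (f i)" "sqint M h"
  shows "ip M h (\<lambda>x. \<Sum>i\<in>I. f i x) = (\<Sum>i\<in>I. ip M h (f i))"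
  using assms by (simp add: ip_commute[of M h] ip_sum_left)

lemmas ip_simps = ip_add_left ip_add_right ip_diff_left ip_diff_right ip_cmult_left ip_cmult_right

lemma ip_nonneg[simp]: "0 \<le> norm_sq M f"
  by (simp add: ip_def)

lemma ip_cong_AE:
  assumes "f \<in> borel_measurable M" "f' \<in> borel_measurable M" "g \<in> borel_measurable M" "g' \<in> borel_measurable M"
    "AE x in M. f x = f' x" "AE x in M. g x = g' x"
  shows "ip M f g = ip M f' g'"
  unfolding ip_def using assms(5,6) by (intro integral_cong_AE) (use assms(1-4) in auto)

lemma ip_eq_0_AE:
  assumes "sqint M f" "norm_sq M f = 0" shows "AE x in M. f x = 0"
proof -
  have "AE x in M. f x * f x = 0"
    using integral_nonneg_eq_0_iff_AE[of M "\<lambda>x. f x * f x"] assms sqint_integrable_mult[OF assms(1,1)]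
    by (simp add: ip_def)
  then show ?thesis by simp
qed

lemma ip_Cauchy_Schwarz:
  assumes f: "sqint M f" and g: "sqint M g"
  shows "(ip M f g)\<^sup>2 \<le> norm_sq M f * norm_sq M g"
proof -
  have "0 \<le> norm_sq M (\<lambda>x. f x - c * g x)" for c by simp
  then have q: "0 \<le> norm_sq M f - 2 * c * ip M f g + c\<^sup>2 * norm_sq M g" for c
    using f g by (simp add: ip_simps ip_commute[of M g f] power2_eq_square algebra_simps)
  show ?thesis
  proof (cases "norm_sq M g = 0")
    case True
    then have "AE x in M. g x = 0" using ip_eq_0_AE[OF g] by simp
    then have "ip M f g = ip M f (\<lambda>x. 0)" using f g by (intro ip_cong_AE) (auto simp: sqint_def)
    then show ?thesis by simp
  next
    case False
    then have pos: "0 < norm_sq M g" using ip_nonneg[of M g] by linarith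
    \<comment> \<open>The minimiser of the quadratic in \<open>c\<close>, multiplied by
      \<open>norm_sq M g\<close> to clear the denominator.\<close>
    have "0 \<le> (norm_sq M f - 2 * (ip M f g / norm_sq M g) * ip M f g + (ip M f g / norm_sq M g)\<^sup>2 * norm_sq M g) * norm_sq M g"
      using pos by (intro mult_nonneg_nonneg q) auto
    also have "\<dots> = norm_sq M f * norm_sq M g - (ip M f g)\<^sup>2"
      using pos by (simp add: field_simps power2_eq_square)
    finally show ?thesis by simp
  qed
qed

lemma ip_abs_le:
  assumes "sqint M f" "sqint M g"
  shows "\<bar>ip M f g\<bar> \<le> sqrt (norm_sq M f) * sqrt (norm_sq M g)"
  using real_sqrt_le_mono[OF ip_Cauchy_Schwarz[OF assms]] by (simp add: real_sqrt_mult)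

lemma ip_add_le:
  assumes "sqint M f" "sqint M g"
  shows "norm_sq M (\<lambda>x. f x + g x) \<le> 2 * norm_sq M f + 2 * norm_sq M g"
proof -
  have "0 \<le> norm_sq M (\<lambda>x. f x - g x)" by simp
  then show ?thesis using assms by (simp add: ip_simps ip_commute[of M g f])
qed

lemma ip_diff_le:
  assumes "sqint M f" "sqint M g"
  shows "norm_sq M (\<lambda>x. f x - g x) \<le> 2 * norm_sq M f + 2 * norm_sq M g"
  using ip_add_le[OF assms(1) sqint_cmult[OF assms(2), of "-1"]] by (simp add: ip_cmult_left ip_cmult_right ip_def)

section \<open>Mean-square convergence and completeness of L2\<close>

definition l2conv :: "'a measure \<Rightarrow> (nat \<Rightarrow> 'a \<Rightarrow> real) \<Rightarrow> ('a \<Rightarrow> real) \<Rightarrow> bool" where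
  "l2conv M u f \<longleftrightarrow> (\<forall>n. sqint M (u n)) \<and> sqint M f \<and>
     (\<lambda>n. norm_sq M (\<lambda>x. u n x - f x)) \<longlonglongrightarrow> 0"

lemma l2conv_ip:
  assumes u: "l2conv M u f" and g: "sqint M g"
  shows "(\<lambda>n. ip M (u n) g) \<longlonglongrightarrow> ip M f g"
proof -
  have *: "(\<lambda>n. sqrt (norm_sq M (\<lambda>x. u n x - f x)) * sqrt (norm_sq M g)) \<longlonglongrightarrow> 0"
    using u unfolding l2conv_def by (intro tendsto_eq_intros) auto
  have "(\<lambda>n. ip M (u n) g - ip M f g) \<longlonglongrightarrow> 0"
  proof (rule Lim_null_comparison[OF _ *], rule always_eventually, rule allI)
    fix n
    have "ip M (u n) g - ip M f g = ip M (\<lambda>x. u n x - f x) g"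
      using u g by (simp add: l2conv_def ip_simps)
    then show "norm (ip M (u n) g - ip M f g) \<le> sqrt (norm_sq M (\<lambda>x. u n x - f x)) * sqrt (norm_sq M g)"
      using u g ip_abs_le[of M "\<lambda>x. u n x - f x" g] by (simp add: l2conv_def)
  qed
  then show ?thesis using Lim_null by blast
qed

lemma l2conv_ip2:
  assumes u: "l2conv M u f" and v: "l2conv M v g"
  shows "(\<lambda>n. ip M (u n) (v n)) \<longlonglongrightarrow> ip M f g"
proof -
  let ?a = "\<lambda>n. norm_sq M (\<lambda>x. u n x - f x)"
  let ?b = "\<lambda>n. norm_sq M (\<lambda>x. v n x - g x)"
  have sq: "sqint M (u n)" "sqint M (v n)" "sqint M f" "sqint M g" for n
    using u v by (auto simp: l2conv_def)
  have "(\<lambda>n. sqrt (?a n) * sqrt (?b n)) \<longlonglongrightarrow> 0"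
    using u v unfolding l2conv_def by (intro tendsto_eq_intros) auto
  then have "(\<lambda>n. ip M (\<lambda>x. u n x - f x) (\<lambda>x. v n x - g x)) \<longlonglongrightarrow> 0"
    by (rule Lim_null_comparison[rotated]) (auto intro!: always_eventually ip_abs_le sq)
  moreover have "(\<lambda>n. ip M (u n) g) \<longlonglongrightarrow> ip M f g" "(\<lambda>n. ip M (v n) f) \<longlonglongrightarrow> ip M g f"
    by (intro l2conv_ip u v sq)+
  ultimately have "(\<lambda>n. ip M (\<lambda>x. u n x - f x) (\<lambda>x. v n x - g x) + ip M (u n) g + ip M (v n) f - ip M f g)
      \<longlonglongrightarrow> 0 + ip M f g + ip M g f - ip M f g"
    by (intro tendsto_intros)
  moreover have "ip M (\<lambda>x. u n x - f x) (\<lambda>x. v n x - g x) + ip M (u n) g + ip M (v n) f - ip M f g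
      = ip M (u n) (v n)" for n
    using sq by (simp add: ip_simps ip_commute[of M _ "v n"])
  ultimately show ?thesis by (simp add: ip_commute[of M g f])
qed

lemma l2conv_const: "sqint M f \<Longrightarrow> l2conv M (\<lambda>n. f) f"
  by (simp add: l2conv_def)

lemma l2conv_diff:
  assumes u: "l2conv M u f" and v: "l2conv M v g"
  shows "l2conv M (\<lambda>n x. u n x - v n x) (\<lambda>x. f x - g x)"
proof -
  have sq: "sqint M (u n)" "sqint M (v n)" "sqint M f" "sqint M g" for n
    using u v by (auto simp: l2conv_def)
  let ?a = "\<lambda>n. norm_sq M (\<lambda>x. u n x - f x)"
  let ?b = "\<lambda>n. norm_sq M (\<lambda>x. v n x - g x)"
  have lim: "(\<lambda>n. 2 * ?a n + 2 * ?b n) \<longlonglongrightarrow> 0"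
    using u v unfolding l2conv_def by (intro tendsto_eq_intros) auto
  have "(\<lambda>n. norm_sq M (\<lambda>x. u n x - v n x - (f x - g x))) \<longlonglongrightarrow> 0"
  proof (rule Lim_null_comparison[OF _ lim], rule always_eventually, rule allI)
    fix n
    have "(\<lambda>x. u n x - v n x - (f x - g x)) = (\<lambda>x. (u n x - f x) - (v n x - g x))" by (simp add: fun_eq_iff)
    then show "norm (norm_sq M (\<lambda>x. u n x - v n x - (f x - g x))) \<le> 2 * ?a n + 2 * ?b n"
      using ip_diff_le[of M "\<lambda>x. u n x - f x" "\<lambda>x. v n x - g x"] sq by simp
  qed
  then show ?thesis using sq by (simp add: l2conv_def)
qed

lemma l2conv_AE_limit:
  assumes "l2conv M u f" "AE x in M. g x = f x" "g \<in> borel_measurable M" shows "l2conv M u g"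
proof -
  have [measurable]: "u n \<in> borel_measurable M" "f \<in> borel_measurable M" "g \<in> borel_measurable M" for n
    using assms by (auto simp: l2conv_def sqint_def)
  have "sqint M g" using assms sqint_AE unfolding l2conv_def by blast
  moreover have "norm_sq M (\<lambda>x. u n x - g x) = norm_sq M (\<lambda>x. u n x - f x)" for n
    using assms(2) by (intro ip_cong_AE) auto
  ultimately show ?thesis using assms unfolding l2conv_def by simp
qed

text \<open>The Riesz-Fischer argument: a fast subsequence converges almost everywhere, and Fatou's
  lemma makes its pointwise limit a mean-square limit of the whole sequence.\<close>

lemma sqint_complete:
  assumes u: "\<And>n. sqint M (u n)"
    and C: "\<And>e. e > 0 \<Longrightarrow> \<exists>N. \<forall>m\<ge>N. \<forall>n\<ge>N. norm_sq M (\<lambda>x. u m x - u n x) < e"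
  shows "\<exists>f. l2conv M u f"
proof -
  have [measurable]: "u n \<in> borel_measurable M" for n using u by (simp add: sqint_def)
  obtain N where N: "\<And>e m n. e > 0 \<Longrightarrow> m \<ge> N e \<Longrightarrow> n \<ge> N e \<Longrightarrow>
      norm_sq M (\<lambda>x. u m x - u n x) < e"
    using C by metis
  \<comment> \<open>Summing the thresholds makes \<open>r\<close> monotone and at least as large as
    each of them, so successive differences along \<open>r\<close> have squared norm at most
    (1/4)^k.\<close>
  define r where "r k = (\<Sum>j\<le>k. N ((1/4)^j))" for k :: nat
  have rN: "N ((1/4)^k) \<le> r k" "r k \<le> r (Suc k)" for k
    unfolding r_def by (auto intro: member_le_sum)
  define d where "d k x = u (r (Suc k)) x - u (r k) x" for k x
  have [measurable]: "d k \<in> borel_measurable M" for k unfolding d_def by simp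
  have d: "sqint M (d k)" "norm_sq M (d k) \<le> (1/4)^k" for k
    unfolding d_def using u N[of "(1/4)^k" "r (Suc k)" "r k"] rN[of k] by (auto simp: less_imp_le)
  \<comment> \<open>The weight 2^k still leaves the convergent series (1/2)^k of integrals, and it
    is large enough to make the differences themselves summable pointwise.\<close>
  have "(\<integral>\<^sup>+x. (\<Sum>k. ennreal (2^k * (d k x)\<^sup>2)) \<partial>M) = (\<Sum>k. \<integral>\<^sup>+x. ennreal (2^k * (d k x)\<^sup>2) \<partial>M)"
    by (rule nn_integral_suminf) simp
  also have "\<dots> \<le> (\<Sum>k. ennreal ((1/2)^k))"
  proof (rule suminf_le)
    fix k
    have "(\<integral>\<^sup>+x. ennreal (2^k * (d k x)\<^sup>2) \<partial>M) = ennreal (2^k * norm_sq M (d k))"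
      using d(1)[of k] unfolding ip_def
      by (subst nn_integral_eq_integral) (auto simp: sqint_def power2_eq_square)
    also have "\<dots> \<le> ennreal (2^k * (1/4)^k)"
      using d(2)[of k] by (intro ennreal_leI mult_left_mono) auto
    also have "2^k * (1/4)^k = ((1/2)^k :: real)" by (simp flip: power_mult_distrib)
    finally show "(\<integral>\<^sup>+x. ennreal (2^k * (d k x)\<^sup>2) \<partial>M) \<le> ennreal ((1/2)^k)" .
  qed auto
  also have "\<dots> = ennreal (\<Sum>k. (1/2)^k)" by (rule suminf_ennreal2) (auto intro: summable_geometric)
  also have "\<dots> < \<infinity>" by simp
  finally have "AE x in M. (\<Sum>k. ennreal (2^k * (d k x)\<^sup>2)) \<noteq> \<infinity>"
    by (intro nn_integral_PInf_AE) auto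
  moreover have "convergent (\<lambda>k. u (r k) x)" if "(\<Sum>k. ennreal (2^k * (d k x)\<^sup>2)) \<noteq> \<infinity>" for x
  proof -
    have s: "summable (\<lambda>k. 2^k * (d k x)\<^sup>2)"
      using that by (intro summable_suminf_not_top) auto
    have "summable (\<lambda>k. d k x)"
    proof (rule summable_comparison_test', rule summable_add[OF s])
      show "summable (\<lambda>k. (1/2::real)^k)" by (auto intro: summable_geometric)
      fix k
      \<comment> \<open>With b = 2^k this bounds |d k| by a term of the weighted series plus a term
        of a geometric series.\<close>
      have "\<bar>z\<bar> \<le> b * z\<^sup>2 + 1 / b" if "b > 0" for b z :: real
      proof -
        have "0 \<le> (b * \<bar>z\<bar> - 1)\<^sup>2 + b * \<bar>z\<bar>" using that by simp
        then have "b * \<bar>z\<bar> \<le> b\<^sup>2 * z\<^sup>2 + 1" by (simp add: power2_diff power_mult_distrib)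
        then show ?thesis using that by (simp add: field_simps power2_eq_square)
      qed
      from this[of "2^k" "d k x"] show "norm (d k x) \<le> 2^k * (d k x)\<^sup>2 + (1/2)^k"
        by (simp add: power_one_over)
    qed
    then have "convergent (\<lambda>n. \<Sum>k<n. d k x)" by (simp add: summable_iff_convergent)
    moreover have "(\<Sum>k<n. d k x) = u (r n) x - u (r 0) x" for n
      unfolding d_def by (rule sum_lessThan_telescope)
    ultimately have "convergent (\<lambda>n. u (r n) x - u (r 0) x)" by simp
    from convergent_add[OF this convergent_const[of "u (r 0) x"]] show ?thesis by simp
  qed
  ultimately have conv: "AE x in M. convergent (\<lambda>k. u (r k) x)" by auto
  define f where "f x = lim (\<lambda>k. u (r k) x)" for x
  have [measurable]: "f \<in> borel_measurable M" unfolding f_def by (intro borel_measurable_lim_metric) simp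
  \<comment> \<open>Fatou along the subsequence: for k \<ge> k0 both \<open>n\<close> and
    \<open>r k\<close> lie beyond the threshold of (1/4)^k0.\<close>
  have bound: "(\<integral>\<^sup>+x. ennreal ((u n x - f x)\<^sup>2) \<partial>M) \<le> ennreal ((1/4)^k0)" if n: "n \<ge> N ((1/4)^k0)" for k0 n
  proof -
    have "(\<integral>\<^sup>+x. ennreal ((u n x - f x)\<^sup>2) \<partial>M) = (\<integral>\<^sup>+x. liminf (\<lambda>k. ennreal ((u n x - u (r k) x)\<^sup>2)) \<partial>M)"
    proof (rule nn_integral_cong_AE, use conv in eventually_elim)
      fix x assume "convergent (\<lambda>k. u (r k) x)"
      then have "(\<lambda>k. u (r k) x) \<longlonglongrightarrow> f x" unfolding f_def by (simp add: convergent_LIMSEQ_iff)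
      then have "(\<lambda>k. ennreal ((u n x - u (r k) x)\<^sup>2)) \<longlonglongrightarrow> ennreal ((u n x - f x)\<^sup>2)"
        by (intro tendsto_ennrealI tendsto_intros)
      then show "ennreal ((u n x - f x)\<^sup>2) = liminf (\<lambda>k. ennreal ((u n x - u (r k) x)\<^sup>2))"
        by (intro lim_imp_Liminf[symmetric]) auto
    qed
    also have "\<dots> \<le> liminf (\<lambda>k. \<integral>\<^sup>+x. ennreal ((u n x - u (r k) x)\<^sup>2) \<partial>M)"
      by (rule nn_integral_liminf) simp
    also have "\<dots> \<le> liminf (\<lambda>k::nat. ennreal ((1/4)^k0))"
    proof (rule Liminf_mono, rule eventually_sequentiallyI[of k0])
      fix k assume k: "k0 \<le> k"
      have "N ((1/4)^k0) \<le> r k" unfolding r_def by (rule member_le_sum) (use k in auto)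
      then have "norm_sq M (\<lambda>x. u n x - u (r k) x) \<le> (1/4)^k0"
        using N[of "(1/4)^k0" n "r k"] n by simp
      moreover have "(\<integral>\<^sup>+x. ennreal ((u n x - u (r k) x)\<^sup>2) \<partial>M) = ennreal (norm_sq M (\<lambda>x. u n x - u (r k) x))"
        using sqint_diff[OF u[of n] u[of "r k"]] unfolding ip_def
        by (subst nn_integral_eq_integral) (auto simp: sqint_def power2_eq_square)
      ultimately show "(\<integral>\<^sup>+x. ennreal ((u n x - u (r k) x)\<^sup>2) \<partial>M) \<le> ennreal ((1/4)^k0)"
        by (simp add: ennreal_leI)
    qed
    also have "\<dots> = ennreal ((1/4)^k0)" by (simp add: Liminf_const)
    finally show ?thesis .
  qed
  have "integrable M (\<lambda>x. (u (N ((1/4)^0)) x - f x)\<^sup>2)"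
    using bound[of 0 "N ((1/4)^0)"] by (intro integrableI_bounded) (auto simp: intro: le_less_trans[OF _ ennreal_less_top[of 1]])
  then have "sqint M (\<lambda>x. u (N ((1/4)^0)) x - f x)" by (simp add: sqint_def)
  from sqint_diff[OF u[of "N ((1/4)^0)"] this] have sf: "sqint M f" by simp
  have "(\<lambda>n. norm_sq M (\<lambda>x. u n x - f x)) \<longlonglongrightarrow> 0"
  proof (rule LIMSEQ_I)
    fix e :: real assume "e > 0"
    then obtain k0 :: nat where k0: "(1/4::real)^k0 < e" using real_arch_pow_inv[of e "1/4"] by auto
    have "norm (norm_sq M (\<lambda>x. u n x - f x) - 0) < e" if n: "n \<ge> N ((1/4)^k0)" for n
    proof -
      have "(\<integral>\<^sup>+x. ennreal ((u n x - f x)\<^sup>2) \<partial>M) = ennreal (norm_sq M (\<lambda>x. u n x - f x))"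
        using sqint_diff[OF u[of n] sf] unfolding ip_def
        by (subst nn_integral_eq_integral) (auto simp: sqint_def power2_eq_square)
      then have "norm_sq M (\<lambda>x. u n x - f x) \<le> (1/4)^k0"
        using bound[OF n] by simp
      then show ?thesis using k0 by simp
    qed
    then show "\<exists>no. \<forall>n\<ge>no. norm (norm_sq M (\<lambda>x. u n x - f x) - 0) < e" by blast
  qed
  then show ?thesis using u sf unfolding l2conv_def by blast
qed

section \<open>Linear spans, closed spans and orthogonal projection\<close>

inductive_set lspan :: "('a \<Rightarrow> real) set \<Rightarrow> ('a \<Rightarrow> real) set" for S where
  lspan_zero: "(\<lambda>x. 0) \<in> lspan S"
| lspan_step: "f \<in> lspan S \<Longrightarrow> g \<in> S \<Longrightarrow> (\<lambda>x. f x + c * g x) \<in> lspan S"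

lemma lspan_base: "g \<in> S \<Longrightarrow> g \<in> lspan S"
  using lspan_step[OF lspan_zero, of g S 1] by simp

lemma lspan_add: assumes "f \<in> lspan S" "g \<in> lspan S" shows "(\<lambda>x. f x + g x) \<in> lspan S"
  using assms(2,1)
proof induction
  case (lspan_step g h c)
  then show ?case using lspan.lspan_step[of "\<lambda>x. f x + g x" S h c] by (simp add: add.assoc)
qed simp

lemma lspan_cmult: assumes "f \<in> lspan S" shows "(\<lambda>x. c * f x) \<in> lspan S"
  using assms
proof induction
  case (lspan_step g h a)
  then show ?case using lspan.lspan_step[of "\<lambda>x. c * g x" S h "c * a"] by (simp add: distrib_left mult.assoc)
qed (simp add: lspan.lspan_zero)

lemma lspan_sum: "(\<And>i. i \<in> I \<Longrightarrow> f i \<in> lspan S) \<Longrightarrow> (\<lambda>x. \<Sum>i\<in>I. f i x) \<in> lspan S"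
  by (induction I rule: infinite_finite_induct) (auto intro: lspan_zero lspan_add)

lemma sqint_lspan: assumes "f \<in> lspan S" "\<And>g. g \<in> S \<Longrightarrow> sqint M g" shows "sqint M f"
  using assms by induction auto

lemma ip_lspan_0:
  assumes "f \<in> lspan S" "\<And>g. g \<in> S \<Longrightarrow> sqint M g" "sqint M q" "\<And>g. g \<in> S \<Longrightarrow> ip M q g = 0"
  shows "ip M q f = 0"
  using assms
proof induction
  case (lspan_step f g c)
  then show ?case using sqint_lspan[OF lspan_step(1), of M] by (simp add: ip_simps)
qed simp

text \<open>The closed linear span in \<open>L\<^sup>2\<close>, defined as the double orthogonal complement.\<close>

definition cspan :: "'a measure \<Rightarrow> ('a \<Rightarrow> real) set \<Rightarrow> ('a \<Rightarrow> real) set" where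
  "cspan M S = {f. sqint M f \<and> (\<forall>q. sqint M q \<and> (\<forall>g\<in>S. ip M q g = 0) \<longrightarrow> ip M q f = 0)}"

lemma cspan_sqint: "f \<in> cspan M S \<Longrightarrow> sqint M f" by (simp add: cspan_def)

lemma cspanI:
  "sqint M f \<Longrightarrow> (\<And>q. sqint M q \<Longrightarrow> (\<And>g. g \<in> S \<Longrightarrow> ip M q g = 0) \<Longrightarrow> ip M q f = 0) \<Longrightarrow> f \<in> cspan M S"
  by (auto simp: cspan_def)

lemma cspanD: "f \<in> cspan M S \<Longrightarrow> sqint M q \<Longrightarrow> (\<And>g. g \<in> S \<Longrightarrow> ip M q g = 0) \<Longrightarrow> ip M q f = 0"
  by (auto simp: cspan_def)

lemma cspan_base: "g \<in> S \<Longrightarrow> sqint M g \<Longrightarrow> g \<in> cspan M S" by (auto simp: cspan_def)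

lemma cspan_add: "f \<in> cspan M S \<Longrightarrow> g \<in> cspan M S \<Longrightarrow> (\<lambda>x. f x + g x) \<in> cspan M S"
  by (auto simp: cspan_def ip_simps)

lemma cspan_diff: "f \<in> cspan M S \<Longrightarrow> g \<in> cspan M S \<Longrightarrow> (\<lambda>x. f x - g x) \<in> cspan M S"
  by (auto simp: cspan_def ip_simps)

lemma cspan_cmult: "f \<in> cspan M S \<Longrightarrow> (\<lambda>x. c * f x) \<in> cspan M S"
  by (auto simp: cspan_def ip_simps)

lemma cspan_trans: "f \<in> cspan M S \<Longrightarrow> (\<And>g. g \<in> S \<Longrightarrow> g \<in> cspan M S') \<Longrightarrow> f \<in> cspan M S'"
  by (auto simp: cspan_def)

lemma cspan_mono: "S \<subseteq> S' \<Longrightarrow> cspan M S \<subseteq> cspan M S'"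
  by (auto simp: cspan_def)

text \<open>Membership is tested by inner products, so it ignores null sets. This is what allows
  versions of observations, estimates and integrals to be exchanged.\<close>

lemma cspan_AE:
  assumes "f \<in> cspan M S" "g \<in> borel_measurable M" "AE x in M. g x = f x" shows "g \<in> cspan M S"
proof (rule cspanI)
  show "sqint M g" using sqint_AE[OF cspan_sqint[OF assms(1)] assms(2,3)] .
  fix q assume q: "sqint M q" "\<And>h. h \<in> S \<Longrightarrow> ip M q h = 0"
  have "ip M q g = ip M q f"
    using q(1) cspan_sqint[OF assms(1)] assms(2,3) by (intro ip_cong_AE) (auto simp: sqint_def)
  then show "ip M q g = 0" using cspanD[OF assms(1) q] by simp
qed

lemma lspan_cspan: "f \<in> lspan S \<Longrightarrow> (\<And>g. g \<in> S \<Longrightarrow> sqint M g) \<Longrightarrow> f \<in> cspan M S"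
  by (rule cspanI; (erule sqint_lspan | erule ip_lspan_0); blast)

lemma l2conv_cspan:
  assumes "l2conv M u f" "\<And>n. u n \<in> cspan M S" shows "f \<in> cspan M S"
proof (rule cspanI)
  show "sqint M f" using assms by (simp add: l2conv_def)
  fix q assume q: "sqint M q" "\<And>g. g \<in> S \<Longrightarrow> ip M q g = 0"
  have "(\<lambda>n. ip M (u n) q) \<longlonglongrightarrow> ip M f q" by (rule l2conv_ip[OF assms(1) q(1)])
  moreover have "ip M (u n) q = 0" for n using cspanD[OF assms(2) q] by (simp add: ip_commute)
  ultimately have "ip M f q = 0" by (simp add: LIMSEQ_const_iff)
  then show "ip M q f = 0" by (simp add: ip_commute)
qed

lemma ip_parallelogram:
  assumes "sqint M f" "sqint M g"
  shows "norm_sq M (\<lambda>x. f x + g x) + norm_sq M (\<lambda>x. f x - g x)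
    = 2 * norm_sq M f + 2 * norm_sq M g"
  using assms by (simp add: ip_simps ip_commute[of M g f])

lemma ip_diff_cmult:
  assumes "sqint M f" "sqint M g"
  shows "norm_sq M (\<lambda>x. f x - a * g x) = norm_sq M f - 2 * a * ip M f g + a\<^sup>2 * norm_sq M g"
  using assms by (simp add: ip_simps ip_commute[of M g f] power2_eq_square algebra_simps)

text \<open>A minimising sequence in the span is Cauchy by the parallelogram law, and the first
  variation at its limit \<open>P\<close> gives orthogonality. The sequence is returned along with
  \<open>P\<close> because it shows that \<open>P\<close> lies in the closed span.\<close>

lemma sqint_projection:
  assumes S: "\<And>g. g \<in> S \<Longrightarrow> sqint M g" and x: "sqint M x"
  obtains u P where "\<And>n. u n \<in> lspan S" "l2conv M u P" "\<And>g. g \<in> S \<Longrightarrow> ip M (\<lambda>\<omega>. x \<omega> - P \<omega>) g = 0"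
proof -
  let ?D = "\<lambda>l. norm_sq M (\<lambda>\<omega>. x \<omega> - l \<omega>)"
  define d where "d = Inf (?D ` lspan S)"
  have bdd: "bdd_below (?D ` lspan S)" by (rule bdd_belowI[of _ 0]) auto
  have dle: "d \<le> ?D l" if "l \<in> lspan S" for l
    unfolding d_def using bdd that by (rule cINF_lower)
  have sq: "sqint M l" if "l \<in> lspan S" for l using sqint_lspan[OF that S] .
  have "\<exists>l\<in>lspan S. ?D l < d + 1 / (real n + 1)" for n
  proof -
    have "Inf (?D ` lspan S) < d + 1 / (real n + 1)" unfolding d_def by simp
    then show ?thesis using lspan_zero by (subst (asm) cInf_less_iff[OF _ bdd]) auto
  qed
  then obtain u where u: "\<And>n. u n \<in> lspan S" "\<And>n. ?D (u n) < d + 1 / (real n + 1)" by metis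
  have par: "norm_sq M (\<lambda>\<omega>. u m \<omega> - u n \<omega>) \<le> 2 / (real m + 1) + 2 / (real n + 1)" for m n
  proof -
    \<comment> \<open>The midpoint stays in the span, so its squared distance to \<open>x\<close> is
      at least \<open>d\<close>; the parallelogram law then bounds \<open>u m - u n\<close> by the
      excesses over \<open>d\<close>.\<close>
    define h where "h = (\<lambda>\<omega>. (1/2) * (u m \<omega> + u n \<omega>))"
    have h: "h \<in> lspan S" unfolding h_def using u by (intro lspan_cmult lspan_add)
    have "(\<lambda>\<omega>. x \<omega> - h \<omega>) = (\<lambda>\<omega>. (1/2) * ((x \<omega> - u n \<omega>) + (x \<omega> - u m \<omega>)))"
      by (simp add: h_def fun_eq_iff field_simps)
    then have "4 * ?D h = norm_sq M (\<lambda>\<omega>. (x \<omega> - u n \<omega>) + (x \<omega> - u m \<omega>))"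
      by (simp only: ip_cmult_left ip_cmult_right)
    moreover have eq: "(\<lambda>\<omega>. u m \<omega> - u n \<omega>) = (\<lambda>\<omega>. (x \<omega> - u n \<omega>) - (x \<omega> - u m \<omega>))" by (simp add: fun_eq_iff)
    moreover note ip_parallelogram[OF sqint_diff[OF x sq[OF u(1)[of n]]] sqint_diff[OF x sq[OF u(1)[of m]]]]
      arg_cong2[of _ _ _ _ "ip M", OF eq eq] dle[OF h] u(2)[of m] u(2)[of n]
    moreover have "2 / (real k + 1) = 2 * (1 / (real k + 1))" for k by simp
    ultimately show ?thesis by argo
  qed
  have "\<exists>f. l2conv M u f"
  proof (rule sqint_complete)
    show "sqint M (u n)" for n by (rule sq[OF u(1)])
    fix e :: real assume e: "e > 0"
    obtain N :: nat where N: "4 / e < real N" using reals_Archimedean2 by blast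
    have "norm_sq M (\<lambda>x. u m x - u n x) < e" if "m \<ge> N" "n \<ge> N" for m n
    proof -
      have "2 / (real k + 1) < e / 2" if "k \<ge> N" for k
      proof -
        have "4 / e < real k + 1" using that N by linarith
        then show ?thesis using e by (simp add: field_simps)
      qed
      from this[of m] this[of n] par[of m n] that show ?thesis by simp
    qed
    then show "\<exists>N. \<forall>m\<ge>N. \<forall>n\<ge>N. norm_sq M (\<lambda>x. u m x - u n x) < e" by blast
  qed
  then obtain P where P: "l2conv M u P" by blast
  then have sP: "sqint M P" by (simp add: l2conv_def)
  have lim: "(\<lambda>n. norm_sq M (\<lambda>\<omega>. x \<omega> - u n \<omega> - a * g \<omega>)) \<longlonglongrightarrow>
      norm_sq M (\<lambda>\<omega>. x \<omega> - P \<omega> - a * g \<omega>)" if "sqint M g" for a g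
    by (intro l2conv_ip2 l2conv_diff l2conv_const P x sqint_cmult that)
  have "ip M (\<lambda>\<omega>. x \<omega> - P \<omega>) g = 0" if g: "g \<in> S" for g
  proof -
    have ge: "d \<le> norm_sq M (\<lambda>\<omega>. x \<omega> - P \<omega> - a * g \<omega>)" for a
    proof (rule LIMSEQ_le_const[OF lim[OF S[OF g]]], intro exI[of _ 0] allI impI)
      fix n
      show "d \<le> norm_sq M (\<lambda>\<omega>. x \<omega> - u n \<omega> - a * g \<omega>)"
        using dle[OF lspan_step[OF u(1)[of n] g, of a]] by (simp add: diff_diff_eq)
    qed
    have le: "norm_sq M (\<lambda>\<omega>. x \<omega> - P \<omega>) \<le> d"
    proof (rule LIMSEQ_le)
      show "(\<lambda>n. ?D (u n)) \<longlonglongrightarrow> norm_sq M (\<lambda>\<omega>. x \<omega> - P \<omega>)"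
        using lim[OF S[OF g], of 0] by simp
      have "(\<lambda>n. d + 1 / (real n + 1)) \<longlonglongrightarrow> d + 0"
        using LIMSEQ_inverse_real_of_nat by (intro tendsto_intros) (simp add: inverse_eq_divide add.commute)
      then show "(\<lambda>n. d + 1 / (real n + 1)) \<longlonglongrightarrow> d" by simp
      show "\<exists>N. \<forall>n\<ge>N. ?D (u n) \<le> d + 1 / (real n + 1)" using u(2) less_imp_le by blast
    qed
    let ?r = "\<lambda>\<omega>. x \<omega> - P \<omega>"
    have q: "0 \<le> a\<^sup>2 * norm_sq M g - 2 * a * ip M ?r g" for a
    proof -
      have sr: "sqint M ?r" using x sP by simp
      note ip_diff_cmult[OF sr S[OF g], of a]
      then show ?thesis using ge[of a] le by simp
    qed
    show ?thesis
    proof (rule ccontr)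
      assume b: "ip M ?r g \<noteq> 0"
      \<comment> \<open>Adding 1 keeps the denominator positive when \<open>g\<close> has norm 0.
        The step size \<open>ip M ?r g / B\<close> makes the quadratic negative.\<close>
      define B where "B = norm_sq M g + 1"
      have B: "B > 0" "norm_sq M g < B" unfolding B_def using ip_nonneg[of M g] by linarith+
      have "0 \<le> (ip M ?r g / B)\<^sup>2 * norm_sq M g - 2 * (ip M ?r g / B) * ip M ?r g" by (rule q)
      also have "\<dots> < (ip M ?r g / B)\<^sup>2 * B - 2 * (ip M ?r g / B) * ip M ?r g"
        using B b by simp
      also have "\<dots> = - ((ip M ?r g)\<^sup>2 / B)" using B by (simp add: field_simps power2_eq_square)
      finally have "(ip M ?r g)\<^sup>2 / B < 0" by simp
      moreover have "0 < (ip M ?r g)\<^sup>2 / B" using B b by simp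
      ultimately show False by linarith
    qed
  qed
  then show ?thesis using that u(1) P by blast
qed

text \<open>The residual of \<open>f\<close> is orthogonal to \<open>S\<close>, hence to the double
  orthogonal complement, which contains the residual itself. Together with
  \<open>l2conv_cspan\<close> this identifies \<open>cspan\<close> with the mean-square closure of
  the finite span.\<close>

lemma cspan_approx:
  assumes S: "\<And>g. g \<in> S \<Longrightarrow> sqint M g" and f: "f \<in> cspan M S"
  obtains u where "\<And>n. u n \<in> lspan S" "l2conv M u f"
proof -
  obtain u P where u: "\<And>n. u n \<in> lspan S" "l2conv M u P"
    and o: "\<And>g. g \<in> S \<Longrightarrow> ip M (\<lambda>\<omega>. f \<omega> - P \<omega>) g = 0"
    using sqint_projection[OF S cspan_sqint[OF f]] by metis
  have sP: "sqint M P" using u by (simp add: l2conv_def)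
  have sq: "sqint M (\<lambda>\<omega>. f \<omega> - P \<omega>)" using cspan_sqint[OF f] sP by simp
  have P: "P \<in> cspan M S" using u(2) by (rule l2conv_cspan) (intro lspan_cspan u S)
  have "norm_sq M (\<lambda>\<omega>. f \<omega> - P \<omega>) = 0"
    by (rule cspanD[OF cspan_diff[OF f P] sq o])
  then have "AE \<omega> in M. f \<omega> - P \<omega> = 0" by (rule ip_eq_0_AE[OF sq])
  then have "l2conv M u f"
    by (intro l2conv_AE_limit[OF u(2)]) (use cspan_sqint[OF f] in \<open>auto simp: sqint_def\<close>)
  then show ?thesis using that u(1) by blast
qed

section \<open>Gaussian variables and characteristic functions\<close>

text \<open>Dynkin's argument for the signed measure with density \<open>U\<close>. The generator
  may lack the whole space, so complements rely on the separate premise that the total integral is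
  0.\<close>

lemma set_integral_zero_sigma_sets:
  fixes U :: "'a \<Rightarrow> real"
  assumes U: "integrable M U" and G: "Int_stable G" "G \<subseteq> sets M"
    and sp: "(LINT x|M. U x) = 0" and z: "\<And>A. A \<in> G \<Longrightarrow> (LINT x:A|M. U x) = 0"
    and A: "A \<in> sigma_sets (space M) G"
  shows "(LINT x:A|M. U x) = 0"
proof -
  have GP: "G \<subseteq> Pow (space M)" using G(2) sets.sets_into_space by blast
  have sub: "sigma_sets (space M) G \<subseteq> sets M" using G(2) by (rule sets.sigma_sets_subset)
  have si: "set_integrable M B U" if "B \<in> sets M" for B
    unfolding set_integrable_def using integrable_mult_indicator[OF that U] by simp
  show ?thesis
    using G(1) GP A
  proof (induction rule: sigma_sets_induct_disjoint)
    case (compl A)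
    then have A: "A \<in> sets M" using sub by blast
    have "(LINT x:space M|M. U x) = 0" using sp by (simp add: set_integral_space[OF U])
    moreover have "(LINT x:(space M - A) \<union> A|M. U x) = (LINT x:space M - A|M. U x) + (LINT x:A|M. U x)"
      using A by (intro set_integral_Un si) auto
    moreover have "(space M - A) \<union> A = space M" using sets.sets_into_space[OF A] by blast
    ultimately show ?case using compl by simp
  next
    case (union A)
    then have A: "A i \<in> sets M" for i using sub by blast
    have "(LINT x:(\<Union>i. A i)|M. U x) = (\<Sum>i. (LINT x:A i|M. U x))"
      using union(1) A by (intro lebesgue_integral_countable_add si) (auto simp: disjoint_family_on_def)
    then show ?case using union by simp
  qed (simp_all add: z, simp add: set_lebesgue_integral_def)
qed

lemma (in prob_space) sqint_const[intro, simp]: "sqint M (\<lambda>_. c)"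
  by (simp add: sqint_def)

lemma ip_one[simp]: "ip M f (\<lambda>_. 1) = (LINT x|M. f x)" "ip M (\<lambda>_. 1) f = (LINT x|M. f x)"
  by (simp_all add: ip_def)

lemma (in prob_space) sqint_integrable: "sqint M f \<Longrightarrow> integrable M f"
  using sqint_integrable_mult[of M f "\<lambda>_. 1"] by simp

lemma (in prob_space) ip_const_right: "ip M f (\<lambda>_. c) = c * (LINT x|M. f x)"
  by (simp add: ip_def)

text \<open>Normality through the characteristic function, with the variance written as second
  moment minus squared mean. Almost surely constant variables are included, and both sides of the
  identity are continuous in mean square.\<close>

definition gauss_char :: "'a measure \<Rightarrow> ('a \<Rightarrow> real) \<Rightarrow> bool" where
  "gauss_char M \<xi> \<longleftrightarrow> sqint M \<xi> \<and>
     (\<forall>\<theta>. (CLINT \<omega>|M. iexp (\<theta> * \<xi> \<omega>)) =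
        iexp (\<theta> * (LINT \<omega>|M. \<xi> \<omega>)) *
        complex_of_real (exp (- (\<theta>\<^sup>2 * (norm_sq M \<xi> - (LINT \<omega>|M. \<xi> \<omega>)\<^sup>2) / 2))))"

lemma gauss_char_sqint: "gauss_char M \<xi> \<Longrightarrow> sqint M \<xi>" by (simp add: gauss_char_def)

context prob_space
begin

lemma integrable_iexp_real[intro, simp]:
  fixes f :: "'a \<Rightarrow> real"
  shows "f \<in> borel_measurable M \<Longrightarrow> integrable M (\<lambda>x. iexp (f x))"
  by (intro integrable_const_bound[where B=1]) auto

lemma gauss_char_affine:
  assumes "gauss_char M \<xi>" shows "gauss_char M (\<lambda>\<omega>. a + b * \<xi> \<omega>)"
proof -
  have [measurable]: "\<xi> \<in> borel_measurable M" using gauss_char_sqint[OF assms] by (simp add: sqint_def)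
  have sq: "sqint M \<xi>" and i: "integrable M \<xi>"
    using assms gauss_char_sqint sqint_integrable by blast+
  have m: "(LINT \<omega>|M. a + b * \<xi> \<omega>) = a + b * (LINT \<omega>|M. \<xi> \<omega>)" using i by (simp add: prob_space)
  have v: "norm_sq M (\<lambda>\<omega>. a + b * \<xi> \<omega>) - (a + b * (LINT \<omega>|M. \<xi> \<omega>))\<^sup>2
     = b\<^sup>2 * (norm_sq M \<xi> - (LINT \<omega>|M. \<xi> \<omega>)\<^sup>2)"
  proof -
    have "norm_sq M (\<lambda>\<omega>. a + b * \<xi> \<omega>) = a\<^sup>2 + 2 * a * b * (LINT \<omega>|M. \<xi> \<omega>) + b\<^sup>2 * norm_sq M \<xi>"
      using sq by (simp add: ip_simps) (simp add: ip_def prob_space power2_eq_square algebra_simps)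
    then show ?thesis by (simp add: power2_eq_square algebra_simps)
  qed
  have "(CLINT \<omega>|M. iexp (\<theta> * (a + b * \<xi> \<omega>))) = iexp (\<theta> * (a + b * (LINT \<omega>|M. \<xi> \<omega>))) *
    complex_of_real (exp (- (\<theta>\<^sup>2 * (b\<^sup>2 * (norm_sq M \<xi> - (LINT \<omega>|M. \<xi> \<omega>)\<^sup>2)) / 2)))" for \<theta>
  proof -
    have "(CLINT \<omega>|M. iexp (\<theta> * (a + b * \<xi> \<omega>))) = (CLINT \<omega>|M. iexp (\<theta> * a) * iexp ((\<theta> * b) * \<xi> \<omega>))"
      by (intro Bochner_Integration.integral_cong) (auto simp: algebra_simps exp_add)
    also have "\<dots> = iexp (\<theta> * a) * (CLINT \<omega>|M. iexp ((\<theta> * b) * \<xi> \<omega>))"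
      by (intro integral_mult_right_zero)
    also have "\<dots> = iexp (\<theta> * a) * (iexp ((\<theta> * b) * (LINT \<omega>|M. \<xi> \<omega>)) *
        complex_of_real (exp (- ((\<theta> * b)\<^sup>2 * (norm_sq M \<xi> - (LINT \<omega>|M. \<xi> \<omega>)\<^sup>2) / 2))))"
      using assms[unfolded gauss_char_def, THEN conjunct2, rule_format, of "\<theta> * b"] by simp
    also have "\<dots> = iexp (\<theta> * (a + b * (LINT \<omega>|M. \<xi> \<omega>))) *
        complex_of_real (exp (- (\<theta>\<^sup>2 * (b\<^sup>2 * (norm_sq M \<xi> - (LINT \<omega>|M. \<xi> \<omega>)\<^sup>2)) / 2)))"
    proof -
      have "iexp (\<theta> * a) * iexp ((\<theta> * b) * (LINT \<omega>|M. \<xi> \<omega>)) = iexp (\<theta> * (a + b * (LINT \<omega>|M. \<xi> \<omega>)))"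
        by (simp add: exp_add[symmetric] algebra_simps)
      moreover have "(\<theta> * b)\<^sup>2 * (norm_sq M \<xi> - (LINT \<omega>|M. \<xi> \<omega>)\<^sup>2) = \<theta>\<^sup>2 * (b\<^sup>2 * (norm_sq M \<xi> - (LINT \<omega>|M. \<xi> \<omega>)\<^sup>2))"
        by (simp add: power_mult_distrib)
      ultimately show ?thesis by (simp only: mult.assoc[symmetric])
    qed
    finally show ?thesis .
  qed
  then show ?thesis unfolding gauss_char_def m v using sq by simp
qed

lemma gauss_char_AE:
  assumes \<xi>: "gauss_char M \<xi>" and [measurable]: "\<eta> \<in> borel_measurable M" and ae: "AE \<omega> in M. \<eta> \<omega> = \<xi> \<omega>"
  shows "gauss_char M \<eta>"
proof -
  have [measurable]: "\<xi> \<in> borel_measurable M" using gauss_char_sqint[OF \<xi>] by (simp add: sqint_def)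
  have "(LINT \<omega>|M. \<eta> \<omega>) = (LINT \<omega>|M. \<xi> \<omega>)" using ae by (intro integral_cong_AE) auto
  moreover have "norm_sq M \<eta> = norm_sq M \<xi>" using ae by (intro ip_cong_AE) auto
  moreover have "(CLINT \<omega>|M. iexp (\<theta> * \<eta> \<omega>)) = (CLINT \<omega>|M. iexp (\<theta> * \<xi> \<omega>))" for \<theta>
    using ae by (intro integral_cong_AE) auto
  moreover have "sqint M \<eta>" by (rule sqint_AE[OF gauss_char_sqint[OF \<xi>] _ ae]) simp
  ultimately show ?thesis using \<xi> unfolding gauss_char_def by simp
qed

lemma gauss_char_const: "gauss_char M (\<lambda>_. c)"
proof -
  have "norm_sq M (\<lambda>_. c) = c\<^sup>2" by (simp add: ip_def prob_space power2_eq_square)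
  then show ?thesis by (simp add: gauss_char_def prob_space)
qed

text \<open>The case with a density is reduced to the standard normal law by centring and scaling,
  and undone by \<open>gauss_char_affine\<close>.\<close>

lemma gaussian_rv_gauss_char:
  assumes "gaussian_rv M Z" shows "gauss_char M Z"
proof -
  have [measurable]: "Z \<in> borel_measurable M" using assms by (simp add: gaussian_rv_def)
  from assms consider \<mu> where "AE \<omega> in M. Z \<omega> = \<mu>"
    | \<mu> \<sigma> where "\<sigma> > 0" "distributed M lborel Z (\<lambda>x. ennreal (normal_density \<mu> \<sigma> x))"
    unfolding gaussian_rv_def by blast
  then show ?thesis
  proof cases
    case 1
    then show ?thesis by (intro gauss_char_AE[OF gauss_char_const[of \<mu>]]) auto
  next
    case 2
    define W where "W \<omega> = (Z \<omega> - \<mu>) / \<sigma>" for \<omega>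
    have [measurable]: "W \<in> borel_measurable M" unfolding W_def by simp
    have D: "distributed M lborel W std_normal_density"
      using 2 normal_standard_normal_convert[of \<sigma> Z \<mu>] unfolding W_def by simp
    have m: "(LINT \<omega>|M. W \<omega>) = 0" using standard_normal_distributed_expectation[OF D] .
    have i2: "integrable M (\<lambda>x. (W x)\<^sup>2)"
      using distributed_integrable[OF D, of "\<lambda>x. x\<^sup>2"] integrable_std_normal_moment[of 2] by simp
    have v: "norm_sq M W = 1"
      using standard_normal_distributed_variance[OF D] by (simp add: ip_def m power2_eq_square)
    have "(CLINT \<omega>|M. iexp (\<theta> * W \<omega>)) = complex_of_real (exp (- (\<theta>\<^sup>2) / 2))" for \<theta>
    proof -
      have "(CLINT \<omega>|M. iexp (\<theta> * W \<omega>)) = char (distr M lborel W) \<theta>"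
        unfolding char_def by (subst integral_distr) auto
      also have "distr M lborel W = std_normal_distribution"
        using D by (simp add: distributed_def)
      finally show ?thesis by (simp add: char_std_normal_distribution)
    qed
    then have "gauss_char M W" unfolding gauss_char_def m v by (simp add: sqint_def i2)
    from gauss_char_affine[OF this, of \<mu> \<sigma>] show ?thesis
      using 2(1) by (simp add: W_def)
  qed
qed

lemma l2conv_integral:
  assumes "l2conv M u f" shows "(\<lambda>n. LINT \<omega>|M. u n \<omega>) \<longlonglongrightarrow> (LINT \<omega>|M. f \<omega>)"
  using l2conv_ip[OF assms, of "\<lambda>_. 1"] by simp

lemma integral_abs_le_ip:
  assumes "sqint M f" shows "(LINT \<omega>|M. \<bar>f \<omega>\<bar>) \<le> sqrt (norm_sq M f)"
proof -
  have "sqint M (\<lambda>\<omega>. \<bar>f \<omega>\<bar>)" using assms by (auto simp: sqint_def)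
  from ip_abs_le[OF this sqint_const[of 1]] show ?thesis
    by (simp add: prob_space) (simp add: ip_def)
qed

text \<open>Since |exp(ia) - exp(ib)| \<le> |a - b|, characteristic functions converge under
  mean-square convergence, and so do the mean and the second moment on the other side.\<close>

lemma gauss_char_l2conv:
  assumes g: "\<And>n. gauss_char M (u n)" and u: "l2conv M u f" shows "gauss_char M f"
proof -
  have sq: "sqint M f" "sqint M (u n)" for n using u by (auto simp: l2conv_def)
  then have [measurable]: "f \<in> borel_measurable M" "u n \<in> borel_measurable M" for n by (auto simp: sqint_def)
  have "(CLINT \<omega>|M. iexp (\<theta> * f \<omega>)) = iexp (\<theta> * (LINT \<omega>|M. f \<omega>)) *
      complex_of_real (exp (- (\<theta>\<^sup>2 * (norm_sq M f - (LINT \<omega>|M. f \<omega>)\<^sup>2) / 2)))" for \<theta>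
  proof (rule LIMSEQ_unique)
    have lim: "(\<lambda>n. \<bar>\<theta>\<bar> * sqrt (norm_sq M (\<lambda>\<omega>. u n \<omega> - f \<omega>))) \<longlonglongrightarrow> 0"
      using u unfolding l2conv_def by (intro tendsto_eq_intros) auto
    have "(\<lambda>n. (CLINT \<omega>|M. iexp (\<theta> * u n \<omega>)) - (CLINT \<omega>|M. iexp (\<theta> * f \<omega>))) \<longlonglongrightarrow> 0"
    proof (rule Lim_null_comparison[OF _ lim], rule always_eventually, rule allI)
      fix n
      have "norm ((CLINT \<omega>|M. iexp (\<theta> * u n \<omega>)) - (CLINT \<omega>|M. iexp (\<theta> * f \<omega>)))
          = norm (CLINT \<omega>|M. iexp (\<theta> * u n \<omega>) - iexp (\<theta> * f \<omega>))"
        by (subst Bochner_Integration.integral_diff) (auto simp del: of_real_mult)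
      also have "\<dots> \<le> (LINT \<omega>|M. norm (iexp (\<theta> * u n \<omega>) - iexp (\<theta> * f \<omega>)))"
        by (rule integral_norm_bound)
      also have "\<dots> \<le> (LINT \<omega>|M. \<bar>\<theta>\<bar> * \<bar>u n \<omega> - f \<omega>\<bar>)"
      proof (rule integral_mono)
        show "integrable M (\<lambda>\<omega>. norm (iexp (\<theta> * u n \<omega>) - iexp (\<theta> * f \<omega>)))"
          by (intro integrable_norm Bochner_Integration.integrable_diff integrable_iexp_real) auto
        show "integrable M (\<lambda>\<omega>. \<bar>\<theta>\<bar> * \<bar>u n \<omega> - f \<omega>\<bar>)" using sq sqint_integrable by simp
        fix \<omega>
        have "iexp a - iexp b = iexp b * (iexp (a - b) - 1)" for a b :: real
          by (simp add: algebra_simps exp_diff)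
        then have "norm (iexp a - iexp b) \<le> \<bar>a - b\<bar>" for a b :: real
          using iexp_approx1[of "a - b" 0] by (simp add: norm_mult del: of_real_diff)
        from this[of "\<theta> * u n \<omega>" "\<theta> * f \<omega>"] show "norm (iexp (\<theta> * u n \<omega>) - iexp (\<theta> * f \<omega>)) \<le> \<bar>\<theta>\<bar> * \<bar>u n \<omega> - f \<omega>\<bar>"
          by (simp flip: abs_mult right_diff_distrib)
      qed
      also have "\<dots> \<le> \<bar>\<theta>\<bar> * sqrt (norm_sq M (\<lambda>\<omega>. u n \<omega> - f \<omega>))"
        using integral_abs_le_ip[of "\<lambda>\<omega>. u n \<omega> - f \<omega>"] sq by (simp add: mult_left_mono)
      finally show "norm ((CLINT \<omega>|M. iexp (\<theta> * u n \<omega>)) - (CLINT \<omega>|M. iexp (\<theta> * f \<omega>))) \<le> \<dots>" .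
    qed
    then show "(\<lambda>n. (CLINT \<omega>|M. iexp (\<theta> * u n \<omega>))) \<longlonglongrightarrow> (CLINT \<omega>|M. iexp (\<theta> * f \<omega>))"
      using Lim_null by blast
    have "(\<lambda>n. iexp (\<theta> * (LINT \<omega>|M. u n \<omega>)) *
        complex_of_real (exp (- (\<theta>\<^sup>2 * (norm_sq M (u n) - (LINT \<omega>|M. u n \<omega>)\<^sup>2) / 2))))
      \<longlonglongrightarrow> iexp (\<theta> * (LINT \<omega>|M. f \<omega>)) *
        complex_of_real (exp (- (\<theta>\<^sup>2 * (norm_sq M f - (LINT \<omega>|M. f \<omega>)\<^sup>2) / 2)))"
      by (intro tendsto_intros l2conv_integral l2conv_ip2 u) simp_all
    then show "(\<lambda>n. (CLINT \<omega>|M. iexp (\<theta> * u n \<omega>))) \<longlonglongrightarrow> iexp (\<theta> * (LINT \<omega>|M. f \<omega>)) *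
        complex_of_real (exp (- (\<theta>\<^sup>2 * (norm_sq M f - (LINT \<omega>|M. f \<omega>)\<^sup>2) / 2)))"
      using g unfolding gauss_char_def by simp
  qed
  then show ?thesis using sq(1) by (simp add: gauss_char_def)
qed

lemma gauss_char_add_indep:
  assumes U: "gauss_char M U" and V: "gauss_char M V" and ind: "indep_var borel U borel V"
  shows "gauss_char M (\<lambda>\<omega>. U \<omega> + V \<omega>)"
proof -
  have sq: "sqint M U" "sqint M V" using U V by (auto intro: gauss_char_sqint)
  then have [measurable]: "U \<in> borel_measurable M" "V \<in> borel_measurable M" by (auto simp: sqint_def)
  have i: "integrable M U" "integrable M V" using sq sqint_integrable by auto
  have uv: "ip M U V = (LINT \<omega>|M. U \<omega>) * (LINT \<omega>|M. V \<omega>)"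
    unfolding ip_def using ind i by (intro indep_var_lebesgue_integral)
  have v: "norm_sq M (\<lambda>\<omega>. U \<omega> + V \<omega>) - (LINT \<omega>|M. U \<omega> + V \<omega>)\<^sup>2
      = (norm_sq M U - (LINT \<omega>|M. U \<omega>)\<^sup>2) + (norm_sq M V - (LINT \<omega>|M. V \<omega>)\<^sup>2)"
    using sq i uv by (simp add: ip_simps ip_commute[of M V U] power2_eq_square algebra_simps)
  have c: "(CLINT \<omega>|M. iexp (\<theta> * f \<omega>)) = char (distr M borel f) \<theta>" if "f \<in> borel_measurable M" for f \<theta>
    unfolding char_def using that by (subst integral_distr) auto
  have "(CLINT \<omega>|M. iexp (\<theta> * (U \<omega> + V \<omega>))) =
      iexp (\<theta> * ((LINT \<omega>|M. U \<omega>) + (LINT \<omega>|M. V \<omega>))) *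
      complex_of_real (exp (- (\<theta>\<^sup>2 * ((norm_sq M U - (LINT \<omega>|M. U \<omega>)\<^sup>2) + (norm_sq M V - (LINT \<omega>|M. V \<omega>)\<^sup>2)) / 2)))" for \<theta>
  proof -
    have e1: "iexp (\<theta> * (a + b)) = iexp (\<theta> * a) * iexp (\<theta> * b)" for a b :: real
      by (simp add: distrib_left exp_add)
    have e2: "exp (- (\<theta>\<^sup>2 * (a + b) / 2)) = exp (- (\<theta>\<^sup>2 * a / 2)) * exp (- (\<theta>\<^sup>2 * b / 2))" for a b :: real
      by (simp add: exp_add[symmetric] distrib_left add_divide_distrib)
    have e0: "(CLINT \<omega>|M. iexp (\<theta> * (U \<omega> + V \<omega>))) = (CLINT \<omega>|M. iexp (\<theta> * U \<omega>)) * (CLINT \<omega>|M. iexp (\<theta> * V \<omega>))"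
      using char_distr_add[OF ind, of \<theta>]
      by (simp only: c borel_measurable_add \<open>U \<in> borel_measurable M\<close> \<open>V \<in> borel_measurable M\<close>)
    have hUV: "(CLINT \<omega>|M. iexp (\<theta> * U \<omega>)) = iexp (\<theta> * (LINT \<omega>|M. U \<omega>)) * complex_of_real (exp (- (\<theta>\<^sup>2 * (norm_sq M U - (LINT \<omega>|M. U \<omega>)\<^sup>2) / 2)))"
      "(CLINT \<omega>|M. iexp (\<theta> * V \<omega>)) = iexp (\<theta> * (LINT \<omega>|M. V \<omega>)) * complex_of_real (exp (- (\<theta>\<^sup>2 * (norm_sq M V - (LINT \<omega>|M. V \<omega>)\<^sup>2) / 2)))"
      using U V unfolding gauss_char_def by blast+
    show ?thesis unfolding e0 unfolding hUV e1 e2 of_real_mult[of "exp _"] by (simp only: mult_ac)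
  qed
  then show ?thesis unfolding gauss_char_def v using sq i by simp
qed

text \<open>Compare the expansions to first order in \<open>a\<close> of both sides of
  \<open>E exp (i (a U + V)) = E exp (i V) exp (- a\<^sup>2 E U\<^sup>2 / 2)\<close>.\<close>

lemma integral_mult_iexp_eq_0:
  assumes g: "\<And>a. gauss_char M (\<lambda>\<omega>. a * U \<omega> + V \<omega>)" and U: "sqint M U" and V: "sqint M V"
    and m: "(LINT \<omega>|M. U \<omega>) = 0" and o: "ip M U V = 0"
  shows "(CLINT \<omega>|M. U \<omega> * iexp (V \<omega>)) = 0"
proof -
  have [measurable]: "U \<in> borel_measurable M" "V \<in> borel_measurable M" using U V by (auto simp: sqint_def)
  have iU: "integrable M U" "integrable M V" using U V sqint_integrable by auto
  define w where "w = norm_sq M U"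
  have w: "w \<ge> 0" unfolding w_def by simp
  define I where "I = (CLINT \<omega>|M. U \<omega> * iexp (V \<omega>))"
  define F where "F a = (CLINT \<omega>|M. iexp (a * U \<omega> + V \<omega>))" for a :: real
  have iUV: "integrable M (\<lambda>\<omega>. U \<omega> * iexp (V \<omega>))"
    by (rule Bochner_Integration.integrable_bound[OF iU(1)]) (auto simp: norm_mult)
  have F: "F a = F 0 * complex_of_real (exp (- (a\<^sup>2 * w / 2)))" for a
  proof -
    have m1: "(LINT \<omega>|M. a * U \<omega> + V \<omega>) = (LINT \<omega>|M. V \<omega>)" for a using iU m by simp
    have v1: "norm_sq M (\<lambda>\<omega>. a * U \<omega> + V \<omega>) = a\<^sup>2 * w + norm_sq M V" for a
      using U V o unfolding w_def by (simp add: ip_simps ip_commute[of M V U] power2_eq_square)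
    have "F a = iexp (LINT \<omega>|M. V \<omega>) * complex_of_real (exp (- ((a\<^sup>2 * w + norm_sq M V - (LINT \<omega>|M. V \<omega>)\<^sup>2) / 2)))" for a
      using g[of a, unfolded gauss_char_def m1 v1, THEN conjunct2, rule_format, of 1] unfolding F_def by simp
    from this[of a] this[of 0] show ?thesis
      by (simp add: exp_add[symmetric] diff_divide_distrib add_divide_distrib flip: of_real_mult)
  qed
  have nF0: "norm (F 0) \<le> 1"
  proof -
    have "norm (F 0) \<le> (LINT \<omega>|M. norm (iexp (V \<omega>)))" unfolding F_def using integral_norm_bound[of M "\<lambda>\<omega>. iexp (V \<omega>)"] by simp
    also have "\<dots> = 1" by (simp add: prob_space)
    finally show ?thesis .
  qed
  \<comment> \<open>The Gaussian formula bounds \<open>F a - F 0\<close>, and Taylor's formula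
    bounds the remainder, each by a^2 w / 2 in norm. The first-order term
    \<open>\<i> * a * I\<close> is thus at most a^2 w; dividing by a and making a small leaves I =
    0.\<close>
  have "norm I \<le> a * w" if a: "a > 0" for a :: real
  proof -
    have i1: "integrable M (\<lambda>\<omega>. iexp (a * U \<omega> + V \<omega>))" and i2: "integrable M (\<lambda>\<omega>. iexp (V \<omega>))"
      by (intro integrable_iexp_real; simp)+
    have i3: "integrable M (\<lambda>\<omega>. \<i> * a * (U \<omega> * iexp (V \<omega>)))" using iUV by (rule integrable_mult_right)
    have "F a - F 0 - \<i> * a * I = (CLINT \<omega>|M. iexp (a * U \<omega> + V \<omega>) - iexp (V \<omega>) - \<i> * a * (U \<omega> * iexp (V \<omega>)))"
      unfolding F_def I_def using iUV
      by (simp only: Bochner_Integration.integral_diff Bochner_Integration.integrable_diff i1 i2 i3 integral_mult_right_zero) simp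
    then have "norm (F a - F 0 - \<i> * a * I) \<le> (LINT \<omega>|M. norm (iexp (a * U \<omega> + V \<omega>) - iexp (V \<omega>) - \<i> * a * (U \<omega> * iexp (V \<omega>))))"
      by (simp only: integral_norm_bound)
    also have "\<dots> \<le> (LINT \<omega>|M. a\<^sup>2 / 2 * (U \<omega>)\<^sup>2)"
    proof (rule integral_mono)
      show "integrable M (\<lambda>\<omega>. norm (iexp (a * U \<omega> + V \<omega>) - iexp (V \<omega>) - \<i> * a * (U \<omega> * iexp (V \<omega>))))"
        by (intro integrable_norm Bochner_Integration.integrable_diff i1 i2 i3)
      show "integrable M (\<lambda>\<omega>. a\<^sup>2 / 2 * (U \<omega>)\<^sup>2)" using U by (simp add: sqint_def)
      fix \<omega>
      have "iexp (a * U \<omega> + V \<omega>) - iexp (V \<omega>) - \<i> * a * (U \<omega> * iexp (V \<omega>))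
          = iexp (V \<omega>) * (iexp (a * U \<omega>) - (1 + \<i> * (a * U \<omega>)))"
      proof -
        have "iexp (a * U \<omega> + V \<omega>) = iexp (a * U \<omega>) * iexp (V \<omega>)" by (simp add: distrib_left exp_add)
        then show ?thesis by (simp only:) (simp only: ring_distribs mult_1_left mult_1_right mult_ac of_real_mult diff_diff_eq)
      qed
      moreover have "norm (iexp (a * U \<omega>) - (1 + \<i> * (a * U \<omega>))) \<le> a\<^sup>2 / 2 * (U \<omega>)\<^sup>2"
      proof -
        have "(\<Sum>k\<le>1. (\<i> * complex_of_real (a * U \<omega>)) ^ k / fact k) = 1 + \<i> * (a * U \<omega>)" by simp
        with iexp_approx1[of "a * U \<omega>" 1] have "norm (iexp (a * U \<omega>) - (1 + \<i> * (a * U \<omega>))) \<le> \<bar>a * U \<omega>\<bar> ^ Suc 1 / fact (Suc 1)"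
          by (simp only:)
        also have "\<dots> = a\<^sup>2 / 2 * (U \<omega>)\<^sup>2" unfolding Suc_1 power2_abs by (simp add: power_mult_distrib)
        finally show ?thesis .
      qed
      ultimately show "norm (iexp (a * U \<omega> + V \<omega>) - iexp (V \<omega>) - \<i> * a * (U \<omega> * iexp (V \<omega>))) \<le> a\<^sup>2 / 2 * (U \<omega>)\<^sup>2"
        by (simp only: norm_mult norm_exp_i_times mult_1_left)
    qed
    also have "\<dots> = a\<^sup>2 / 2 * w" unfolding w_def ip_def by (simp add: power2_eq_square)
    finally have 1: "norm (F a - F 0 - \<i> * a * I) \<le> a\<^sup>2 / 2 * w" .
    have "F a - F 0 = F 0 * complex_of_real (exp (- (a\<^sup>2 * w / 2)) - 1)"
      by (subst F) (simp add: algebra_simps)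
    then have "norm (F a - F 0) = norm (F 0) * \<bar>exp (- (a\<^sup>2 * w / 2)) - 1\<bar>" by (simp add: norm_mult del: of_real_diff)
    also have "\<dots> \<le> 1 * \<bar>exp (- (a\<^sup>2 * w / 2)) - 1\<bar>" using nF0 by (intro mult_right_mono) auto
    also have "\<dots> \<le> a\<^sup>2 * w / 2"
    proof -
      have "0 \<le> a\<^sup>2 * w / 2" using w by simp
      moreover from this have "exp (- (a\<^sup>2 * w / 2)) \<le> 1" by simp
      ultimately show ?thesis using exp_ge_add_one_self[of "- (a\<^sup>2 * w / 2)"]
        unfolding mult_1_left abs_le_iff by linarith
    qed
    finally have 2: "norm (F a - F 0) \<le> a\<^sup>2 * w / 2" .
    have "a * norm I = norm (\<i> * a * I)" using a by (simp add: norm_mult)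
    also have "\<dots> \<le> norm (F a - F 0) + norm (F a - F 0 - \<i> * a * I)"
      using norm_triangle_ineq4[of "F a - F 0" "F a - F 0 - \<i> * a * I"] by simp
    also have "\<dots> \<le> a * (a * w)" using 1 2 by (simp add: power2_eq_square)
    finally show ?thesis using a by simp
  qed
  then have le: "norm I \<le> a * w" if "a > 0" for a using that by blast
  have "norm I \<le> 0"
  proof (rule ccontr)
    assume n: "\<not> norm I \<le> 0"
    have "norm I \<le> (norm I / (2 * (w + 1))) * w" using n w by (intro le) auto
    also have "\<dots> \<le> (norm I / (2 * (w + 1))) * (w + 1)" using w by (intro mult_left_mono) auto
    also have "\<dots> = norm I / 2" using w by (simp add: field_simps)
    finally show False using n by simp
  qed
  then show ?thesis unfolding I_def by simp
qed

section \<open>Fourier uniqueness and integrals over generated sigma-algebras\<close>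

lemma set_integral_eq_0_of_char:
  fixes W V :: "'a \<Rightarrow> real"
  assumes W: "integrable M W" and V[measurable]: "V \<in> borel_measurable M"
    and z: "\<And>\<theta>. (CLINT \<omega>|M. W \<omega> * iexp (\<theta> * V \<omega>)) = 0" and A: "A \<in> sets borel"
  shows "(LINT \<omega>|M. W \<omega> * indicator A (V \<omega>)) = 0"
proof -
  have [measurable]: "W \<in> borel_measurable M" "A \<in> sets borel" using W A by auto
  \<comment> \<open>Weighting by the positive and by the negative part of \<open>W\<close> gives,
    after normalisation, two probability laws of \<open>V\<close> with the same characteristic
    function; Levy's uniqueness theorem identifies them.\<close>
  define p where "p \<omega> = max 0 (W \<omega>)" for \<omega>
  define q where "q \<omega> = max 0 (- W \<omega>)" for \<omega>
  have pq: "W \<omega> = p \<omega> - q \<omega>" "0 \<le> p \<omega>" "0 \<le> q \<omega>" for \<omega> by (auto simp: p_def q_def)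
  have i: "integrable M p" "integrable M q" unfolding p_def q_def using W by auto
  have [measurable]: "p \<in> borel_measurable M" "q \<in> borel_measurable M" unfolding p_def q_def by auto
  have ie: "integrable M (\<lambda>\<omega>. f \<omega> * iexp (\<theta> * V \<omega>))" if "integrable M f" for f :: "'a \<Rightarrow> real" and \<theta>
    by (rule Bochner_Integration.integrable_bound[OF that]) (use that in \<open>auto simp: norm_mult\<close>)
  have ind: "integrable M (\<lambda>\<omega>. f \<omega> * indicator A (V \<omega>))" if "integrable M f" for f :: "'a \<Rightarrow> real"
    by (rule Bochner_Integration.integrable_bound[OF that]) (use that in \<open>auto simp: indicator_def\<close>)
  have eq: "(CLINT \<omega>|M. p \<omega> * iexp (\<theta> * V \<omega>)) = (CLINT \<omega>|M. q \<omega> * iexp (\<theta> * V \<omega>))" for \<theta>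
  proof -
    have "(CLINT \<omega>|M. W \<omega> * iexp (\<theta> * V \<omega>)) = (CLINT \<omega>|M. p \<omega> * iexp (\<theta> * V \<omega>) - q \<omega> * iexp (\<theta> * V \<omega>))"
      by (simp add: pq(1) left_diff_distrib)
    also have "\<dots> = (CLINT \<omega>|M. p \<omega> * iexp (\<theta> * V \<omega>)) - (CLINT \<omega>|M. q \<omega> * iexp (\<theta> * V \<omega>))"
      by (intro Bochner_Integration.integral_diff ie i)
    finally show ?thesis using z[of \<theta>] by simp
  qed
  define c where "c = (LINT \<omega>|M. p \<omega>)"
  have "complex_of_real (LINT \<omega>|M. p \<omega>) = complex_of_real (LINT \<omega>|M. q \<omega>)"
    using eq[of 0] by simp
  then have c: "(LINT \<omega>|M. q \<omega>) = c" by (simp add: c_def)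
  have "c \<ge> 0" unfolding c_def using pq by simp
  have main: "(LINT \<omega>|M. p \<omega> * indicator A (V \<omega>)) = (LINT \<omega>|M. q \<omega> * indicator A (V \<omega>))"
  proof (cases "c = 0")
    case True
    \<comment> \<open>A total mass of 0 cannot be normalised, but then both parts vanish almost
      everywhere.\<close>
    have "AE \<omega> in M. p \<omega> = 0" "AE \<omega> in M. q \<omega> = 0"
      using integral_nonneg_eq_0_iff_AE[OF i(1)] integral_nonneg_eq_0_iff_AE[OF i(2)] pq True c c_def by auto
    then show ?thesis by (intro integral_cong_AE) auto
  next
    case False
    then have c0: "c > 0" using \<open>c \<ge> 0\<close> by simp
    define D where "D f = distr (density M (\<lambda>\<omega>. f \<omega> / c)) borel V" for f :: "'a \<Rightarrow> real"
    have rd: "real_distribution (D f)" and ch: "char (D f) \<theta> = (CLINT \<omega>|M. f \<omega> * iexp (\<theta> * V \<omega>)) / c"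
      and ms: "measure (D f) A = (LINT \<omega>|M. f \<omega> * indicator A (V \<omega>)) / c"
      if f: "integrable M f" "\<And>\<omega>. 0 \<le> f \<omega>" "(LINT \<omega>|M. f \<omega>) = c" for f \<theta>
    proof -
      have [measurable]: "f \<in> borel_measurable M" using f by auto
      have "emeasure (density M (\<lambda>\<omega>. f \<omega> / c)) (space M) = (\<integral>\<^sup>+\<omega>. ennreal (f \<omega> / c) \<partial>M)"
        by (simp add: emeasure_density cong: nn_integral_cong)
      also have "\<dots> = 1" using f c0 by (subst nn_integral_eq_integral) auto
      finally interpret N: prob_space "density M (\<lambda>\<omega>. f \<omega> / c)" by (intro prob_spaceI) simp
      show "real_distribution (D f)" unfolding D_def by (rule N.real_distribution_distr) simp
      then interpret R: real_distribution "D f" .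
      show "char (D f) \<theta> = (CLINT \<omega>|M. f \<omega> * iexp (\<theta> * V \<omega>)) / c"
        unfolding char_def D_def using f c0
        by (subst integral_distr, simp, simp, subst integral_density) (auto simp: scaleR_conv_of_real)
      have "measure (D f) A = (LINT x|D f. indicator A x)" by simp
      also have "\<dots> = (LINT \<omega>|M. (f \<omega> / c) * indicator A (V \<omega>))"
        unfolding D_def using f c0
        by (subst integral_distr, simp, simp, subst integral_density) auto
      finally show "measure (D f) A = (LINT \<omega>|M. f \<omega> * indicator A (V \<omega>)) / c" by simp
    qed
    have "D p = D q"
      using rd ch i pq c eq by (intro Levy_uniqueness) (auto simp: c_def fun_eq_iff)
    then show ?thesis using ms[of p] ms[of q] i pq c c0 by (simp add: c_def)
  qed
  have "(LINT \<omega>|M. W \<omega> * indicator A (V \<omega>)) = (LINT \<omega>|M. p \<omega> * indicator A (V \<omega>) - q \<omega> * indicator A (V \<omega>))"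
    by (simp add: pq(1) left_diff_distrib)
  also have "\<dots> = 0" using main ind i by simp
  finally show ?thesis .
qed

text \<open>Complex weights arise because \<open>integral_prod_indicator_eq_0\<close> multiplies the
  weight by exponentials. Conjugation turns \<theta> into -\<theta>, which separates the real from
  the imaginary part.\<close>

lemma set_integral_eq_0_of_char_complex:
  fixes W :: "'a \<Rightarrow> complex" and V :: "'a \<Rightarrow> real"
  assumes W: "integrable M W" and V[measurable]: "V \<in> borel_measurable M"
    and z: "\<And>\<theta>. (CLINT \<omega>|M. W \<omega> * iexp (\<theta> * V \<omega>)) = 0" and A: "A \<in> sets borel"
  shows "(CLINT \<omega>|M. W \<omega> * indicator A (V \<omega>)) = 0"
proof -
  have [measurable]: "W \<in> borel_measurable M" "A \<in> sets borel" using W A by auto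
  have i: "integrable M (\<lambda>\<omega>. Re (W \<omega>))" "integrable M (\<lambda>\<omega>. Im (W \<omega>))" using W by auto
  have ie: "integrable M (\<lambda>\<omega>. f \<omega> * iexp (\<theta> * V \<omega>))" if "integrable M f" for f :: "'a \<Rightarrow> real" and \<theta>
    by (rule Bochner_Integration.integrable_bound[OF that]) (use that in \<open>auto simp: norm_mult\<close>)
  have ic: "integrable M (\<lambda>\<omega>. W \<omega> * indicator A (V \<omega>))"
    by (rule Bochner_Integration.integrable_bound[OF W]) (auto simp: indicator_def)
  have RI: "(CLINT \<omega>|M. Re (W \<omega>) * iexp (\<theta> * V \<omega>)) + \<i> * (CLINT \<omega>|M. Im (W \<omega>) * iexp (\<theta> * V \<omega>)) = 0"
    (is "?R \<theta> + \<i> * ?I \<theta> = 0") for \<theta>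
  proof -
    have "(CLINT \<omega>|M. W \<omega> * iexp (\<theta> * V \<omega>)) = (CLINT \<omega>|M. Re (W \<omega>) * iexp (\<theta> * V \<omega>) + \<i> * (Im (W \<omega>) * iexp (\<theta> * V \<omega>)))"
      by (intro Bochner_Integration.integral_cong refl) (metis complex_eq distrib_right mult.assoc)
    also have "\<dots> = ?R \<theta> + \<i> * ?I \<theta>"
      using ie[OF i(1)] ie[OF i(2)] by simp
    finally show ?thesis using z by simp
  qed
  have cnj: "cnj (CLINT \<omega>|M. f \<omega> * iexp ((-\<theta>) * V \<omega>)) = (CLINT \<omega>|M. f \<omega> * iexp (\<theta> * V \<omega>))" for f :: "'a \<Rightarrow> real" and \<theta>
    by (subst Bochner_Integration.integral_cnj[symmetric], intro Bochner_Integration.integral_cong) (auto simp: exp_cnj)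
  have RI': "?R \<theta> - \<i> * ?I \<theta> = 0" for \<theta>
  proof -
    have "cnj (?R (-\<theta>) + \<i> * ?I (-\<theta>)) = 0" using arg_cong[OF RI[of "-\<theta>"], of cnj] by (simp only: complex_cnj_zero)
    then show ?thesis by (simp only: complex_cnj_add complex_cnj_mult cnj) simp
  qed
  have *: "a = 0 \<and> b = 0" if "a + \<i> * b = 0" "a - \<i> * b = 0" for a b :: complex
  proof -
    have "2 * a = (a + \<i> * b) + (a - \<i> * b)" by simp
    then have "a = 0" unfolding that by simp
    then show ?thesis using that by simp
  qed
  have "?R \<theta> = 0" "?I \<theta> = 0" for \<theta>
    using *[OF RI[of \<theta>] RI'[of \<theta>]] by blast+
  then have "(LINT \<omega>|M. Re (W \<omega>) * indicator A (V \<omega>)) = 0" "(LINT \<omega>|M. Im (W \<omega>) * indicator A (V \<omega>)) = 0"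
    using i A by (auto intro!: set_integral_eq_0_of_char)
  moreover have "Re (W \<omega> * indicator A (V \<omega>)) = Re (W \<omega>) * indicator A (V \<omega>)"
     "Im (W \<omega> * indicator A (V \<omega>)) = Im (W \<omega>) * indicator A (V \<omega>)" for \<omega>
    by (auto simp: indicator_def)
  ultimately show ?thesis by (simp add: complex_eq_iff integral_Re[OF ic, symmetric] integral_Im[OF ic, symmetric])
qed

text \<open>Exponentials are traded for indicators one variable at a time: the factor
  \<open>iexp (\<theta> * V j \<omega>)\<close> is absorbed into the weight, the induction
  hypothesis treats the other variables, and one-dimensional uniqueness removes the remaining
  exponential.\<close>

lemma integral_prod_indicator_eq_0:
  fixes W :: "'a \<Rightarrow> complex" and V :: "'i \<Rightarrow> 'a \<Rightarrow> real"
  assumes "finite J" "integrable M W" "\<And>i. i \<in> J \<Longrightarrow> V i \<in> borel_measurable M"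
    "\<And>i. i \<in> J \<Longrightarrow> A i \<in> sets borel"
    "\<And>c. (CLINT \<omega>|M. W \<omega> * iexp (\<Sum>i\<in>J. c i * V i \<omega>)) = 0"
  shows "(CLINT \<omega>|M. W \<omega> * (\<Prod>i\<in>J. indicator (A i) (V i \<omega>))) = 0"
  using assms
proof (induction J arbitrary: W rule: finite_induct)
  case empty
  from empty(4)[of "\<lambda>_. 0"] show ?case by simp
next
  case (insert j J)
  have [measurable]: "W \<in> borel_measurable M" "V j \<in> borel_measurable M" "A j \<in> sets borel"
    and VJ: "\<And>i. i \<in> J \<Longrightarrow> V i \<in> borel_measurable M" "\<And>i. i \<in> J \<Longrightarrow> A i \<in> sets borel"
    using insert.prems by auto
  have [measurable]: "(\<lambda>\<omega>. \<Prod>i\<in>J. indicator (A i) (V i \<omega>) :: complex) \<in> borel_measurable M"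
    by (intro borel_measurable_prod measurable_compose[OF VJ(1)] borel_measurable_indicator VJ(2))
  have iW: "integrable M (\<lambda>\<omega>. W \<omega> * g \<omega>)" if "g \<in> borel_measurable M" "\<And>\<omega>. norm (g \<omega>) \<le> 1" for g :: "'a \<Rightarrow> complex"
    by (rule Bochner_Integration.integrable_bound[OF insert.prems(1)])
       (use that in \<open>auto simp: norm_mult mult_left_le\<close>)
  have n1: "norm (\<Prod>i\<in>J. indicator (A i) (V i \<omega>) :: complex) \<le> 1" for \<omega>
    unfolding prod_norm[symmetric] by (intro prod_le_1) (auto simp: indicator_def)
  have "(CLINT \<omega>|M. (W \<omega> * iexp (\<theta> * V j \<omega>)) * (\<Prod>i\<in>J. indicator (A i) (V i \<omega>))) = 0" for \<theta>
  proof (rule insert.IH)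
    show "integrable M (\<lambda>\<omega>. W \<omega> * iexp (\<theta> * V j \<omega>))" by (rule iW) auto
    fix c :: "'i \<Rightarrow> real"
    have "(\<Sum>i\<in>insert j J. (c(j := \<theta>)) i * V i \<omega>) = \<theta> * V j \<omega> + (\<Sum>i\<in>J. c i * V i \<omega>)" for \<omega>
      using insert(1,2) by (subst sum.insert) (auto intro!: sum.cong)
    then show "(CLINT \<omega>|M. W \<omega> * iexp (\<theta> * V j \<omega>) * iexp (\<Sum>i\<in>J. c i * V i \<omega>)) = 0"
      using insert.prems(4)[of "c(j := \<theta>)"] by (simp add: distrib_left exp_add mult.assoc)
  qed (use VJ in auto)
  then have "(CLINT \<omega>|M. (W \<omega> * (\<Prod>i\<in>J. indicator (A i) (V i \<omega>))) * iexp (\<theta> * V j \<omega>)) = 0" for \<theta>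
    by (simp add: mult_ac)
  then have "(CLINT \<omega>|M. (W \<omega> * (\<Prod>i\<in>J. indicator (A i) (V i \<omega>))) * indicator (A j) (V j \<omega>)) = 0"
    using iW n1 by (intro set_integral_eq_0_of_char_complex) auto
  then show ?case using insert(1,2) by (simp add: mult_ac)
qed

text \<open>The products of indicators in \<open>integral_prod_indicator_eq_0\<close> are the
  indicators of finite-dimensional cylinders, a generator closed under intersection.\<close>

lemma set_integral_generated_sigma_eq_0:
  fixes U :: "'a \<Rightarrow> real"
  assumes U: "integrable M U" and S: "\<And>g. g \<in> S \<Longrightarrow> g \<in> borel_measurable M"
    and z: "\<And>v. v \<in> lspan S \<Longrightarrow> (CLINT \<omega>|M. U \<omega> * iexp (v \<omega>)) = 0"
    and B: "B \<in> sets (generated_sigma M S)"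
  shows "(LINT \<omega>:B|M. U \<omega>) = 0"
proof -
  define G where "G = {{\<omega> \<in> space M. \<forall>g\<in>J. g \<omega> \<in> A g} | J A. finite J \<and> J \<subseteq> S \<and> (\<forall>g. A g \<in> sets (borel :: real measure))}"
  have GM: "G \<subseteq> sets M"
  proof
    fix C assume "C \<in> G"
    then obtain J A where C: "C = {\<omega> \<in> space M. \<forall>g\<in>J. g \<omega> \<in> A g}" and J: "finite J" "J \<subseteq> S" "\<forall>g. A g \<in> sets (borel :: real measure)"
      unfolding G_def mem_Collect_eq by (elim exE conjE) (rule that; assumption)
    have "{\<omega> \<in> space M. g \<omega> \<in> A g} \<in> sets M" if "g \<in> J" for g
    proof -
      have "g -` A g \<inter> space M \<in> sets M" using J S that by (intro measurable_sets) auto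
      moreover have "g -` A g \<inter> space M = {\<omega> \<in> space M. g \<omega> \<in> A g}" by auto
      ultimately show ?thesis by simp
    qed
    then show "C \<in> sets M" unfolding C using J by (intro sets.sets_Collect_finite_All) auto
  qed
  have gs: "sets (generated_sigma M S) \<subseteq> sigma_sets (space M) G"
  proof -
    have "(\<Union>Z\<in>S. {Z -` A \<inter> space M | A. A \<in> sets borel}) \<subseteq> G"
    proof safe
      fix Z A assume "Z \<in> S" "A \<in> sets (borel :: real measure)"
      then show "Z -` A \<inter> space M \<in> G" unfolding G_def by (intro CollectI exI[of _ "{Z}"] exI[of _ "\<lambda>_. A"]) auto
    qed
    from sigma_sets_mono'[OF this] show ?thesis unfolding generated_sigma_def
      by (subst sets_measure_of) auto
  qed
  have ist: "Int_stable G"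
  proof (rule Int_stableI)
    fix a b assume "a \<in> G" "b \<in> G"
    from \<open>a \<in> G\<close> obtain J A where C: "a = {\<omega> \<in> space M. \<forall>g\<in>J. g \<omega> \<in> A g}"
      and J: "finite J" "J \<subseteq> S" "\<forall>g. A g \<in> sets (borel :: real measure)"
      unfolding G_def mem_Collect_eq by (elim exE conjE) (rule that; assumption)
    from \<open>b \<in> G\<close> obtain J' A' where C': "b = {\<omega> \<in> space M. \<forall>g\<in>J'. g \<omega> \<in> A' g}"
      and J': "finite J'" "J' \<subseteq> S" "\<forall>g. A' g \<in> sets (borel :: real measure)"
      unfolding G_def mem_Collect_eq by (elim exE conjE) (rule that; assumption)
    \<comment> \<open>A variable constrained by only one of the two cylinders receives UNIV from the
      other.\<close>
    define A'' where "A'' g = (if g \<in> J then A g else UNIV) \<inter> (if g \<in> J' then A' g else UNIV)" for g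
    have "x \<in> A'' g \<longleftrightarrow> (g \<in> J \<longrightarrow> x \<in> A g) \<and> (g \<in> J' \<longrightarrow> x \<in> A' g)" for x g by (simp add: A''_def)
    then have "a \<inter> b = {\<omega> \<in> space M. \<forall>g\<in>J \<union> J'. g \<omega> \<in> A'' g}" unfolding C C' by (simp only:) blast
    moreover have "A'' g \<in> sets borel" for g unfolding A''_def using J(3) J'(3) by (intro sets.Int) auto
    ultimately show "a \<inter> b \<in> G" unfolding G_def
      by (intro CollectI exI[of _ "J \<union> J'"] exI[of _ A''] conjI) (use J J' in auto)
  qed
  have U0: "(LINT \<omega>|M. U \<omega>) = 0"
  proof -
    have "complex_of_real (LINT \<omega>|M. U \<omega>) = 0"
      using z[OF lspan_zero] by simp
    then show ?thesis by simp
  qed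
  show ?thesis
  proof (rule set_integral_zero_sigma_sets[OF U ist GM U0])
    show "B \<in> sigma_sets (space M) G" using B gs by blast
    fix C assume "C \<in> G"
    then obtain J A where C: "C = {\<omega> \<in> space M. \<forall>g\<in>J. g \<omega> \<in> A g}" and J: "finite J" "J \<subseteq> S" "\<forall>g. A g \<in> sets (borel :: real measure)"
      unfolding G_def mem_Collect_eq by (elim exE conjE) (rule that; assumption)
    have "(CLINT \<omega>|M. complex_of_real (U \<omega>) * (\<Prod>g\<in>J. indicator (A g) (g \<omega>))) = 0"
    proof (rule integral_prod_indicator_eq_0[where V = "\<lambda>g. g"])
      fix c
      have "(\<lambda>\<omega>. \<Sum>g\<in>J. c g * g \<omega>) \<in> lspan S"
        using J by (intro lspan_sum lspan_cmult lspan_base) auto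
      from z[OF this] show "(CLINT \<omega>|M. complex_of_real (U \<omega>) * iexp (\<Sum>g\<in>J. c g * g \<omega>)) = 0" .
    next
      show "integrable M (\<lambda>\<omega>. complex_of_real (U \<omega>))" using U by simp
    qed (use J S in blast)+
    note prod0 = this
    have "complex_of_real (U \<omega>) * (\<Prod>g\<in>J. indicator (A g) (g \<omega>)) = complex_of_real (indicator C \<omega> * U \<omega>)"
      if "\<omega> \<in> space M" for \<omega>
    proof (cases "\<forall>g\<in>J. g \<omega> \<in> A g")
      case True
      then show ?thesis using that by (simp add: C indicator_def prod.neutral)
    next
      case False
      then obtain g where "g \<in> J" "g \<omega> \<notin> A g" by blast
      then have "(\<Prod>g\<in>J. indicator (A g) (g \<omega>) :: complex) = 0" using J(1) by (intro prod_zero bexI[of _ g]) auto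
      then show ?thesis using False by (simp add: C)
    qed
    then have "(CLINT \<omega>|M. complex_of_real (U \<omega>) * (\<Prod>g\<in>J. indicator (A g) (g \<omega>)))
        = (CLINT \<omega>|M. complex_of_real (indicator C \<omega> * U \<omega>))"
      by (intro Bochner_Integration.integral_cong refl)
    with prod0 have "(CLINT \<omega>|M. complex_of_real (indicator C \<omega> * U \<omega>)) = 0" by simp
    then have "complex_of_real (LINT \<omega>|M. indicator C \<omega> * U \<omega>) = 0" by (simp only: integral_complex_of_real)
    then show "(LINT \<omega>:C|M. U \<omega>) = 0" by (simp add: set_lebesgue_integral_def)
  qed
qed

end

section \<open>The Wiener integral\<close>

lemma lspan_imageE:
  assumes "f \<in> lspan (v ` I)"
  obtains J c where "finite J" "J \<subseteq> I" "f = (\<lambda>x. \<Sum>i\<in>J. c i * v i x)"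
proof -
  from assms have "\<exists>J c. finite J \<and> J \<subseteq> I \<and> f = (\<lambda>x. \<Sum>i\<in>J. c i * v i x)"
  proof induction
    case lspan_zero
    then show ?case by (intro exI[of _ "{}"]) auto
  next
    case (lspan_step f g a)
    then obtain J c i where J: "finite J" "J \<subseteq> I" "f = (\<lambda>x. \<Sum>i\<in>J. c i * v i x)" and i: "i \<in> I" "g = v i" by blast
    \<comment> \<open>The old coefficients are arbitrary outside \<open>J\<close> and are masked
      there; the new index \<open>i\<close> may or may not already belong to
      \<open>J\<close>.\<close>
    define c' where "c' j = (if j \<in> J then c j else 0) + (if j = i then a else 0)" for j
    have "(\<Sum>j\<in>insert i J. c' j * v j x) = f x + a * g x" for x
    proof -
      have "(\<Sum>j\<in>insert i J. c' j * v j x)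
          = (\<Sum>j\<in>insert i J. (if j \<in> J then c j * v j x else 0)) + (\<Sum>j\<in>insert i J. (if j = i then a * v j x else 0))"
        by (simp only: sum.distrib[symmetric]) (auto intro!: sum.cong simp: c'_def distrib_right)
      also have "(\<Sum>j\<in>insert i J. (if j \<in> J then c j * v j x else 0)) = f x"
        using J by (subst sum.inter_restrict[symmetric]) (auto intro!: sum.cong)
      also have "(\<Sum>j\<in>insert i J. (if j = i then a * v j x else 0)) = a * g x"
        using J i by (simp add: sum.delta)
      finally show ?thesis .
    qed
    then show ?case using J i by (intro exI[of _ "insert i J"] exI[of _ c']) (auto simp: fun_eq_iff)
  qed
  then show ?thesis using that by blast
qed

text \<open>Summation by parts with coefficients independent of \<open>v\<close>, so that one
  identity serves both Brownian paths and the indicators of (0,s]. The condition v 0 = 0 makes 0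
  admissible as first break point, and strict monotonicity matches the independence of Brownian
  increments.\<close>

lemma sum_eq_sum_increments:
  fixes J :: "real set" and c :: "real \<Rightarrow> real"
  assumes "finite J" "J \<subseteq> {0..}"
  obtains n p d where "p 0 = 0" "\<And>i. i < n \<Longrightarrow> p i < p (Suc i)" "p n = 0 \<or> p n \<in> J"
    "\<And>v :: real \<Rightarrow> real. v 0 = 0 \<Longrightarrow> (\<Sum>s\<in>J. c s * v s) = (\<Sum>i<n. d i * (v (p (Suc i)) - v (p i)))"
proof -
  have "\<exists>(n::nat) p d. p 0 = 0 \<and> (\<forall>i<n. p i < p (Suc i)) \<and> (p n = 0 \<or> p n \<in> J) \<and>
      (\<forall>v :: real \<Rightarrow> real. v 0 = 0 \<longrightarrow> (\<Sum>s\<in>J. c s * v s) = (\<Sum>i<n. d i * (v (p (Suc i)) - v (p i))))"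
    using assms
  proof (induction J rule: finite_linorder_max_induct)
    case empty
    show ?case by (intro exI[of _ "0::nat"] exI[of _ "\<lambda>_. 0"]) auto
  next
    case (insert b A)
    then obtain n :: nat and p d where IH: "p 0 = 0" "\<forall>i<n. p i < p (Suc i)" "p n = 0 \<or> p n \<in> A"
      "\<And>v :: real \<Rightarrow> real. v 0 = 0 \<Longrightarrow> (\<Sum>s\<in>A. c s * v s) = (\<Sum>i<n. d i * (v (p (Suc i)) - v (p i)))"
      by auto
    have bA: "b \<notin> A" using insert by auto
    show ?case
    proof (cases "b = 0")
      case True
      then have "A = {}" using insert by fastforce
      then show ?thesis using True IH bA insert(1) by (intro exI[of _ n] exI[of _ p] exI[of _ d]) auto
    next
      case False
      then have b: "p n < b" using IH(3) insert by auto
      define p' where "p' = p(Suc n := b)"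
      \<comment> \<open>As v b is the sum of all increments up to \<open>b\<close>, appending
        \<open>b\<close> adds \<open>c b\<close> to every coefficient.\<close>
      define d' where "d' i = (if i < n then d i else 0) + c b" for i
      have p': "p' i = p i" if "i \<le> n" for i using that by (simp add: p'_def)
      have p'S: "p' (Suc n) = b" by (simp add: p'_def)
      have A1: "p' 0 = 0" using IH by (simp add: p')
      have A2: "p' i < p' (Suc i)" if "i < Suc n" for i
          using that IH(2) b by (cases "i = n") (auto simp: p' p'S)
      have A3: "p' (Suc n) = 0 \<or> p' (Suc n) \<in> insert b A" by (simp add: p'S)
      have A4: "(\<Sum>s\<in>insert b A. c s * v s) = (\<Sum>i<Suc n. d' i * (v (p' (Suc i)) - v (p' i)))" if v: "v 0 = 0" for v :: "real \<Rightarrow> real"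
      proof -
        have "(\<Sum>i<Suc n. d' i * (v (p' (Suc i)) - v (p' i)))
            = (\<Sum>i<Suc n. (if i < n then d i else 0) * (v (p' (Suc i)) - v (p' i))) + c b * (\<Sum>i<Suc n. v (p' (Suc i)) - v (p' i))"
          unfolding d'_def by (simp only: distrib_right sum.distrib sum_distrib_left)
        also have "(\<Sum>i<Suc n. (if i < n then d i else 0) * (v (p' (Suc i)) - v (p' i))) = (\<Sum>i<n. d i * (v (p (Suc i)) - v (p i)))"
          by (simp add: p')
        also have "(\<Sum>i<Suc n. v (p' (Suc i)) - v (p' i)) = v b"
          using sum_lessThan_telescope[of "\<lambda>i. v (p' i)" "Suc n"] IH v by (simp add: p'S p')
        finally show ?thesis
          using IH(4)[of v, OF v] bA insert(1) by simp
      qed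
      show ?thesis
        by (rule exI[of _ "Suc n"], rule exI[of _ p'], rule exI[of _ d']) (use A1 A2 A3 A4 in blast)
    qed
  qed
  then show ?thesis using that by blast
qed

section \<open>Square-integrable kernels on a bounded interval\<close>

definition kern :: "real \<Rightarrow> (real \<Rightarrow> real) \<Rightarrow> bool" where
  "kern T f \<longleftrightarrow> 0 \<le> T \<and> sqint lborel f \<and> (\<forall>s. s \<notin> {0..T} \<longrightarrow> f s = 0)"

lemma kern_sqint: "kern T f \<Longrightarrow> sqint lborel f" by (simp add: kern_def)

lemma kern_mono: "kern S f \<Longrightarrow> S \<le> T \<Longrightarrow> kern T f" by (force simp: kern_def)

lemma kern_add: "kern T f \<Longrightarrow> kern T g \<Longrightarrow> kern T (\<lambda>s. f s + g s)" by (simp add: kern_def)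
lemma kern_diff: "kern T f \<Longrightarrow> kern T g \<Longrightarrow> kern T (\<lambda>s. f s - g s)" by (simp add: kern_def)
lemma kern_cmult: "kern T f \<Longrightarrow> kern T (\<lambda>s. c * f s)" by (simp add: kern_def)

lemma kern_bounded_mult:
  assumes f: "kern T f" and g: "g \<in> borel_measurable borel" "\<And>s. \<bar>g s\<bar> \<le> K"
  shows "kern T (\<lambda>s. f s * g s)"
proof -
  have "sqint lborel (\<lambda>s. f s * g s)"
  proof (rule sqint_bound)
    show "sqint lborel (\<lambda>s. K * f s)" using kern_sqint[OF f] by simp
    show "(\<lambda>s. f s * g s) \<in> borel_measurable lborel" using kern_sqint[OF f] g(1) by (auto simp: sqint_def)
    have "\<bar>f s * g s\<bar> \<le> \<bar>K * f s\<bar>" for s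
      using mult_left_mono[OF g(2)[of s], of "\<bar>f s\<bar>"] abs_ge_self[of K] mult_right_mono[of K "\<bar>K\<bar>" "\<bar>f s\<bar>"]
      by (simp add: abs_mult mult.commute)
    then show "AE s in lborel. \<bar>f s * g s\<bar> \<le> \<bar>K * f s\<bar>" by simp
  qed
  then show ?thesis using f by (simp add: kern_def)
qed

lemma kern_indicator_mult:
  assumes f: "kern T f" and A: "A \<in> sets borel" shows "kern T (\<lambda>s. indicator A s * f s)"
  using kern_bounded_mult[OF f, of "indicator A" 1] A by (simp add: mult.commute indicator_def)

lemma sqint_indicator:
  assumes "A \<in> sets M" "emeasure M A < \<infinity>" shows "sqint M (indicator A)"
proof -
  have "(\<lambda>x. (indicator A x :: real)\<^sup>2) = indicator A" by (auto simp: indicator_def)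
  then show ?thesis using assms by (simp add: sqint_def)
qed

lemma ip_sum_sum:
  assumes "\<And>i. i \<in> I \<Longrightarrow> sqint M (f i)" "\<And>j. j \<in> J \<Longrightarrow> sqint M (g j)"
  shows "ip M (\<lambda>x. \<Sum>i\<in>I. c i * f i x) (\<lambda>x. \<Sum>j\<in>J. d j * g j x) = (\<Sum>i\<in>I. \<Sum>j\<in>J. c i * (d j * ip M (f i) (g j)))"
proof -
  have "ip M (\<lambda>x. \<Sum>i\<in>I. c i * f i x) (\<lambda>x. \<Sum>j\<in>J. d j * g j x) = (\<Sum>i\<in>I. ip M (\<lambda>x. c i * f i x) (\<lambda>x. \<Sum>j\<in>J. d j * g j x))"
    by (rule ip_sum_left) (auto intro!: sqint_sum sqint_cmult assms)
  also have "\<dots> = (\<Sum>i\<in>I. \<Sum>j\<in>J. c i * (d j * ip M (f i) (g j)))"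
  proof (rule sum.cong[OF refl])
    fix i assume i: "i \<in> I"
    have "ip M (f i) (\<lambda>x. \<Sum>j\<in>J. d j * g j x) = (\<Sum>j\<in>J. ip M (f i) (\<lambda>x. d j * g j x))"
      by (rule ip_sum_right) (auto intro: assms i)
    then show "ip M (\<lambda>x. c i * f i x) (\<lambda>x. \<Sum>j\<in>J. d j * g j x) = (\<Sum>j\<in>J. c i * (d j * ip M (f i) (g j)))"
      by (simp add: ip_cmult_left ip_cmult_right sum_distrib_left)
  qed
  finally show ?thesis .
qed

lemma kern_bounded:
  assumes "0 \<le> T" and g: "g \<in> borel_measurable borel" "\<And>s. \<bar>g s\<bar> \<le> K"
  shows "kern T (\<lambda>s. indicator {0..T} s * g s)"
proof -
  have "sqint lborel (indicator {0..T} :: real \<Rightarrow> real)"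
    by (rule sqint_indicator) (use emeasure_lborel_Icc_eq[of 0 T] in auto)
  then have "kern T (indicator {0..T})" using assms(1) by (simp add: kern_def)
  from kern_bounded_mult[OF this g] show ?thesis .
qed

lemma sqint_indicator_Ioc: "sqint lborel (indicator {a<..b::real} :: real \<Rightarrow> real)"
  proof (rule sqint_indicator)
  show "emeasure lborel {a<..b} < \<infinity>"
    using emeasure_mono[of "{a<..b}" "{a..b}" lborel] emeasure_lborel_Icc_eq[of a b]
    by (auto simp: le_less_trans greaterThanAtMost_subseteq_atLeastAtMost_iff split: if_splits)
qed simp

lemma ip_indicator_Ioc0:
  assumes "0 \<le> a" "0 \<le> b"
  shows "ip lborel (indicator {0<..a}) (indicator {0<..b}) = min a b"
proof -
  have "{0<..a} \<inter> {0<..b} = {0<..min a b}" by auto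
  then show ?thesis using assms by (simp add: ip_def indicator_inter_arith[symmetric])
qed

text \<open>Written with \<open>min\<close> so as to match the covariance of Brownian increments
  term by term in \<open>step_isometry\<close>.\<close>

lemma ip_indicator_Ioc:
  assumes "0 \<le> a" "a \<le> b" "0 \<le> c" "c \<le> d"
  shows "ip lborel (indicator {a<..b}) (indicator {c<..d}) = min b d - min b c - min a d + min a c"
proof -
  have e: "(indicator {x<..y} :: real \<Rightarrow> real) = (\<lambda>s. indicator {0<..y} s - indicator {0<..x} s)" if "0 \<le> x" "x \<le> y" for x y
    using that by (auto simp: indicator_def fun_eq_iff)
  show ?thesis unfolding e[OF assms(1,2)] e[OF assms(3,4)]
    using assms by (simp add: ip_simps sqint_indicator_Ioc ip_indicator_Ioc0)
qed

lemma AE_eq_0_of_set_integrals: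
  fixes U :: "'a \<Rightarrow> real"
  assumes U: "integrable M U" and z: "\<And>A. A \<in> sets M \<Longrightarrow> (LINT x:A|M. U x) = 0"
  shows "AE x in M. U x = 0"
proof -
  have [measurable]: "U \<in> borel_measurable M" using U by auto
  have i: "integrable M (\<lambda>x. max 0 (U x))" "integrable M (\<lambda>x. max 0 (- U x))" using U by auto
  have "(LINT x|M. max 0 (U x)) = (LINT x:{x\<in>space M. U x > 0}|M. U x)"
    unfolding set_lebesgue_integral_def by (intro Bochner_Integration.integral_cong) (auto simp: indicator_def)
  then have 1: "(LINT x|M. max 0 (U x)) = 0" by (simp add: z)
  have "(LINT x|M. max 0 (- U x)) = (LINT x|M. - (indicator {x\<in>space M. U x < 0} x *\<^sub>R U x))"
    by (intro Bochner_Integration.integral_cong) (auto simp: indicator_def)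
  also have "\<dots> = - (LINT x:{x\<in>space M. U x < 0}|M. U x)"
    unfolding set_lebesgue_integral_def by simp
  finally have 2: "(LINT x|M. max 0 (- U x)) = 0" by (simp add: z)
  have "AE x in M. max 0 (U x) = 0" "AE x in M. max 0 (- U x) = 0"
    using 1 2 integral_nonneg_eq_0_iff_AE[OF i(1)] integral_nonneg_eq_0_iff_AE[OF i(2)] by auto
  then show ?thesis by eventually_elim auto
qed

text \<open>A function orthogonal to all indicators of (0,s] has, after truncation to (0,T], zero
  integral over every half-line, and therefore vanishes almost everywhere on that interval.\<close>

lemma kern_in_cspan:
  assumes f: "kern T f"
  shows "f \<in> cspan lborel ((\<lambda>s. indicator {0<..s}) ` {0..T})"
proof -
  have T: "0 \<le> T" using f by (simp add: kern_def)
  show ?thesis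
  proof (rule cspanI)
    show sf: "sqint lborel f" using f by (rule kern_sqint)
    fix q assume q: "sqint lborel q" and o: "\<And>g. g \<in> (\<lambda>s. indicator {0<..s}) ` {0..T} \<Longrightarrow> ip lborel q g = 0"
    have o': "ip lborel q (indicator {0<..s}) = 0" if "0 \<le> s" "s \<le> T" for s using o that by auto
    have [measurable]: "q \<in> borel_measurable borel" "f \<in> borel_measurable borel" using q sf by (auto simp: sqint_def)
    define U where "U s = q s * indicator {0<..T} s" for s
    have iU: "integrable lborel U" unfolding U_def by (rule sqint_integrable_mult[OF q sqint_indicator_Ioc])
    have "(LINT s:A|lborel. U s) = 0" if "A \<in> sets lborel" for A
    proof (rule set_integral_zero_sigma_sets[OF iU, where G = "range atMost"])
      show "Int_stable (range (atMost :: real \<Rightarrow> real set))" by (auto simp: Int_stable_def)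
      show "(LINT s|lborel. U s) = 0" using o'[of T] T unfolding U_def ip_def by simp
      have "sigma UNIV (range atMost) = (borel :: real measure)" by (rule borel_eq_atMost[symmetric])
      then have "sigma_sets UNIV (range atMost) = sets (borel :: real measure)" by (metis sets_measure_of top_greatest Pow_UNIV)
      then show "A \<in> sigma_sets (space lborel) (range atMost)" using that by simp
      fix B :: "real set" assume "B \<in> range atMost"
      then obtain a where B: "B = {..a}" by auto
      \<comment> \<open>Clamping \<open>a\<close> to [0,T] turns the truncated half-line into a
        member of the family.\<close>
      have "(LINT s:B|lborel. U s) = ip lborel q (indicator {0<..max 0 (min a T)})"
        unfolding set_lebesgue_integral_def ip_def U_def B
        by (intro Bochner_Integration.integral_cong) (auto simp: indicator_def)
      then show "(LINT s:B|lborel. U s) = 0" using o'[of "max 0 (min a T)"] T by simp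
    qed auto
    then have "AE s in lborel. U s = 0" by (rule AE_eq_0_of_set_integrals[OF iU])
    \<comment> \<open>A kernel may be nonzero at 0, a point that the intervals (0,s] miss.\<close>
    moreover have "AE s in lborel. s \<noteq> (0::real)" by (rule AE_lborel_singleton)
    ultimately have "AE s in lborel. q s * f s = 0"
    proof eventually_elim
      case (elim s)
      then show ?case using f by (cases "s \<in> {0<..T}") (auto simp: U_def kern_def)
    qed
    then show "ip lborel q f = 0" unfolding ip_def by (intro integral_eq_zero_AE)
  qed
qed

lemma nn_integral_sq_eq_ip:
  assumes "sqint M f" shows "(\<integral>\<^sup>+x. ennreal ((f x)\<^sup>2) \<partial>M) = ennreal (norm_sq M f)"
  using assms unfolding ip_def by (subst nn_integral_eq_integral) (auto simp: sqint_def power2_eq_square)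

section \<open>Covariances and Gaussianity of Brownian motion\<close>

locale brownian = prob_space M for M :: "'a measure" +
  fixes B :: "real \<Rightarrow> 'a \<Rightarrow> real"
  assumes bm: "brownian_motion M B"
begin

lemma B_measurable: "0 \<le> t \<Longrightarrow> B t \<in> borel_measurable M"
  using bm by (simp add: brownian_motion_def)

lemma B_0: "AE \<omega> in M. B 0 \<omega> = 0"
  using bm by (simp add: brownian_motion_def)

lemma B_increment:
  assumes "0 \<le> s" "s < t"
  shows "gauss_char M (\<lambda>\<omega>. B t \<omega> - B s \<omega>)" "(LINT \<omega>|M. B t \<omega> - B s \<omega>) = 0"
    "norm_sq M (\<lambda>\<omega>. B t \<omega> - B s \<omega>) = t - s"
proof -
  have D: "distributed M lborel (\<lambda>\<omega>. B t \<omega> - B s \<omega>) (\<lambda>x. ennreal (normal_density 0 (sqrt (t - s)) x))"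
    using bm assms by (simp add: brownian_motion_def)
  have p: "0 < sqrt (t - s)" using assms by simp
  have [measurable]: "B t \<in> borel_measurable M" "B s \<in> borel_measurable M" using assms by (auto intro: B_measurable)
  show "gauss_char M (\<lambda>\<omega>. B t \<omega> - B s \<omega>)"
    by (rule gaussian_rv_gauss_char) (use D p in \<open>unfold gaussian_rv_def, intro conjI exI[of _ 0] disjI2 exI[of _ "sqrt (t - s)"]; simp\<close>)
  show m: "(LINT \<omega>|M. B t \<omega> - B s \<omega>) = 0" by (rule normal_distributed_expectation[OF p D])
  show "norm_sq M (\<lambda>\<omega>. B t \<omega> - B s \<omega>) = t - s"
    using normal_distributed_variance[OF p D] assms unfolding m by (simp add: ip_def power2_eq_square)
qed

lemma B_AE_increment: "AE \<omega> in M. B t \<omega> = B t \<omega> - B 0 \<omega>"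
  using B_0 by eventually_elim simp

lemma sqint_B: assumes "0 \<le> t" shows "sqint M (B t)"
proof (cases "t = 0")
  case True
  then show ?thesis using B_0 B_measurable by (intro sqint_AE[OF sqint_zero]) auto
next
  case False
  then show ?thesis using assms B_AE_increment[of t] B_increment(1)[of 0 t] B_measurable
    by (intro sqint_AE[OF gauss_char_sqint]) auto
qed

lemma B_moments: assumes "0 \<le> t" shows "(LINT \<omega>|M. B t \<omega>) = 0" "norm_sq M (B t) = t"
proof -
  have [measurable]: "B t \<in> borel_measurable M" "B 0 \<in> borel_measurable M" using assms by (auto intro: B_measurable)
  have "(LINT \<omega>|M. B t \<omega>) = (LINT \<omega>|M. B t \<omega> - B 0 \<omega>)"
    using B_AE_increment by (intro integral_cong_AE) auto
  then show "(LINT \<omega>|M. B t \<omega>) = 0" using B_increment(2)[of 0 t] assms by (cases "t = 0") auto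
  have "norm_sq M (B t) = norm_sq M (\<lambda>\<omega>. B t \<omega> - B 0 \<omega>)"
    using B_AE_increment by (intro ip_cong_AE) auto
  then show "norm_sq M (B t) = t" using B_increment(3)[of 0 t] assms by (cases "t = 0") auto
qed

text \<open>Polarisation of the variance of the increment.\<close>

lemma ip_B: assumes "0 \<le> s" "0 \<le> t" shows "ip M (B s) (B t) = min s t"
proof -
  have *: "ip M (B s) (B t) = s" if "0 \<le> s" "s < t" for s t
  proof -
    have sq: "sqint M (B s)" "sqint M (B t)" using that by (auto intro: sqint_B)
    have "t - s = norm_sq M (B t) - 2 * ip M (B s) (B t) + norm_sq M (B s)"
      using B_increment(3)[OF that] sq by (simp add: ip_simps ip_commute[of M "B t" "B s"])
    then show ?thesis using B_moments(2) that by simp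
  qed
  consider "s < t" | "t < s" | "s = t" by linarith
  then show ?thesis
    by cases (use *[of s t] *[of t s] ip_commute[of M "B s" "B t"] assms B_moments(2) in auto)
qed

text \<open>Rewriting over increments makes the terms independent, so Gaussianity is added up one
  increment at a time. The rewriting holds almost surely because B 0 = 0 does.\<close>

lemma gauss_char_lspan_B:
  assumes "f \<in> lspan (B ` {0..})" shows "gauss_char M f"
proof -
  obtain J c where J: "finite J" "J \<subseteq> {0..}" and f: "f = (\<lambda>\<omega>. \<Sum>s\<in>J. c s * B s \<omega>)"
    using lspan_imageE[OF assms] by blast
  obtain n p d where p: "p 0 = 0" "\<And>i. i < n \<Longrightarrow> p i < p (Suc i)"
    and v: "\<And>v :: real \<Rightarrow> real. v 0 = 0 \<Longrightarrow> (\<Sum>s\<in>J. c s * v s) = (\<Sum>i<n. d i * (v (p (Suc i)) - v (p i)))"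
    using sum_eq_sum_increments[OF J] by metis
  have p0: "0 \<le> p i" if "i \<le> n" for i
    using that
  proof (induction i)
    case (Suc i)
    then show ?case using p(2)[of i] by simp
  qed (simp add: p)
  have Bp: "B (p i) \<in> borel_measurable M" if "i \<le> n" for i by (intro B_measurable p0 that)
  let ?X = "\<lambda>i \<omega>. B (p (Suc i)) \<omega> - B (p i) \<omega>"
  have "indep_vars (\<lambda>_. borel) ?X {..<n}"
    using bm p p0[of 0] unfolding brownian_motion_def by auto
  then have ind: "indep_vars (\<lambda>_. borel) (\<lambda>i \<omega>. d i * ?X i \<omega>) {..<n}"
    using indep_vars_compose2[of "\<lambda>_. borel" ?X "{..<n}" "\<lambda>i x. d i * x" "\<lambda>_. borel"] by auto
  have "gauss_char M (\<lambda>\<omega>. \<Sum>i<m. d i * ?X i \<omega>)" if "m \<le> n" for m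
    using that
  proof (induction m)
    case 0
    show ?case using gauss_char_const[of 0] by simp
  next
    case (Suc m)
    have "indep_vars (\<lambda>_. borel) (\<lambda>i \<omega>. d i * ?X i \<omega>) (insert m {..<m})"
      using Suc(2) by (intro indep_vars_subset[OF ind]) auto
    then have "indep_var borel (\<lambda>\<omega>. d m * ?X m \<omega>) borel (\<lambda>\<omega>. \<Sum>i<m. d i * ?X i \<omega>)"
      by (intro indep_vars_sum) auto
    moreover have "gauss_char M (\<lambda>\<omega>. d m * ?X m \<omega>)"
      using gauss_char_affine[OF B_increment(1)[OF p0[of m] p(2)[of m]], of 0 "d m"] Suc(2) by simp
    ultimately have "gauss_char M (\<lambda>\<omega>. d m * ?X m \<omega> + (\<Sum>i<m. d i * ?X i \<omega>))"
      using Suc by (intro gauss_char_add_indep) auto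
    then show ?case by (simp add: add.commute)
  qed
  from this[of n] have g: "gauss_char M (\<lambda>\<omega>. \<Sum>i<n. d i * ?X i \<omega>)" by simp
  have ae: "AE \<omega> in M. f \<omega> = (\<Sum>i<n. d i * ?X i \<omega>)"
    using B_0
  proof eventually_elim
    case (elim \<omega>)
    show ?case using v[of "\<lambda>s. B s \<omega>"] elim by (simp add: f)
  qed
  have "sqint M f" by (rule sqint_lspan[OF assms]) (auto intro: sqint_B)
  then show ?thesis by (intro gauss_char_AE[OF g _ ae] sqint_measurable)
qed

section \<open>Step integrals, the isometry and existence of the Wiener integral\<close>

definition partition :: "real \<Rightarrow> nat \<Rightarrow> (nat \<Rightarrow> real) \<Rightarrow> bool" where
  "partition T n p \<longleftrightarrow> 0 \<le> p 0 \<and> (\<forall>i<n. p i \<le> p (Suc i)) \<and> p n \<le> T"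

lemma partition_bounds:
  assumes "partition T n p" "i \<le> n" shows "0 \<le> p i" "p i \<le> T"
proof -
  have "p i \<le> p j" if "i \<le> j" "j \<le> n" for i j
    using that assms(1) by (induction j rule: dec_induct) (auto simp: partition_def intro: order_trans)
  from this[of 0 i] this[of i n] assms show "0 \<le> p i" "p i \<le> T" by (auto simp: partition_def)
qed

lemma step_fun_sqint: "sqint lborel (step_fun n p c)"
  unfolding step_fun_def[abs_def] by (intro sqint_sum sqint_cmult sqint_indicator_Ioc)

lemma step_fun_outside:
  assumes "partition T n p" "s \<notin> {0..T}" shows "step_fun n p c s = 0"
proof -
  have "s \<notin> {p i<..p (Suc i)}" if "i < n" for i
    using partition_bounds[OF assms(1), of i] partition_bounds[OF assms(1), of "Suc i"] that assms(2) by auto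
  then show ?thesis by (simp add: step_fun_def)
qed

lemma step_integral_cspan:
  assumes "partition T n p" shows "step_integral B n p c \<in> cspan M (B ` {0..T})"
proof -
  have "step_integral B n p c = (\<lambda>\<omega>. \<Sum>i<n. c i * (B (p (Suc i)) \<omega> + (-1) * B (p i) \<omega>))"
    by (simp add: step_integral_def fun_eq_iff)
  also have "\<dots> \<in> lspan (B ` {0..T})"
    using partition_bounds[OF assms] by (intro lspan_sum lspan_cmult lspan_add lspan_base) auto
  finally show ?thesis using sqint_B by (intro lspan_cspan) auto
qed

lemma step_integral_sqint: "partition T n p \<Longrightarrow> sqint M (step_integral B n p c)"
  using step_integral_cspan by (rule cspan_sqint)

text \<open>Both sides are bilinear in the steps, and the covariance of two increments is the length
  of the overlap of their intervals. Overlaps are computed pairwise, so the two partitions may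
  differ.\<close>

lemma step_isometry:
  assumes p: "partition T n p" and p': "partition T' n' p'"
  shows "ip M (step_integral B n p c) (step_integral B n' p' c') = ip lborel (step_fun n p c) (step_fun n' p' c')"
proof -
  have sq: "sqint M (B (p i))" "sqint M (B (p' j))" if "i \<le> n" "j \<le> n'" for i j
    using that partition_bounds[OF p] partition_bounds[OF p'] by (auto intro: sqint_B)
  have *: "ip M (\<lambda>\<omega>. B (p (Suc i)) \<omega> - B (p i) \<omega>) (\<lambda>\<omega>. B (p' (Suc j)) \<omega> - B (p' j) \<omega>)
    = ip lborel (indicator {p i<..p (Suc i)}) (indicator {p' j<..p' (Suc j)})" if "i < n" "j < n'" for i j
  proof -
    have "p i \<le> p (Suc i)" "p' j \<le> p' (Suc j)" using that p p' by (auto simp: partition_def)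
    then show ?thesis
      using that sq[of i j] sq[of "Suc i" "Suc j"] partition_bounds[OF p] partition_bounds[OF p']
      by (simp add: ip_simps ip_B ip_indicator_Ioc min.commute)
  qed
  have "ip M (step_integral B n p c) (step_integral B n' p' c')
      = (\<Sum>i<n. \<Sum>j<n'. c i * (c' j * ip M (\<lambda>\<omega>. B (p (Suc i)) \<omega> - B (p i) \<omega>) (\<lambda>\<omega>. B (p' (Suc j)) \<omega> - B (p' j) \<omega>)))"
    unfolding step_integral_def[abs_def] by (rule ip_sum_sum) (auto intro!: sqint_diff sq[of _ 0] sq[of 0])
  also have "\<dots> = (\<Sum>i<n. \<Sum>j<n'. c i * (c' j * ip lborel (indicator {p i<..p (Suc i)}) (indicator {p' j<..p' (Suc j)})))"
    by (intro sum.cong refl) (simp add: *)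
  also have "\<dots> = ip lborel (step_fun n p c) (step_fun n' p' c')"
    unfolding step_fun_def[abs_def] by (rule ip_sum_sum[symmetric]) (auto intro: sqint_indicator_Ioc)
  finally show ?thesis .
qed

text \<open>Recasts the defining limits as mean-square convergence. The restriction to [0,T]
  disappears because the kernel and the step functions vanish outside it.\<close>

lemma has_wiener_iff:
  assumes f: "kern T f"
  shows "has_wiener_integral M B f T Z \<longleftrightarrow>
    (\<exists>n p c. (\<forall>k. partition T (n k) (p k)) \<and> l2conv lborel (\<lambda>k. step_fun (n k) (p k) (c k)) f \<and>
       l2conv M (\<lambda>k. step_integral B (n k) (p k) (c k)) Z)"
proof -
  have [measurable]: "f \<in> borel_measurable borel" using kern_sqint[OF f] by (auto simp: sqint_def)
  have smf: "set_borel_measurable borel {0..T} f" unfolding set_borel_measurable_def by simp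
  have 1: "(\<lambda>k. \<integral>\<^sup>+s\<in>{0..T}. ennreal ((f s - step_fun (n k) (p k) (c k) s)\<^sup>2) \<partial>lborel) \<longlonglongrightarrow> 0
      \<longleftrightarrow> l2conv lborel (\<lambda>k. step_fun (n k) (p k) (c k)) f"
    if p: "\<forall>k. partition T (n k) (p k)" for n p c
  proof -
    have "(\<integral>\<^sup>+s\<in>{0..T}. ennreal ((f s - step_fun (n k) (p k) (c k) s)\<^sup>2) \<partial>lborel)
        = ennreal (norm_sq lborel (\<lambda>s. step_fun (n k) (p k) (c k) s - f s))" for k
    proof -
      have "(\<integral>\<^sup>+s\<in>{0..T}. ennreal ((f s - step_fun (n k) (p k) (c k) s)\<^sup>2) \<partial>lborel)
        = (\<integral>\<^sup>+s. ennreal ((step_fun (n k) (p k) (c k) s - f s)\<^sup>2) \<partial>lborel)"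
        using f step_fun_outside[OF p[rule_format, of k]]
        by (intro nn_integral_cong) (auto simp: indicator_def kern_def power2_commute)
      then show ?thesis using nn_integral_sq_eq_ip[OF sqint_diff[OF step_fun_sqint kern_sqint[OF f]]] by simp
    qed
    then show ?thesis using kern_sqint[OF f] step_fun_sqint
      by (simp add: l2conv_def ennreal_0[symmetric] del: ennreal_0)
  qed
  have 2: "Z \<in> borel_measurable M \<and> (\<lambda>k. \<integral>\<^sup>+\<omega>. ennreal ((Z \<omega> - step_integral B (n k) (p k) (c k) \<omega>)\<^sup>2) \<partial>M) \<longlonglongrightarrow> 0
      \<longleftrightarrow> l2conv M (\<lambda>k. step_integral B (n k) (p k) (c k)) Z"
    if p: "\<forall>k. partition T (n k) (p k)" for n p c
  proof -
    let ?I = "\<lambda>k. step_integral B (n k) (p k) (c k)"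
    have sI: "sqint M (?I k)" for k using p by (blast intro: step_integral_sqint)
    have eq: "(\<integral>\<^sup>+\<omega>. ennreal ((Z \<omega> - ?I k \<omega>)\<^sup>2) \<partial>M) = ennreal (norm_sq M (\<lambda>\<omega>. ?I k \<omega> - Z \<omega>))" if "sqint M Z" for k
      using nn_integral_sq_eq_ip[OF sqint_diff[OF sI that]] by (simp add: power2_commute)
    \<comment> \<open>A finite distance to a single step integral already forces \<open>Z\<close> to
      be square-integrable.\<close>
    have "sqint M Z" if m[measurable]: "Z \<in> borel_measurable M" and l: "(\<lambda>k. \<integral>\<^sup>+\<omega>. ennreal ((Z \<omega> - ?I k \<omega>)\<^sup>2) \<partial>M) \<longlonglongrightarrow> 0"
    proof -
      have "\<forall>\<^sub>F k in sequentially. (\<integral>\<^sup>+\<omega>. ennreal ((Z \<omega> - ?I k \<omega>)\<^sup>2) \<partial>M) < 1"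
        using l by (rule order_tendstoD) simp
      then obtain k where k: "(\<integral>\<^sup>+\<omega>. ennreal ((Z \<omega> - ?I k \<omega>)\<^sup>2) \<partial>M) < 1"
        by (auto simp: eventually_sequentially)
      have [measurable]: "?I k \<in> borel_measurable M" using sI by (simp add: sqint_def)
      have "sqint M (\<lambda>\<omega>. Z \<omega> - ?I k \<omega>)" unfolding sqint_def
        using k by (auto intro!: integrableI_bounded intro: less_trans)
      from sqint_add[OF this sI[of k]] show ?thesis by simp
    qed
    then show ?thesis using eq sI
      by (auto simp: l2conv_def sqint_def[of M Z] ennreal_0[symmetric] simp del: ennreal_0)
  qed
  show ?thesis
    unfolding has_wiener_integral_def partition_def[symmetric] using smf 1 2 by blast
qed

text \<open>The isometry carries a step approximation of the kernel to a Cauchy sequence of step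
  integrals. Existence is what gives the choice in \<open>wiener_integral\<close> its
  meaning.\<close>

lemma has_wiener_exists:
  assumes f: "kern T f" shows "\<exists>Z. has_wiener_integral M B f T Z"
proof -
  obtain u where u: "\<And>k. u k \<in> lspan ((\<lambda>s. indicator {0<..s}) ` {0..T})" "l2conv lborel u f"
    using cspan_approx[OF _ kern_in_cspan[OF f]] sqint_indicator_Ioc by (metis (no_types, lifting) imageE)
  have T: "0 \<le> T" using f by (simp add: kern_def)
  \<comment> \<open>Summation by parts turns a combination of indicators of (0,s] into a step
    function on a partition of [0,T].\<close>
  have "\<exists>n p d. partition T n p \<and> u k = step_fun n p d" for k
  proof -
    obtain J c where J: "finite J" "J \<subseteq> {0..T}" and uk: "u k = (\<lambda>x. \<Sum>s\<in>J. c s * indicator {0<..s} x)"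
      using lspan_imageE[OF u(1)[of k]] by blast
    have J0: "J \<subseteq> {0..}" using J by auto
    obtain n p d where p: "p 0 = 0" "\<And>i. i < n \<Longrightarrow> p i < p (Suc i)" "p n = 0 \<or> p n \<in> J"
      and v: "\<And>v :: real \<Rightarrow> real. v 0 = 0 \<Longrightarrow> (\<Sum>s\<in>J. c s * v s) = (\<Sum>i<n. d i * (v (p (Suc i)) - v (p i)))"
      by (rule sum_eq_sum_increments[OF J(1) J0, of c]) (rule that)
    have part: "partition T n p" using p J T by (auto simp: partition_def less_imp_le)
    have "u k x = step_fun n p d x" for x
    proof -
      have "u k x = (\<Sum>i<n. d i * (indicator {0<..p (Suc i)} x - indicator {0<..p i} x))"
        unfolding uk by (rule v) simp
      also have "\<dots> = step_fun n p d x" unfolding step_fun_def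
      proof (rule sum.cong[OF refl])
        fix i assume "i \<in> {..<n}"
        then have "0 \<le> p i" "p i < p (Suc i)" using partition_bounds(1)[OF part, of i] p(2)[of i] by auto
        then show "d i * (indicator {0<..p (Suc i)} x - indicator {0<..p i} x) = d i * indicator {p i<..p (Suc i)} x"
          by (auto simp: indicator_def)
      qed
      finally show ?thesis .
    qed
    then show ?thesis using part by blast
  qed
  then obtain n p d where npd: "\<And>k. partition T (n k) (p k)" "\<And>k. u k = step_fun (n k) (p k) (d k)" by metis
  define I where "I k = step_integral B (n k) (p k) (d k)" for k
  have sI: "sqint M (I k)" for k unfolding I_def by (rule step_integral_sqint[OF npd(1)])
  have su: "sqint lborel (u k)" for k using u(2) by (simp add: l2conv_def)
  have sf: "sqint lborel f" using f by (rule kern_sqint)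
  have iso: "ip M (I k) (I m) = ip lborel (u k) (u m)" for k m
    unfolding I_def npd(2) by (rule step_isometry[OF npd(1) npd(1)])
  have "\<exists>Z. l2conv M I Z"
  proof (rule sqint_complete[OF sI])
    fix e :: real assume e: "e > 0"
    have "(\<lambda>k. norm_sq lborel (\<lambda>x. u k x - f x)) \<longlonglongrightarrow> 0" using u(2) by (simp add: l2conv_def)
    then obtain N where N: "\<And>k. k \<ge> N \<Longrightarrow> norm_sq lborel (\<lambda>x. u k x - f x) < e / 4"
      using LIMSEQ_D[of _ 0 "e / 4"] e by fastforce
    have "norm_sq M (\<lambda>x. I m x - I k x) < e" if "m \<ge> N" "k \<ge> N" for m k
    proof -
      have "norm_sq M (\<lambda>x. I m x - I k x) = norm_sq lborel (\<lambda>x. u m x - u k x)"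
        using sI su by (simp add: ip_simps iso)
      also have "(\<lambda>x. u m x - u k x) = (\<lambda>x. (u m x - f x) - (u k x - f x))" by (simp add: fun_eq_iff)
      also have "norm_sq lborel (\<lambda>x. (u m x - f x) - (u k x - f x)) < e"
        using ip_diff_le[OF sqint_diff[OF su sf] sqint_diff[OF su sf], of m k] N[OF that(1)] N[OF that(2)] by linarith
      finally show ?thesis .
    qed
    then show "\<exists>N. \<forall>m\<ge>N. \<forall>k\<ge>N. norm_sq M (\<lambda>x. I m x - I k x) < e" by blast
  qed
  then obtain Z where "l2conv M I Z" by blast
  then have "has_wiener_integral M B f T Z"
    unfolding has_wiener_iff[OF f] using npd u(2) I_def
    by (intro exI[of _ n] exI[of _ p] exI[of _ d]) (simp add: I_def[abs_def] npd(2)[symmetric])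
  then show ?thesis by blast
qed

lemma wiener_has: "kern T f \<Longrightarrow> has_wiener_integral M B f T (wiener_integral M B f T)"
  unfolding wiener_integral_def using has_wiener_exists by (rule someI_ex)

text \<open>Two horizons are allowed because \<open>Y s\<close> contains an integral up to s, while
  the filtering argument keeps one fixed horizon.\<close>

lemma wiener_isometry:
  assumes f: "kern S f" and g: "kern T g"
  shows "ip M (wiener_integral M B f S) (wiener_integral M B g T) = ip lborel f g"
proof -
  obtain n p c where 1: "\<forall>k. partition S (n k) (p k)" "l2conv lborel (\<lambda>k. step_fun (n k) (p k) (c k)) f"
    "l2conv M (\<lambda>k. step_integral B (n k) (p k) (c k)) (wiener_integral M B f S)"
    using wiener_has[OF f] unfolding has_wiener_iff[OF f] by blast
  obtain n' p' c' where 2: "\<forall>k. partition T (n' k) (p' k)" "l2conv lborel (\<lambda>k. step_fun (n' k) (p' k) (c' k)) g"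
    "l2conv M (\<lambda>k. step_integral B (n' k) (p' k) (c' k)) (wiener_integral M B g T)"
    using wiener_has[OF g] unfolding has_wiener_iff[OF g] by blast
  from l2conv_ip2[OF 1(3) 2(3)] have "(\<lambda>k. ip lborel (step_fun (n k) (p k) (c k)) (step_fun (n' k) (p' k) (c' k)))
      \<longlonglongrightarrow> ip M (wiener_integral M B f S) (wiener_integral M B g T)"
    by (simp only: step_isometry[OF 1(1)[rule_format] 2(1)[rule_format]])
  from LIMSEQ_unique[OF this l2conv_ip2[OF 1(2) 2(2)]] show ?thesis .
qed

lemma wiener_cspan:
  assumes f: "kern T f" shows "wiener_integral M B f T \<in> cspan M (B ` {0..T})"
proof -
  obtain n p c where 1: "\<forall>k. partition T (n k) (p k)"
    "l2conv M (\<lambda>k. step_integral B (n k) (p k) (c k)) (wiener_integral M B f T)"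
    using wiener_has[OF f] unfolding has_wiener_iff[OF f] by blast
  then show ?thesis by (intro l2conv_cspan[OF 1(2)] step_integral_cspan) blast
qed

lemma wiener_sqint: "kern T f \<Longrightarrow> sqint M (wiener_integral M B f T)"
  using wiener_cspan by (rule cspan_sqint)

text \<open>The versions are chosen separately for each integrand, so linearity is only almost sure.
  By the isometry the squared norm of the defect expands to 0.\<close>

lemma wiener_linear:
  assumes f: "kern T f" and g: "kern T g"
  shows "AE \<omega> in M. wiener_integral M B (\<lambda>s. f s + c * g s) T \<omega> = wiener_integral M B f T \<omega> + c * wiener_integral M B g T \<omega>"
proof -
  let ?h = "\<lambda>s. f s + c * g s"
  have h: "kern T ?h" using f g by (intro kern_add kern_cmult)
  note K = f g h
  note sq = K[THEN kern_sqint] K[THEN wiener_sqint]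
  have sd: "sqint M (\<lambda>\<omega>. wiener_integral M B ?h T \<omega> - (wiener_integral M B f T \<omega> + c * wiener_integral M B g T \<omega>))"
    using sq by simp
  have "ip M (\<lambda>\<omega>. wiener_integral M B ?h T \<omega> - (wiener_integral M B f T \<omega> + c * wiener_integral M B g T \<omega>))
      (\<lambda>\<omega>. wiener_integral M B ?h T \<omega> - (wiener_integral M B f T \<omega> + c * wiener_integral M B g T \<omega>)) = 0"
    using sq by (simp add: ip_simps wiener_isometry[OF h h] wiener_isometry[OF h f] wiener_isometry[OF h g]
       wiener_isometry[OF f h] wiener_isometry[OF g h] wiener_isometry[OF f g] wiener_isometry[OF g f]
       wiener_isometry[OF f f] wiener_isometry[OF g g] algebra_simps)
  from ip_eq_0_AE[OF sd this] show ?thesis by eventually_elim simp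
qed

lemma wiener_horizon:
  assumes f: "kern S f" and ST: "S \<le> T"
  shows "AE \<omega> in M. wiener_integral M B f S \<omega> = wiener_integral M B f T \<omega>"
proof -
  have f': "kern T f" by (rule kern_mono[OF f ST])
  have sd: "sqint M (\<lambda>\<omega>. wiener_integral M B f S \<omega> - wiener_integral M B f T \<omega>)"
    using wiener_sqint[OF f] wiener_sqint[OF f'] by simp
  have "norm_sq M (\<lambda>\<omega>. wiener_integral M B f S \<omega> - wiener_integral M B f T \<omega>) = 0"
    using wiener_sqint[OF f] wiener_sqint[OF f']
    by (simp add: ip_simps wiener_isometry[OF f f] wiener_isometry[OF f f'] wiener_isometry[OF f' f] wiener_isometry[OF f' f'])
  from ip_eq_0_AE[OF sd this] show ?thesis by eventually_elim simp
qed

end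

lemma has_wiener_integral_cong:
  assumes "\<And>s. 0 \<le> s \<Longrightarrow> s \<le> t \<Longrightarrow> f s = g s"
  shows "has_wiener_integral M B f t = has_wiener_integral M B g t"
proof -
  have "set_borel_measurable borel {0..t} f \<longleftrightarrow> set_borel_measurable borel {0..t} g"
    unfolding set_borel_measurable_def
    by (intro arg_cong2[where f="(\<in>)"] ext) (auto simp: indicator_def assms)
  moreover have "(\<integral>\<^sup>+s\<in>{0..t}. ennreal ((f s - h s)\<^sup>2) \<partial>lborel) = (\<integral>\<^sup>+s\<in>{0..t}. ennreal ((g s - h s)\<^sup>2) \<partial>lborel)" for h
    by (intro nn_integral_cong) (auto simp: indicator_def assms)
  ultimately show ?thesis unfolding has_wiener_integral_def fun_eq_iff by simp
qed

text \<open>A literal equality and not only an almost sure one: both integrands define the same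
  predicate, so the choice operator returns the same version.\<close>

lemma wiener_integral_cong:
  "(\<And>s. 0 \<le> s \<Longrightarrow> s \<le> t \<Longrightarrow> f s = g s) \<Longrightarrow> wiener_integral M B f t = wiener_integral M B g t"
  unfolding wiener_integral_def using has_wiener_integral_cong by metis

section \<open>Time integrals of square-integrable processes\<close>

text \<open>Vanishing outside [0,T] lets time integrals run over the whole line. Square
  integrability is demanded at every single time because inner products are taken at fixed
  times.\<close>

definition l2process :: "'a measure \<Rightarrow> real \<Rightarrow> (real \<Rightarrow> 'a \<Rightarrow> real) \<Rightarrow> bool" where
  "l2process M T V \<longleftrightarrow> (\<lambda>(s, \<omega>). V s \<omega>) \<in> borel_measurable (lborel \<Otimes>\<^sub>M M) \<and> (\<forall>s. sqint M (V s)) \<and>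
     (\<forall>s \<omega>. s \<notin> {0..T} \<longrightarrow> V s \<omega> = 0) \<and> integrable lborel (\<lambda>s. norm_sq M (V s))"

definition time_integral :: "(real \<Rightarrow> real) \<Rightarrow> (real \<Rightarrow> 'a \<Rightarrow> real) \<Rightarrow> 'a \<Rightarrow> real" where
  "time_integral a V \<omega> = (LINT s|lborel. a s * V s \<omega>)"

context prob_space
begin

lemma pair_sigma_finite_lborel: "pair_sigma_finite lborel M"
  by (intro pair_sigma_finite.intro lborel.sigma_finite_measure_axioms sigma_finite_measure_axioms)

lemma l2process_sqint: "l2process M T V \<Longrightarrow> sqint M (V s)"
  by (simp add: l2process_def)

lemma l2process_product:
  assumes V: "l2process M T V"
  shows "integrable (lborel \<Otimes>\<^sub>M M) (\<lambda>(s, \<omega>). (V s \<omega>)\<^sup>2)"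
proof -
  interpret P: pair_sigma_finite lborel M by (rule pair_sigma_finite_lborel)
  have [measurable]: "(\<lambda>(s, \<omega>). V s \<omega>) \<in> borel_measurable (lborel \<Otimes>\<^sub>M M)" using V by (simp add: l2process_def)
  show ?thesis
  proof (rule P.Fubini_integrable)
    show "(\<lambda>(s, \<omega>). (V s \<omega>)\<^sup>2) \<in> borel_measurable (lborel \<Otimes>\<^sub>M M)" by measurable
    have "integrable lborel (\<lambda>s. norm_sq M (V s))" using V by (simp add: l2process_def)
    then show "integrable lborel (\<lambda>s. LINT \<omega>|M. norm (case (s, \<omega>) of (s, \<omega>) \<Rightarrow> (V s \<omega>)\<^sup>2))"
      by (simp add: ip_def power2_eq_square)
    show "AE s in lborel. integrable M (\<lambda>\<omega>. case (s, \<omega>) of (s, \<omega>) \<Rightarrow> (V s \<omega>)\<^sup>2)"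
      using l2process_sqint[OF V] by (simp add: sqint_def)
  qed
qed

lemma weight_product:
  assumes a: "sqint lborel a" and W: "sqint M W"
  shows "integrable (lborel \<Otimes>\<^sub>M M) (\<lambda>(s, \<omega>). (a s * W \<omega>)\<^sup>2)"
proof -
  interpret P: pair_sigma_finite lborel M by (rule pair_sigma_finite_lborel)
  have [measurable]: "a \<in> borel_measurable borel" "W \<in> borel_measurable M" using a W by (auto simp: sqint_def)
  show ?thesis
  proof (rule P.Fubini_integrable)
    have "integrable lborel (\<lambda>s. (a s)\<^sup>2 * norm_sq M W)" using a by (simp add: sqint_def)
    then show "integrable lborel (\<lambda>s. LINT \<omega>|M. norm (case (s, \<omega>) of (s, \<omega>) \<Rightarrow> (a s * W \<omega>)\<^sup>2))"
      by (simp add: ip_def power_mult_distrib flip: power2_eq_square)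
    show "AE s in lborel. integrable M (\<lambda>\<omega>. case (s, \<omega>) of (s, \<omega>) \<Rightarrow> (a s * W \<omega>)\<^sup>2)"
      using W by (simp add: sqint_def power_mult_distrib)
  qed measurable
qed

text \<open>The integrand is a product of two square-integrable functions on the product space; this
  integrability lies behind every exchange of expectation and time integral in
  \<open>time_integral_ip\<close>.\<close>

lemma weighted_integrable:
  assumes V: "l2process M T V" and a: "sqint lborel a" and W: "sqint M W"
  shows "integrable (lborel \<Otimes>\<^sub>M M) (\<lambda>(s, \<omega>). W \<omega> * (a s * V s \<omega>))"
proof -
  have [measurable]: "a \<in> borel_measurable borel" "W \<in> borel_measurable M" using a W by (auto simp: sqint_def)
  have [measurable]: "(\<lambda>(s, \<omega>). V s \<omega>) \<in> borel_measurable (lborel \<Otimes>\<^sub>M M)" using V by (simp add: l2process_def)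
  have 1: "sqint (lborel \<Otimes>\<^sub>M M) (\<lambda>(s, \<omega>). V s \<omega>)"
    using l2process_product[OF V] by (simp add: sqint_def case_prod_unfold)
  have "(\<lambda>(s, \<omega>). a s * W \<omega>) \<in> borel_measurable (lborel \<Otimes>\<^sub>M M)" by measurable
  then have 2: "sqint (lborel \<Otimes>\<^sub>M M) (\<lambda>(s, \<omega>). a s * W \<omega>)"
    using weight_product[OF a W] by (simp add: sqint_def case_prod_unfold)
  show ?thesis using sqint_integrable_mult[OF 2 1] by (simp add: case_prod_unfold mult_ac)
qed

lemma time_integral_AE_integrable:
  assumes V: "l2process M T V" and a: "sqint lborel a"
  shows "AE \<omega> in M. integrable lborel (\<lambda>s. a s * V s \<omega>)"
proof -
  interpret P: pair_sigma_finite lborel M by (rule pair_sigma_finite_lborel)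
  show ?thesis using P.AE_integrable_snd[OF weighted_integrable[OF V a, of "\<lambda>_. 1"]] by simp
qed

lemma time_integral_measurable:
  assumes V: "l2process M T V" and a: "sqint lborel a"
  shows "time_integral a V \<in> borel_measurable M"
proof -
  interpret P: pair_sigma_finite lborel M by (rule pair_sigma_finite_lborel)
  have "integrable M (\<lambda>\<omega>. LINT s|lborel. 1 * (a s * V s \<omega>))"
    by (rule P.integrable_snd[OF weighted_integrable[OF V a, of "\<lambda>_. 1"]]) simp
  then show ?thesis unfolding time_integral_def[abs_def] by auto
qed

text \<open>Cauchy-Schwarz in time along almost every path, then Fubini.\<close>

lemma time_integral_sqint_bound:
  assumes V: "l2process M T V" and a: "sqint lborel a"
  shows "sqint M (time_integral a V)"
    and "norm_sq M (time_integral a V) \<le> norm_sq lborel a * (LINT s|lborel. norm_sq M (V s))"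
proof -
  interpret P: pair_sigma_finite lborel M by (rule pair_sigma_finite_lborel)
  have Vm[measurable]: "(\<lambda>(s, \<omega>). V s \<omega>) \<in> borel_measurable (lborel \<Otimes>\<^sub>M M)" using V by (simp add: l2process_def)
  note m[measurable] = time_integral_measurable[OF V a]
  note p = l2process_product[OF V]
  have "AE \<omega> in M. integrable lborel (\<lambda>s. (V s \<omega>)\<^sup>2)" by (rule P.AE_integrable_snd[OF p])
  then have ae: "AE \<omega> in M. (time_integral a V \<omega>)\<^sup>2 \<le> norm_sq lborel a * (LINT s|lborel. (V s \<omega>)\<^sup>2)"
    using AE_space
  proof eventually_elim
    case (elim \<omega>)
    have "(\<lambda>s. V s \<omega>) \<in> borel_measurable lborel"
      using measurable_compose[OF measurable_Pair2'[OF elim(2)] Vm] by simp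
    then have "sqint lborel (\<lambda>s. V s \<omega>)" using elim(1) by (simp add: sqint_def)
    from ip_Cauchy_Schwarz[OF a this] show ?case
      by (simp add: ip_def time_integral_def power2_eq_square)
  qed
  have i: "integrable M (\<lambda>\<omega>. norm_sq lborel a * (LINT s|lborel. (V s \<omega>)\<^sup>2))"
    using P.integrable_snd[OF p] by simp
  have i2: "integrable M (\<lambda>\<omega>. (time_integral a V \<omega>)\<^sup>2)"
    by (rule Bochner_Integration.integrable_bound[OF i]) (use ae in \<open>auto elim!: eventually_mono\<close>)
  then show "sqint M (time_integral a V)" by (simp add: sqint_def)
  have "norm_sq M (time_integral a V) = (LINT \<omega>|M. (time_integral a V \<omega>)\<^sup>2)"
    by (simp add: ip_def power2_eq_square)
  also have "\<dots> \<le> (LINT \<omega>|M. norm_sq lborel a * (LINT s|lborel. (V s \<omega>)\<^sup>2))"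
    by (rule integral_mono_AE[OF i2 i ae])
  also have "\<dots> = norm_sq lborel a * (LINT \<omega>|M. (LINT s|lborel. (V s \<omega>)\<^sup>2))" by simp
  also have "(LINT \<omega>|M. (LINT s|lborel. (V s \<omega>)\<^sup>2)) = (LINT s|lborel. (LINT \<omega>|M. (V s \<omega>)\<^sup>2))"
    using P.integral_snd[OF p] P.integral_fst[OF p] by simp
  finally show "norm_sq M (time_integral a V) \<le> norm_sq lborel a * (LINT s|lborel. norm_sq M (V s))"
    by (simp add: ip_def power2_eq_square)
qed

lemmas time_integral_sqint = time_integral_sqint_bound(1)

lemma time_integral_ip:
  assumes V: "l2process M T V" and a: "sqint lborel a" and W: "sqint M W"
  shows "integrable lborel (\<lambda>s. a s * ip M W (V s))"
    and "ip M W (time_integral a V) = (LINT s|lborel. a s * ip M W (V s))"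
proof -
  interpret P: pair_sigma_finite lborel M by (rule pair_sigma_finite_lborel)
  note p = weighted_integrable[OF V a W]
  have e: "(LINT \<omega>|M. W \<omega> * (a s * V s \<omega>)) = a s * ip M W (V s)" for s
  proof -
    have "(\<lambda>\<omega>. W \<omega> * (a s * V s \<omega>)) = (\<lambda>\<omega>. a s * (W \<omega> * V s \<omega>))" by (simp add: fun_eq_iff)
    then show ?thesis by (simp add: ip_def)
  qed
  show "integrable lborel (\<lambda>s. a s * ip M W (V s))"
    using P.integrable_fst[OF p] by (simp add: e)
  have "ip M W (time_integral a V) = (LINT \<omega>|M. (LINT s|lborel. W \<omega> * (a s * V s \<omega>)))"
    by (simp add: ip_def time_integral_def)
  also have "\<dots> = (LINT s|lborel. (LINT \<omega>|M. W \<omega> * (a s * V s \<omega>)))"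
    using P.integral_snd[OF p] P.integral_fst[OF p] by simp
  finally show "ip M W (time_integral a V) = (LINT s|lborel. a s * ip M W (V s))" by (simp add: e)
qed

text \<open>Tested against \<open>q\<close>, the expectation moves inside the time integral.
  Membership is asked only where the weight is nonzero, so a kernel supported in [0,r] involves only
  times up to r.\<close>

lemma time_integral_cspan:
  assumes V: "l2process M T V" and a: "sqint lborel a" and S: "\<And>s. s \<in> {0..T} \<Longrightarrow> a s \<noteq> 0 \<Longrightarrow> V s \<in> cspan M S"
  shows "time_integral a V \<in> cspan M S"
proof (rule cspanI[OF time_integral_sqint[OF V a]])
  fix q assume q: "sqint M q" "\<And>g. g \<in> S \<Longrightarrow> ip M q g = 0"
  have z: "a s * ip M q (V s) = 0" for s
  proof (cases "s \<in> {0..T}")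
    case True
    then show ?thesis using cspanD[OF S[OF True] q] by (cases "a s = 0") auto
  next
    case False
    then have "V s = (\<lambda>_. 0)" using V by (auto simp: l2process_def)
    then show ?thesis by simp
  qed
  show "ip M q (time_integral a V) = 0" unfolding time_integral_ip(2)[OF V a q(1)] z by simp
qed

lemma l2process_ip_kern:
  assumes T: "0 \<le> T" and V: "l2process M T V" and W: "sqint M W" shows "kern T (\<lambda>s. ip M W (V s))"
proof -
  have [measurable]: "(\<lambda>(s, \<omega>). V s \<omega>) \<in> borel_measurable (lborel \<Otimes>\<^sub>M M)" using V by (simp add: l2process_def)
  have [measurable]: "W \<in> borel_measurable M" using W by (simp add: sqint_def)
  have [measurable]: "(\<lambda>s. ip M W (V s)) \<in> borel_measurable lborel" unfolding ip_def by measurable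
  have "integrable lborel (\<lambda>s. (ip M W (V s))\<^sup>2)"
  proof (rule Bochner_Integration.integrable_bound)
    show "integrable lborel (\<lambda>s. norm_sq M W * norm_sq M (V s))" using V by (simp add: l2process_def)
    show "AE s in lborel. norm ((ip M W (V s))\<^sup>2) \<le> norm (norm_sq M W * norm_sq M (V s))"
      using ip_Cauchy_Schwarz[OF W l2process_sqint[OF V]] by simp
  qed measurable
  moreover have "ip M W (V s) = 0" if "s \<notin> {0..T}" for s
  proof -
    have "V s = (\<lambda>_. 0)" using V that by (auto simp: l2process_def)
    then show ?thesis by simp
  qed
  ultimately show ?thesis using T by (auto simp: kern_def sqint_def)
qed

lemma l2process_norm_sq: "l2process M T V \<Longrightarrow> integrable lborel (\<lambda>s. norm_sq M (V s))"
  by (simp add: l2process_def)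

lemma l2process_dominated:
  assumes V: "l2process M T V" and m: "(\<lambda>(s, \<omega>). W s \<omega>) \<in> borel_measurable (lborel \<Otimes>\<^sub>M M)"
    and sq: "\<And>s. sqint M (W s)" and z: "\<And>s \<omega>. s \<notin> {0..T} \<Longrightarrow> W s \<omega> = 0"
    and le: "\<And>s. norm_sq M (W s) \<le> norm_sq M (V s)"
  shows "l2process M T W"
proof -
  note m[measurable]
  have "(\<lambda>s. norm_sq M (W s)) \<in> borel_measurable lborel" unfolding ip_def by measurable
  then have "integrable lborel (\<lambda>s. norm_sq M (W s))"
    by (rule Bochner_Integration.integrable_bound[OF l2process_norm_sq[OF V]]) (use le in simp)
  then show ?thesis using m sq z by (simp add: l2process_def)
qed

section \<open>Generated sigma-algebras and independence\<close>

lemma sigma_finite_subalgebra_of_subalgebra: "subalgebra M F \<Longrightarrow> sigma_finite_subalgebra M F"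
  by (intro finite_measure_subalgebra_is_sigma_finite finite_measure_subalgebra.intro
       finite_measure_subalgebra_axioms.intro) unfold_locales

lemma generated_sigma_measurable:
  assumes S: "\<And>g. g \<in> S \<Longrightarrow> g \<in> borel_measurable M"
  shows "subalgebra M (generated_sigma M S)" "g \<in> S \<Longrightarrow> g \<in> borel_measurable (generated_sigma M S)"
proof -
  have sp: "(\<Union>Z\<in>S. {Z -` A \<inter> space M | A. A \<in> sets borel}) \<subseteq> Pow (space M)" by auto
  have se: "sets (generated_sigma M S) = sigma_sets (space M) (\<Union>Z\<in>S. {Z -` A \<inter> space M | A. A \<in> sets borel})"
    unfolding generated_sigma_def by (rule sets_measure_of[OF sp])
  have spc: "space (generated_sigma M S) = space M" unfolding generated_sigma_def by (rule space_measure_of[OF sp])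
  have "(\<Union>Z\<in>S. {Z -` A \<inter> space M | A. A \<in> sets borel}) \<subseteq> sets M"
    using measurable_sets[OF S] by auto
  then show "subalgebra M (generated_sigma M S)"
    unfolding subalgebra_def se spc by (simp add: sets.sigma_sets_subset)
  show "g \<in> borel_measurable (generated_sigma M S)" if "g \<in> S"
    using that unfolding measurable_def se spc by (auto intro!: sigma_sets.Basic)
qed

lemma lspan_measurable:
  assumes "f \<in> lspan S" "\<And>g. g \<in> S \<Longrightarrow> g \<in> borel_measurable N" shows "f \<in> borel_measurable N"
  using assms by induction auto

lemma indep_var_of_indep_set:
  assumes ind: "indep_set (sets F1) (sets F2)" and s: "subalgebra M F1" "subalgebra M F2"
    and f: "f \<in> borel_measurable F1" and g: "g \<in> borel_measurable F2"
  shows "indep_var borel (f :: 'a \<Rightarrow> real) borel (g :: 'a \<Rightarrow> real)"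
proof -
  have sub: "sigma_sets (space M) {h -` A \<inter> space M | A. A \<in> sets borel} \<subseteq> sets N"
    if "subalgebra M N" "h \<in> borel_measurable N" for N and h :: "'a \<Rightarrow> real"
  proof -
    have sp: "space N = space M" using that by (simp add: subalgebra_def)
    have "{h -` A \<inter> space M | A. A \<in> sets borel} \<subseteq> sets N"
      using measurable_sets[OF that(2)] by (auto simp: sp)
    then show ?thesis using sets.sigma_sets_subset[of _ N] by (simp add: sp)
  qed
  have "indep_set (sigma_sets (space M) {f -` A \<inter> space M | A. A \<in> sets borel})
      (sigma_sets (space M) {g -` A \<inter> space M | A. A \<in> sets borel})"
    using ind unfolding indep_set_def
    by (rule indep_sets_mono_sets) (use sub[OF s(1) f] sub[OF s(2) g] in \<open>auto split: bool.split\<close>)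
  moreover have "f \<in> borel_measurable M" "g \<in> borel_measurable M"
    using s f g measurable_from_subalg by blast+
  ultimately show ?thesis by (simp add: indep_var_eq)
qed

end

section \<open>Innovations\<close>

text \<open>The regions u \<le> r and r \<le> u cover the plane and overlap in the diagonal, which
  meets each line in a null set. This produces the cancellation in
  \<open>innov_isometry\<close>.\<close>

lemma integral_triangle:
  fixes \<Phi> :: "real \<Rightarrow> real \<Rightarrow> real"
  assumes I: "integrable (lborel \<Otimes>\<^sub>M lborel) (\<lambda>(r, u). \<Phi> r u)"
  shows "(LINT r|lborel. LINT u|lborel. indicator {..r} u * \<Phi> r u) + (LINT u|lborel. LINT r|lborel. indicator {..u} r * \<Phi> r u)
    = (LINT r|lborel. LINT u|lborel. \<Phi> r u)"
proof -
  have m[measurable]: "(\<lambda>(r, u). \<Phi> r u) \<in> borel_measurable (lborel \<Otimes>\<^sub>M lborel)" using I by auto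
  have i1: "integrable (lborel \<Otimes>\<^sub>M lborel) (\<lambda>(r, u). indicator {..r} u * \<Phi> r u)"
  proof (rule Bochner_Integration.integrable_bound[OF I])
    have "(\<lambda>(r, u). (if u \<le> r then 1 else 0) * \<Phi> r u) \<in> borel_measurable (lborel \<Otimes>\<^sub>M lborel)" by measurable
    also have "(\<lambda>(r, u). (if u \<le> r then 1 else 0) * \<Phi> r u) = (\<lambda>(r, u). indicator {..r} u * \<Phi> r u)"
      by (auto simp: fun_eq_iff)
    finally show "(\<lambda>(r, u). indicator {..r} u * \<Phi> r u) \<in> borel_measurable (lborel \<Otimes>\<^sub>M lborel)" .
  qed (auto simp: indicator_def)
  have i2: "integrable (lborel \<Otimes>\<^sub>M lborel) (\<lambda>(r, u). indicator {..u} r * \<Phi> r u)"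
  proof (rule Bochner_Integration.integrable_bound[OF I])
    have "(\<lambda>(r, u). (if r \<le> u then 1 else 0) * \<Phi> r u) \<in> borel_measurable (lborel \<Otimes>\<^sub>M lborel)" by measurable
    also have "(\<lambda>(r, u). (if r \<le> u then 1 else 0) * \<Phi> r u) = (\<lambda>(r, u). indicator {..u} r * \<Phi> r u)"
      by (auto simp: fun_eq_iff)
    finally show "(\<lambda>(r, u). indicator {..u} r * \<Phi> r u) \<in> borel_measurable (lborel \<Otimes>\<^sub>M lborel)" .
  qed (auto simp: indicator_def)
  have "(LINT u|lborel. LINT r|lborel. indicator {..u} r * \<Phi> r u) = (LINT r|lborel. LINT u|lborel. indicator {..u} r * \<Phi> r u)"
    using lborel_pair.integral_snd[OF i2] lborel_pair.integral_fst[OF i2] by simp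
  moreover have "(LINT r|lborel. LINT u|lborel. indicator {..r} u * \<Phi> r u) + (LINT r|lborel. LINT u|lborel. indicator {..u} r * \<Phi> r u)
    = (LINT r|lborel. (LINT u|lborel. indicator {..r} u * \<Phi> r u) + (LINT u|lborel. indicator {..u} r * \<Phi> r u))"
    by (rule Bochner_Integration.integral_add[symmetric, OF lborel_pair.integrable_fst[OF i1] lborel_pair.integrable_fst[OF i2]])
  moreover have "\<dots> = (LINT r|lborel. LINT u|lborel. \<Phi> r u)"
  proof (rule integral_cong_AE)
    show "(\<lambda>r. (LINT u|lborel. indicator {..r} u * \<Phi> r u) + (LINT u|lborel. indicator {..u} r * \<Phi> r u)) \<in> borel_measurable lborel"
      using lborel_pair.integrable_fst[OF i1] lborel_pair.integrable_fst[OF i2] by auto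
    show "(\<lambda>r. LINT u|lborel. \<Phi> r u) \<in> borel_measurable lborel" using lborel_pair.integrable_fst[OF I] by auto
    show "AE r in lborel. (LINT u|lborel. indicator {..r} u * \<Phi> r u) + (LINT u|lborel. indicator {..u} r * \<Phi> r u) = (LINT u|lborel. \<Phi> r u)"
      using lborel_pair.AE_integrable_fst[OF i1] lborel_pair.AE_integrable_fst[OF i2] lborel_pair.AE_integrable_fst[OF I]
    proof eventually_elim
      case (elim r)
      have "(LINT u|lborel. indicator {..r} u * \<Phi> r u) + (LINT u|lborel. indicator {..u} r * \<Phi> r u)
          = (LINT u|lborel. indicator {..r} u * \<Phi> r u + indicator {..u} r * \<Phi> r u)"
        using elim by simp
      also have "\<dots> = (LINT u|lborel. \<Phi> r u)"
      proof (rule integral_cong_AE)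
        show "(\<lambda>u. indicator {..r} u * \<Phi> r u + indicator {..u} r * \<Phi> r u) \<in> borel_measurable lborel" using elim by auto
        show "\<Phi> r \<in> borel_measurable lborel" using elim by auto
        have "AE u in lborel. u \<noteq> r" by (rule AE_lborel_singleton)
        then show "AE u in lborel. indicator {..r} u * \<Phi> r u + indicator {..u} r * \<Phi> r u = \<Phi> r u"
          by eventually_elim (auto simp: indicator_def)
      qed
      finally show ?case .
    qed
  qed
  ultimately show ?thesis by simp
qed

lemma ip_bounded_mult_le:
  assumes f: "sqint M f" and g: "g \<in> borel_measurable M" "\<And>s. \<bar>g s\<bar> \<le> K"
  shows "norm_sq M (\<lambda>s. f s * g s) \<le> K\<^sup>2 * norm_sq M f"
proof -
  have [measurable]: "f \<in> borel_measurable M" "g \<in> borel_measurable M" using f g by (auto simp: sqint_def)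
  have le: "(f s * g s) * (f s * g s) \<le> K\<^sup>2 * (f s * f s)" for s
  proof -
    have "(g s)\<^sup>2 \<le> K\<^sup>2" using g(2)[of s] by (simp add: abs_le_square_iff[symmetric])
    then have "(f s)\<^sup>2 * (g s)\<^sup>2 \<le> (f s)\<^sup>2 * K\<^sup>2" by (intro mult_left_mono) auto
    then show ?thesis by (simp add: power2_eq_square mult_ac)
  qed
  have i: "integrable M (\<lambda>s. K\<^sup>2 * (f s * f s))" using sqint_integrable_mult[OF f f] by simp
  have "integrable M (\<lambda>s. (f s * g s) * (f s * g s))"
    by (rule Bochner_Integration.integrable_bound[OF i]) (use le in auto)
  then have "norm_sq M (\<lambda>s. f s * g s) \<le> (LINT s|M. K\<^sup>2 * (f s * f s))"
    unfolding ip_def using i le by (intro integral_mono)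
  then show ?thesis by (simp add: ip_def)
qed

text \<open>The model on a fixed horizon \<open>T\<close>, with \<open>B\<close> as observation
  noise. \<open>FX\<close> stands for the sigma-algebra of the initial value and the signal noise.
  \<open>K\<close> bounds both coefficients on the whole line, whereas \<open>\<delta>\<close>
  bounds \<open>D\<close> away from 0 on [0,T] only, since truncated coefficients vanish
  outside.\<close>

locale linear_filter = brownian M B for M :: "'a measure" and B +
  fixes FX :: "'a measure" and X Xh Y :: "real \<Rightarrow> 'a \<Rightarrow> real" and G D :: "real \<Rightarrow> real" and T K \<delta> y0 :: real
  assumes T0: "0 \<le> T"
    and FX: "subalgebra M FX" and FX_indep: "indep_set (sets FX) (sets (generated_sigma M (B ` {0..})))"
    and X: "l2process M T X" and X_FX: "\<And>s. X s \<in> borel_measurable FX"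
    and X_gauss: "\<And>f. f \<in> lspan (X ` {0..T}) \<Longrightarrow> gauss_char M f"
    and G: "G \<in> borel_measurable borel" "\<And>s. \<bar>G s\<bar> \<le> K"
    and D: "D \<in> borel_measurable borel" "\<And>s. \<bar>D s\<bar> \<le> K"
    and \<delta>: "0 < \<delta>" "\<And>s. s \<in> {0..T} \<Longrightarrow> \<delta> \<le> \<bar>D s\<bar>"
    and Y: "\<And>s. s \<in> {0..T} \<Longrightarrow> Y s \<in> borel_measurable M"
      "\<And>s. s \<in> {0..T} \<Longrightarrow> AE \<omega> in M. Y s \<omega> = y0 +
         ((LINT r|lborel. indicator {0..s} r * G r * X r \<omega>) + wiener_integral M B D s \<omega>)"
    and Xh: "l2process M T Xh"
      "\<And>s. s \<in> {0..T} \<Longrightarrow> AE \<omega> in M. Xh s \<omega> = real_cond_exp M (generated_sigma M (Y ` {0..s})) (X s) \<omega>"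
begin

section \<open>Orthogonality of signal and noise, and the Gaussian space they span\<close>

lemmas sqX = l2process_sqint[OF X] and sqXh = l2process_sqint[OF Xh(1)]

lemma gen_B: "subalgebra M (generated_sigma M (B ` {0..}))"
  "g \<in> B ` {0..} \<Longrightarrow> g \<in> borel_measurable (generated_sigma M (B ` {0..}))"
  by (rule generated_sigma_measurable; use B_measurable in auto)+

text \<open>Independence and zero mean give orthogonality to each \<open>B s\<close>; the closed
  span inherits it.\<close>

lemma FX_perp_B:
  assumes f: "f \<in> borel_measurable FX" "sqint M f" and Z: "Z \<in> cspan M (B ` {0..T})"
  shows "ip M f Z = 0"
proof (rule cspanD[OF Z f(2)])
  fix g assume "g \<in> B ` {0..T}"
  then obtain s where s: "0 \<le> s" "g = B s" by auto
  have "indep_var borel f borel g"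
    by (rule indep_var_of_indep_set[OF FX_indep FX gen_B(1) f(1) gen_B(2)]) (use s in auto)
  then have "ip M f g = (LINT \<omega>|M. f \<omega>) * (LINT \<omega>|M. g \<omega>)"
    unfolding ip_def using f s sqint_B by (intro indep_var_lebesgue_integral sqint_integrable) auto
  then show "ip M f g = 0" using B_moments(1) s by simp
qed

lemma X_perp_B: "Z \<in> cspan M (B ` {0..T}) \<Longrightarrow> ip M (X s) Z = 0"
  using FX_perp_B[OF X_FX sqX] .

lemma mean_B: "Z \<in> cspan M (B ` {0..T}) \<Longrightarrow> (LINT \<omega>|M. Z \<omega>) = 0"
  using FX_perp_B[of "\<lambda>_. 1" Z] by simp

lemma time_integral_X_perp_B:
  assumes Z: "Z \<in> cspan M (B ` {0..T})" and a: "sqint lborel a"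
  shows "ip M Z (time_integral a X) = 0"
  using time_integral_ip(2)[OF X a cspan_sqint[OF Z]] X_perp_B[OF Z] by (simp add: ip_commute[of M Z])

text \<open>The closed span of this set is the Gaussian Hilbert space of the model; observations,
  estimates and errors on [0,T] all lie in it.\<close>

definition gsys :: "('a \<Rightarrow> real) set" where
  "gsys = insert (\<lambda>_. 1) (X ` {0..T} \<union> B ` {0..T})"

lemma gsys_sqint: "g \<in> gsys \<Longrightarrow> sqint M g"
  unfolding gsys_def using sqX sqint_B by auto

text \<open>Each combination splits into a constant, a signal part measurable for \<open>FX\<close>,
  and a noise part independent of it; the two random parts are Gaussian separately.\<close>

lemma gsys_lspan_gauss: assumes "f \<in> lspan gsys" shows "gauss_char M f"
proof -
  \<comment> \<open>The factor 1 fits the form a + b \<xi> of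
    \<open>gauss_char_affine\<close>.\<close>
  from assms have "\<exists>c fx fb. fx \<in> lspan (X ` {0..T}) \<and> fb \<in> lspan (B ` {0..}) \<and> f = (\<lambda>\<omega>. c + 1 * (fx \<omega> + fb \<omega>))"
  proof induction
    case lspan_zero
    have "(\<lambda>_. 0) \<in> lspan (X ` {0..T})" "(\<lambda>_. 0) \<in> lspan (B ` {0..})" by (auto intro: lspan.lspan_zero)
    then show ?case by (intro exI[of _ 0] exI[of _ "\<lambda>_. 0"]) auto
  next
    case (lspan_step f g a)
    then obtain c fx fb where IH: "fx \<in> lspan (X ` {0..T})" "fb \<in> lspan (B ` {0..})" "f = (\<lambda>\<omega>. c + 1 * (fx \<omega> + fb \<omega>))" by blast
    consider "g = (\<lambda>_. 1)" | "g \<in> X ` {0..T}" | "g \<in> B ` {0..}" using lspan_step(2) unfolding gsys_def by auto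
    then show ?case
    proof cases
      case 1
      then show ?thesis using IH by (intro exI[of _ "c + a"] exI[of _ fx] exI[of _ fb]) auto
    next
      case 2
      then show ?thesis using IH lspan.lspan_step[OF IH(1) 2, of a]
        by (intro exI[of _ c] exI[of _ "\<lambda>\<omega>. fx \<omega> + a * g \<omega>"] exI[of _ fb]) (auto simp: fun_eq_iff)
    next
      case 3
      then show ?thesis using IH lspan.lspan_step[OF IH(2) 3, of a]
        by (intro exI[of _ c] exI[of _ fx] exI[of _ "\<lambda>\<omega>. fb \<omega> + a * g \<omega>"]) (auto simp: fun_eq_iff)
    qed
  qed
  then obtain c fx fb where f: "fx \<in> lspan (X ` {0..T})" "fb \<in> lspan (B ` {0..})" "f = (\<lambda>\<omega>. c + 1 * (fx \<omega> + fb \<omega>))" by blast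
  have fxm: "fx \<in> borel_measurable FX" by (rule lspan_measurable[OF f(1)]) (use X_FX in auto)
  have fbm: "fb \<in> borel_measurable (generated_sigma M (B ` {0..}))" by (rule lspan_measurable[OF f(2) gen_B(2)])
  have "indep_var borel fx borel fb"
    by (rule indep_var_of_indep_set[OF FX_indep FX gen_B(1) fxm fbm])
  then have "gauss_char M (\<lambda>\<omega>. fx \<omega> + fb \<omega>)"
    by (intro gauss_char_add_indep X_gauss gauss_char_lspan_B f)
  from gauss_char_affine[OF this, of c 1] show ?thesis unfolding f(3) .
qed

lemma gsys_cspan_gauss: assumes "f \<in> cspan M gsys" shows "gauss_char M f"
proof -
  obtain u where u: "\<And>n. u n \<in> lspan gsys" "l2conv M u f"
    using cspan_approx[OF gsys_sqint assms] by metis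
  show ?thesis by (rule gauss_char_l2conv[OF gsys_lspan_gauss[OF u(1)] u(2)])
qed

section \<open>Integrals of deterministic kernels against the observations\<close>

definition obs :: "(real \<Rightarrow> real) \<Rightarrow> 'a \<Rightarrow> real" where
  "obs f \<omega> = time_integral (\<lambda>r. f r * G r) X \<omega> + wiener_integral M B (\<lambda>r. f r * D r) T \<omega>"

lemma kernG: "kern S f \<Longrightarrow> kern S (\<lambda>r. f r * G r)" by (rule kern_bounded_mult[OF _ G])
lemma kernD: "kern S f \<Longrightarrow> kern S (\<lambda>r. f r * D r)" by (rule kern_bounded_mult[OF _ D])

lemma obs_sqint: assumes "kern T f" shows "sqint M (obs f)"
  unfolding obs_def[abs_def]
  by (intro sqint_add time_integral_sqint[OF X kern_sqint[OF kernG[OF assms]]] wiener_sqint kernD[OF assms])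

lemma time_integral_linear:
  assumes V: "l2process M T V" and a: "sqint lborel a" and b: "sqint lborel b"
  shows "AE \<omega> in M. time_integral (\<lambda>s. a s + c * b s) V \<omega> = time_integral a V \<omega> + c * time_integral b V \<omega>"
  using time_integral_AE_integrable[OF V a] time_integral_AE_integrable[OF V b]
proof eventually_elim
  case (elim \<omega>)
  then show ?case by (simp add: time_integral_def distrib_right mult.assoc)
qed

lemma obs_linear:
  assumes f: "kern T f" and g: "kern T g"
  shows "AE \<omega> in M. obs (\<lambda>s. f s + c * g s) \<omega> = obs f \<omega> + c * obs g \<omega>"
proof -
  have e: "(\<lambda>r. (f r + c * g r) * G r) = (\<lambda>r. f r * G r + c * (g r * G r))"
    "(\<lambda>r. (f r + c * g r) * D r) = (\<lambda>r. f r * D r + c * (g r * D r))" by (auto simp: fun_eq_iff algebra_simps)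
  show ?thesis
    unfolding obs_def e
    using time_integral_linear[OF X kern_sqint[OF kernG[OF f]] kern_sqint[OF kernG[OF g]], of c]
      wiener_linear[OF kernD[OF f] kernD[OF g], of c]
  proof eventually_elim
    case (elim \<omega>)
    then show ?case by (simp only: distrib_left add_ac)
  qed
qed

text \<open>Comes from (a + b)^2 \<le> 2 a^2 + 2 b^2, with Cauchy-Schwarz for the drift and the
  isometry for the noise. Its purpose is the continuity of \<open>obs\<close> in the kernel.\<close>

definition CX :: real where "CX = 2 * K\<^sup>2 * (LINT s|lborel. norm_sq M (X s)) + 2 * K\<^sup>2"

lemma obs_bound: assumes f: "kern T f" shows "norm_sq M (obs f) \<le> CX * norm_sq lborel f"
proof -
  note a = kern_sqint[OF kernG[OF f]]
  have n: "0 \<le> (LINT s|lborel. norm_sq M (X s))" by simp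
  have "norm_sq M (obs f) \<le> 2 * norm_sq M (time_integral (\<lambda>r. f r * G r) X)
      + 2 * norm_sq M (wiener_integral M B (\<lambda>r. f r * D r) T)"
    unfolding obs_def[abs_def] by (intro ip_add_le time_integral_sqint[OF X a] wiener_sqint kernD f)
  also have "norm_sq M (wiener_integral M B (\<lambda>r. f r * D r) T) \<le> K\<^sup>2 * norm_sq lborel f"
    using D by (simp add: wiener_isometry[OF kernD[OF f] kernD[OF f]] ip_bounded_mult_le kern_sqint[OF f])
  also have "norm_sq M (time_integral (\<lambda>r. f r * G r) X)
      \<le> norm_sq lborel (\<lambda>r. f r * G r) * (LINT s|lborel. norm_sq M (X s))"
    by (rule time_integral_sqint_bound(2)[OF X a])
  also have "\<dots> \<le> (K\<^sup>2 * norm_sq lborel f) * (LINT s|lborel. norm_sq M (X s))"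
    using G by (intro mult_right_mono n ip_bounded_mult_le kern_sqint[OF f]) auto
  finally show ?thesis by (simp add: CX_def algebra_simps)
qed

text \<open>The constant 1 is included so that projections preserve the mean, as conditional
  expectations do.\<close>

definition ysys :: "real \<Rightarrow> ('a \<Rightarrow> real) set" where "ysys s = insert (\<lambda>_. 1) (Y ` {0..s})"

lemma kern_ind: "s \<in> {0..T} \<Longrightarrow> kern s (indicator {0..s})"
  using kern_bounded[of s "\<lambda>_. 1" 1] by simp

text \<open>\<open>obs\<close> keeps the horizon \<open>T\<close> and encodes the time interval in
  the support of the kernel. The noise integral up to s is thus rewritten with a cut-off kernel and
  then extended to \<open>T\<close>.\<close>

lemma Y_obs:
  assumes s: "s \<in> {0..T}"
  shows "AE \<omega> in M. Y s \<omega> = y0 + obs (indicator {0..s}) \<omega>"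
proof -
  have k: "kern s (indicator {0..s})" by (rule kern_ind[OF s])
  have "wiener_integral M B D s = wiener_integral M B (\<lambda>r. indicator {0..s} r * D r) s"
    by (rule wiener_integral_cong) auto
  with Y(2)[OF s] wiener_horizon[OF kernD[OF k], of T] s show ?thesis
    by (auto simp: obs_def time_integral_def elim!: eventually_elim2)
qed

lemma obs_gsys: assumes f: "kern T f" shows "obs f \<in> cspan M gsys"
proof -
  have "time_integral (\<lambda>r. f r * G r) X \<in> cspan M gsys"
    by (rule time_integral_cspan[OF X kern_sqint[OF kernG[OF f]]], rule cspan_base) (auto simp: gsys_def sqX)
  moreover have "wiener_integral M B (\<lambda>r. f r * D r) T \<in> cspan M gsys"
    by (rule cspan_trans[OF wiener_cspan[OF kernD[OF f]]], rule cspan_base) (auto simp: gsys_def sqint_B)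
  ultimately show ?thesis unfolding obs_def[abs_def] by (rule cspan_add)
qed

lemma const_cspan: "(\<lambda>_. 1) \<in> S \<Longrightarrow> (\<lambda>_. c) \<in> cspan M S"
  using cspan_cmult[OF cspan_base[of "\<lambda>_. 1" S M], of c] by simp

lemma Y_gsys: assumes s: "s \<in> {0..T}" shows "Y s \<in> cspan M gsys"
proof -
  have k: "kern T (indicator {0..s})" using kern_mono[OF kern_ind[OF s]] s by simp
  have "(\<lambda>\<omega>. y0 + obs (indicator {0..s}) \<omega>) \<in> cspan M gsys"
    by (intro cspan_add const_cspan obs_gsys k) (simp add: gsys_def)
  then show ?thesis by (rule cspan_AE[OF _ Y(1)[OF s] Y_obs[OF s]])
qed

lemma Y_sqint: "s \<in> {0..T} \<Longrightarrow> sqint M (Y s)" using Y_gsys cspan_sqint by blast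

lemma ysys_sqint: "s \<in> {0..T} \<Longrightarrow> g \<in> ysys s \<Longrightarrow> sqint M g"
  unfolding ysys_def using Y_sqint by auto

lemma ysys_mono: "r \<le> s \<Longrightarrow> f \<in> cspan M (ysys r) \<Longrightarrow> f \<in> cspan M (ysys s)"
proof -
  assume "r \<le> s" "f \<in> cspan M (ysys r)"
  moreover from this have "ysys r \<subseteq> ysys s" by (auto simp: ysys_def)
  ultimately show ?thesis using cspan_mono by blast
qed

text \<open>Joint Gaussianity turns the orthogonal projection onto the linear span of the observations into
  the conditional expectation.\<close>

lemma Xh_cspan: assumes s: "s \<in> {0..T}" shows "Xh s \<in> cspan M (ysys s)"
proof -
  let ?F = "generated_sigma M (Y ` {0..s})"
  have Ym: "g \<in> borel_measurable M" if "g \<in> Y ` {0..s}" for g using that Y(1) s by auto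
  have sub: "subalgebra M ?F" and Ygen: "\<And>g. g \<in> Y ` {0..s} \<Longrightarrow> g \<in> borel_measurable ?F"
    using generated_sigma_measurable[OF Ym] by auto
  interpret SF: sigma_finite_subalgebra M ?F
    by (rule sigma_finite_subalgebra_of_subalgebra[OF sub])
  obtain u P where u: "\<And>n. u n \<in> lspan (ysys s)" "l2conv M u P"
    and o: "\<And>g. g \<in> ysys s \<Longrightarrow> ip M (\<lambda>\<omega>. X s \<omega> - P \<omega>) g = 0"
    by (rule sqint_projection[of "ysys s" M "X s", OF ysys_sqint[OF s] sqX]) (assumption, rule that)
  have sP: "sqint M P" using u by (simp add: l2conv_def)
  have P: "P \<in> cspan M (ysys s)"
    using u(2) by (rule l2conv_cspan) (intro lspan_cspan[OF u(1)] ysys_sqint[OF s])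
  have yg: "g \<in> cspan M gsys" if "g \<in> ysys s" for g
    using that Y_gsys s const_cspan[of gsys 1] by (auto simp: ysys_def gsys_def)
  have Pg: "P \<in> cspan M gsys" by (rule cspan_trans[OF P yg])
  define U where "U \<omega> = X s \<omega> - P \<omega>" for \<omega>
  have sU: "sqint M U" unfolding U_def[abs_def] using sqX sP by simp
  have Ug: "U \<in> cspan M gsys" unfolding U_def[abs_def]
    using s by (intro cspan_diff Pg cspan_base sqX) (auto simp: gsys_def)
  \<comment> \<open>The residual of the projection is uncorrelated with the observations; being
    jointly Gaussian with them and centred, it integrates to 0 over every event they
    generate.\<close>
  have "(LINT \<omega>:A|M. U \<omega>) = 0" if A: "A \<in> sets ?F" for A
  proof (rule set_integral_generated_sigma_eq_0[OF sqint_integrable[OF sU] Ym _ A])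
    fix v assume v: "v \<in> lspan (Y ` {0..s})"
    have vs: "v \<in> cspan M (Y ` {0..s})" using v Y_sqint s by (intro lspan_cspan) auto
    have vg: "v \<in> cspan M gsys" by (rule cspan_trans[OF vs]) (use yg in \<open>auto simp: ysys_def\<close>)
    show "(CLINT \<omega>|M. U \<omega> * iexp (v \<omega>)) = 0"
    proof (rule integral_mult_iexp_eq_0[OF _ sU cspan_sqint[OF vs]])
      show "gauss_char M (\<lambda>\<omega>. a * U \<omega> + v \<omega>)" for a
        by (intro gsys_cspan_gauss cspan_add cspan_cmult Ug vg)
      show "(LINT \<omega>|M. U \<omega>) = 0" using o[of "\<lambda>_. 1"] by (simp add: U_def[abs_def] ysys_def)
      show "ip M U v = 0" by (rule cspanD[OF vs sU]) (use o in \<open>auto simp: U_def[abs_def] ysys_def\<close>)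
    qed
  qed auto
  \<comment> \<open>A mean-square limit of observations is measurable for the raw generated
    sigma-algebra only up to null sets. The conditional expectation \<open>P'\<close> of
    \<open>P\<close> serves as a genuinely measurable version.\<close>
  define P' where "P' = real_cond_exp M ?F P"
  have iX: "integrable M (X s)" and iP: "integrable M P" using sqX sP sqint_integrable by auto
  have [measurable]: "P' \<in> borel_measurable M" unfolding P'_def by simp
  have Pm: "P' \<in> borel_measurable ?F" unfolding P'_def by simp
  have iP': "integrable M P'" unfolding P'_def using iP by (rule SF.real_cond_exp_int)
  have "(\<integral>x\<in>A. X s x \<partial>M) = (\<integral>x\<in>A. P' x \<partial>M)" if A: "A \<in> sets ?F" for A
  proof -
    have AM: "A \<in> sets M" using A sub by (auto simp: subalgebra_def)
    have "(\<integral>x\<in>A. X s x \<partial>M) - (\<integral>x\<in>A. P x \<partial>M) = (LINT \<omega>:A|M. U \<omega>)"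
      unfolding U_def
      using integrable_mult_indicator[OF AM iX] integrable_mult_indicator[OF AM iP]
      by (subst set_integral_diff) (auto simp: set_integrable_def)
    then show ?thesis using \<open>\<And>A. A \<in> sets ?F \<Longrightarrow> (LINT \<omega>:A|M. U \<omega>) = 0\<close>[OF A]
      SF.real_cond_exp_intA[OF iP A] unfolding P'_def by simp
  qed
  from SF.real_cond_exp_charact[OF this iX iP' Pm] have "AE x in M. real_cond_exp M ?F (X s) x = P' x" .
  with Xh(2)[OF s] have XP: "AE x in M. Xh s x = P' x" by eventually_elim simp
  then have "AE x in M. P' x = Xh s x" by eventually_elim simp
  then have sP': "sqint M P'" by (intro sqint_AE[OF sqXh[of s]]) auto
  \<comment> \<open>This difference is orthogonal to \<open>P\<close>, which lies in the closed span
    of measurable variables, and to \<open>P'\<close>, which is measurable itself; hence it is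
    orthogonal to itself.\<close>
  define q where "q \<omega> = P \<omega> - P' \<omega>" for \<omega>
  have sq: "sqint M q" unfolding q_def[abs_def] using sP sP' by simp
  have perp: "ip M q g = 0" if g: "g \<in> borel_measurable ?F" "sqint M g" for g
  proof -
    have "(LINT x|M. g x * P' x) = (LINT x|M. g x * P x)"
      unfolding P'_def using sqint_integrable_mult[OF g(2) sP] g(1) sP
      by (intro SF.real_cond_exp_intg(2)) (auto simp: sqint_def)
    then have "ip M g P' = ip M g P" by (simp add: ip_def)
    then show ?thesis unfolding q_def[abs_def]
      using sP sP' g by (simp add: ip_diff_right ip_commute[of M "\<lambda>\<omega>. P \<omega> - P' \<omega>" g])
  qed
  have "ip M q P = 0"
    by (rule cspanD[OF P sq], rule perp) (use Ygen ysys_sqint[OF s] in \<open>auto simp: ysys_def\<close>)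
  moreover have "ip M q P' = 0" by (rule perp[OF Pm sP'])
  ultimately have "ip M q (\<lambda>\<omega>. P \<omega> - P' \<omega>) = 0" using sP sP' sq by (simp add: ip_diff_right)
  then have "norm_sq M q = 0" by (simp add: q_def[abs_def])
  from ip_eq_0_AE[OF sq this] XP have "AE x in M. Xh s x = P x"
    unfolding q_def by eventually_elim simp
  then show ?thesis by (rule cspan_AE[OF P sqint_measurable[OF sqXh]])
qed

definition Xt :: "real \<Rightarrow> 'a \<Rightarrow> real" where "Xt s \<omega> = X s \<omega> - Xh s \<omega>"

lemma sqXt: "sqint M (Xt s)" unfolding Xt_def[abs_def] using sqX sqXh by simp

text \<open>The defining property of the conditional expectation, tested on the generators of the
  closed span, which are measurable for the observation sigma-algebra.\<close>

lemma Xt_perp: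
  assumes s: "s \<in> {0..T}" and Z: "Z \<in> cspan M (ysys s)" shows "ip M (Xt s) Z = 0"
proof (rule cspanD[OF Z sqXt])
  let ?F = "generated_sigma M (Y ` {0..s})"
  have Ym: "g \<in> borel_measurable M" if "g \<in> Y ` {0..s}" for g using that Y(1) s by auto
  have sub: "subalgebra M ?F" and Ygen: "\<And>g. g \<in> Y ` {0..s} \<Longrightarrow> g \<in> borel_measurable ?F"
    using generated_sigma_measurable[OF Ym] by auto
  interpret SF: sigma_finite_subalgebra M ?F
    by (rule sigma_finite_subalgebra_of_subalgebra[OF sub])
  fix g assume g: "g \<in> ysys s"
  then have gF: "g \<in> borel_measurable ?F" using Ygen by (auto simp: ysys_def)
  have sg: "sqint M g" by (rule ysys_sqint[OF s g])
  have "ip M g (Xh s) = ip M g (real_cond_exp M ?F (X s))"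
    using Xh(2)[OF s] sg sqXh[of s] by (intro ip_cong_AE) (auto simp: sqint_def)
  also have "\<dots> = ip M g (X s)" unfolding ip_def
    using sqint_integrable_mult[OF sg sqX] gF sqX[of s] by (intro SF.real_cond_exp_intg(2)) (auto simp: sqint_def)
  finally show "ip M (Xt s) g = 0" unfolding Xt_def[abs_def]
    using sg sqX sqXh by (simp add: ip_diff_right ip_commute[of M "\<lambda>\<omega>. X s \<omega> - Xh s \<omega>" g])
qed

lemma Xt_norm: assumes "s \<in> {0..T}"
  shows "norm_sq M (X s) = norm_sq M (Xt s) + norm_sq M (Xh s)"
proof -
  have "ip M (Xt s) (Xh s) = 0" by (rule Xt_perp[OF assms Xh_cspan[OF assms]])
  moreover have "X s = (\<lambda>\<omega>. Xt s \<omega> + Xh s \<omega>)" by (simp add: Xt_def fun_eq_iff)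
  ultimately show ?thesis using sqXt sqXh by (simp add: ip_simps ip_commute[of M "Xh s" "Xt s"])
qed

lemma Xt: "l2process M T Xt"
proof (rule l2process_dominated[OF X])
  have [measurable]: "(\<lambda>(s, \<omega>). X s \<omega>) \<in> borel_measurable (lborel \<Otimes>\<^sub>M M)"
    "(\<lambda>(s, \<omega>). Xh s \<omega>) \<in> borel_measurable (lborel \<Otimes>\<^sub>M M)" using X Xh(1) by (auto simp: l2process_def)
  show "(\<lambda>(s, \<omega>). Xt s \<omega>) \<in> borel_measurable (lborel \<Otimes>\<^sub>M M)" unfolding Xt_def by measurable
  show "Xt s \<omega> = 0" if "s \<notin> {0..T}" for s \<omega> using X Xh(1) that by (simp add: l2process_def Xt_def)
  then have z: "Xt s = (\<lambda>_. 0)" if "s \<notin> {0..T}" for s using that by (simp add: fun_eq_iff)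
  show "norm_sq M (Xt s) \<le> norm_sq M (X s)" for s
    using Xt_norm[of s] z[of s] by (cases "s \<in> {0..T}") auto
qed (rule sqXt)

lemma Xt_zero: "s \<notin> {0..T} \<Longrightarrow> Xt s = (\<lambda>_. 0)"
  using Xt by (auto simp: l2process_def fun_eq_iff)

lemma Xt_mean: "(LINT \<omega>|M. Xt s \<omega>) = 0"
proof (cases "s \<in> {0..T}")
  case True
  have "(\<lambda>_. 1) \<in> cspan M (ysys s)" by (rule const_cspan) (simp add: ysys_def)
  from Xt_perp[OF True this] show ?thesis by simp
qed (simp add: Xt_zero)

lemma obs_perp_linear:
  assumes "kern T f" "kern T g" "sqint M q"
  shows "ip M q (obs (\<lambda>s. f s + c * g s)) = ip M q (obs f) + c * ip M q (obs g)"
proof -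
  have k: "kern T (\<lambda>s. f s + c * g s)" using assms by (intro kern_add kern_cmult)
  have "ip M q (obs (\<lambda>s. f s + c * g s)) = ip M q (\<lambda>\<omega>. obs f \<omega> + c * obs g \<omega>)"
    using obs_linear[OF assms(1,2), of c] obs_sqint[OF k] obs_sqint[OF assms(1)] obs_sqint[OF assms(2)] assms(3)
    by (intro ip_cong_AE) (auto intro: sqint_measurable)
  then show ?thesis using assms by (simp add: ip_simps obs_sqint)
qed

text \<open>Paired with a \<open>q\<close> orthogonal to the observations, \<open>obs\<close> is a
  linear functional of the kernel, continuous by \<open>obs_bound\<close> and zero on the indicators
  that come from \<open>Y s\<close>. These indicators span a dense set of kernels.\<close>

lemma obs_cspan:
  assumes r: "r \<in> {0..T}" and f: "kern r f" shows "obs f \<in> cspan M (ysys r)"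
proof (rule cspanI)
  have fT: "kern T f" using kern_mono[OF f] r by simp
  show "sqint M (obs f)" by (rule obs_sqint[OF fT])
  fix q assume q: "sqint M q" and o: "\<And>g. g \<in> ysys r \<Longrightarrow> ip M q g = 0"
  define l where "l g = ip M q (obs g)" for g
  have bound: "\<bar>l g\<bar> \<le> sqrt (norm_sq M q) * sqrt (CX * norm_sq lborel g)" if "kern T g" for g
  proof -
    have "\<bar>l g\<bar> \<le> sqrt (norm_sq M q) * sqrt (norm_sq M (obs g))"
      unfolding l_def by (rule ip_abs_le[OF q obs_sqint[OF that]])
    also have "\<dots> \<le> sqrt (norm_sq M q) * sqrt (CX * norm_sq lborel g)"
      using obs_bound[OF that] by (intro mult_left_mono) auto
    finally show ?thesis .
  qed
  have lind: "l (indicator {0..s}) = 0" if s: "s \<in> {0..r}" for s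
  proof -
    have sT: "s \<in> {0..T}" using s r by auto
    have k: "kern T (indicator {0..s})" using kern_mono[OF kern_ind[OF sT]] sT by simp
    have "ip M q (Y s) = ip M q (\<lambda>\<omega>. y0 + obs (indicator {0..s}) \<omega>)"
      using Y_obs[OF sT] Y(1)[OF sT] q obs_sqint[OF k] by (intro ip_cong_AE) (auto intro: sqint_measurable)
    also have "\<dots> = y0 * ip M q (\<lambda>_. 1) + l (indicator {0..s})"
      unfolding l_def using q obs_sqint[OF k] by (simp add: ip_add_right ip_const_right)
    finally show ?thesis using o[of "Y s"] o[of "\<lambda>_. 1"] s by (simp add: ysys_def)
  qed
  have lin: "l (\<lambda>s. g s + c * h s) = l g + c * l h" if "kern T g" "kern T h" for g h c
    unfolding l_def by (rule obs_perp_linear[OF that q])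
  have kIoc: "kern T (indicator {0<..s})" if "s \<in> {0..r}" for s
    using sqint_indicator_Ioc[of 0 s] that r T0 by (auto simp: kern_def)
  \<comment> \<open>The observations supply closed intervals [0,s], the dense family uses (0,s]. The
    kernels differ only at 0, and the bound on \<open>l\<close> disposes of that null set.\<close>
  have lIoc: "l (indicator {0<..s}) = 0" if s: "s \<in> {0..r}" for s
  proof -
    have k: "kern T (indicator {0..s})" using kern_mono[OF kern_ind[of s]] s r by auto
    let ?h = "\<lambda>u. indicator {0..s} u + (-1) * indicator {0<..s} u :: real"
    have kh: "kern T ?h" by (intro kern_add kern_cmult k kIoc s)
    have "AE u in lborel. u \<noteq> (0::real)" by (rule AE_lborel_singleton)
    then have "AE u in lborel. ?h u * ?h u = 0" by eventually_elim (auto simp: indicator_def)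
    then have "norm_sq lborel ?h = 0" unfolding ip_def by (rule integral_eq_zero_AE)
    then have "l ?h = 0" using bound[OF kh] by simp
    then show ?thesis using lin[OF k kIoc[OF s], of "-1"] lind[OF s] by simp
  qed
  obtain u where u: "\<And>k. u k \<in> lspan ((\<lambda>s. indicator {0<..s}) ` {0..r})" "l2conv lborel u f"
    using cspan_approx[OF _ kern_in_cspan[OF f]] sqint_indicator_Ioc by (metis (no_types, lifting) imageE)
  have lu: "kern T g \<and> l g = 0" if "g \<in> lspan ((\<lambda>s. indicator {0<..s}) ` {0..r})" for g
    using that
  proof induction
    case lspan_zero
    have "kern T (\<lambda>_. 0)" using T0 by (simp add: kern_def)
    moreover have "ip lborel (\<lambda>_. 0 :: real) (\<lambda>_. 0) = 0" by simp
    ultimately show ?case using bound[of "\<lambda>_. 0"] by simp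
  next
    case (lspan_step g h c)
    then have h: "kern T h" "l h = 0" using kIoc lIoc by auto
    then show ?case using lspan_step lin[of g h c] by (auto intro!: kern_add kern_cmult)
  qed
  have lim: "(\<lambda>n. sqrt (norm_sq M q) * sqrt (CX * norm_sq lborel (\<lambda>s. u n s - f s))) \<longlonglongrightarrow> 0"
    using u(2) unfolding l2conv_def by (intro tendsto_eq_intros) auto
  have "\<bar>l f\<bar> \<le> sqrt (norm_sq M q) * sqrt (CX * norm_sq lborel (\<lambda>s. u n s - f s))" for n
  proof -
    have un: "kern T (u n)" "l (u n) = 0" using lu[OF u(1)] by auto
    have "l (\<lambda>s. u n s + (-1) * f s) = l (u n) + (-1) * l f" by (rule lin[OF un(1) fT])
    then have "\<bar>l f\<bar> = \<bar>l (\<lambda>s. u n s - f s)\<bar>" using un by simp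
    then show ?thesis using bound[OF kern_diff[OF un(1) fT]] by simp
  qed
  then have "\<bar>l f\<bar> \<le> 0" by (intro LIMSEQ_le_const[OF lim]) auto
  then show "ip M q (obs f) = 0" by (simp add: l_def)
qed

section \<open>Innovation integrals\<close>

definition innov :: "(real \<Rightarrow> real) \<Rightarrow> 'a \<Rightarrow> real" where
  "innov f \<omega> = time_integral (\<lambda>r. f r * G r) Xt \<omega> + wiener_integral M B (\<lambda>r. f r * D r) T \<omega>"

lemma innov_sqint: assumes "kern T f" shows "sqint M (innov f)"
  unfolding innov_def[abs_def]
  by (intro sqint_add time_integral_sqint[OF Xt kern_sqint[OF kernG[OF assms]]] wiener_sqint kernD[OF assms])

text \<open>In this form, dY minus the estimated drift, the innovation integral is seen to be
  determined by the observations.\<close>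

lemma innov_obs:
  assumes f: "kern T f"
  shows "AE \<omega> in M. innov f \<omega> = obs f \<omega> - time_integral (\<lambda>r. f r * G r) Xh \<omega>"
proof -
  note a = kern_sqint[OF kernG[OF f]]
  show ?thesis
    using time_integral_AE_integrable[OF X a] time_integral_AE_integrable[OF Xh(1) a]
  proof eventually_elim
    case (elim \<omega>)
    then show ?case by (simp add: innov_def obs_def time_integral_def Xt_def right_diff_distrib)
  qed
qed

lemma time_integral_Xh_cspan:
  assumes r: "r \<in> {0..T}" and f: "kern r f" shows "time_integral (\<lambda>s. f s * G s) Xh \<in> cspan M (ysys r)"
proof -
  have fT: "kern T f" using kern_mono[OF f] r by simp
  show ?thesis
  proof (rule time_integral_cspan[OF Xh(1) kern_sqint[OF kernG[OF fT]]])
    fix s assume s: "s \<in> {0..T}" "f s * G s \<noteq> 0"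
    then have "s \<le> r" using f by (force simp: kern_def)
    then show "Xh s \<in> cspan M (ysys r)" using Xh_cspan[OF s(1)] ysys_mono by blast
  qed
qed

lemma innov_cspan:
  assumes r: "r \<in> {0..T}" and f: "kern r f" shows "innov f \<in> cspan M (ysys r)"
proof -
  have fT: "kern T f" using kern_mono[OF f] r by simp
  show ?thesis
    by (rule cspan_AE[OF cspan_diff[OF obs_cspan[OF r f] time_integral_Xh_cspan[OF r f]] _ innov_obs[OF fT]])
       (intro sqint_measurable innov_sqint fT)
qed

end

section \<open>Second-order structure of the innovations\<close>

context linear_filter
begin

lemma innov_mean: assumes f: "kern T f" shows "(LINT \<omega>|M. innov f \<omega>) = 0"
proof -
  note a = kern_sqint[OF kernG[OF f]]
  have "ip M (\<lambda>_. 1) (time_integral (\<lambda>r. f r * G r) Xt) = 0"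
    using time_integral_ip(2)[OF Xt a sqint_const[of 1]] by (simp add: Xt_mean)
  moreover have "(LINT \<omega>|M. wiener_integral M B (\<lambda>r. f r * D r) T \<omega>) = 0"
    by (rule mean_B[OF wiener_cspan[OF kernD[OF f]]])
  ultimately show ?thesis unfolding innov_def
    using time_integral_sqint[OF Xt a] wiener_sqint[OF kernD[OF f]] by (simp add: sqint_integrable)
qed

text \<open>Noise after time r is uncorrelated with the signal by independence, and with the noise
  in the observations up to r by disjointness of supports in the isometry; hence also with the
  estimate at r.\<close>

lemma Xt_perp_future:
  assumes r: "r \<in> {0..T}" and h: "kern T h" "\<And>u. u \<in> {0..r} \<Longrightarrow> h u = 0"
  shows "ip M (Xt r) (wiener_integral M B (\<lambda>u. h u * D u) T) = 0"
proof -
  let ?W = "wiener_integral M B (\<lambda>u. h u * D u) T"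
  have W: "?W \<in> cspan M (B ` {0..T})" by (rule wiener_cspan[OF kernD[OF h(1)]])
  have sW: "sqint M ?W" by (rule cspan_sqint[OF W])
  have "ip M ?W (Xh r) = 0"
  proof (rule cspanD[OF Xh_cspan[OF r] sW])
    fix g assume "g \<in> ysys r"
    then consider "g = (\<lambda>_. 1)" | s where "s \<in> {0..r}" "g = Y s" unfolding ysys_def by auto
    then show "ip M ?W g = 0"
    proof cases
      case 1
      then show ?thesis using mean_B[OF W] by simp
    next
      case 2
      then have s: "s \<in> {0..T}" using r by auto
      let ?i = "indicator {0..s} :: real \<Rightarrow> real"
      have k: "kern T ?i" using kern_mono[OF kern_ind[OF s]] s by simp
      note so = obs_sqint[OF k]
      have "ip M ?W (Y s) = ip M ?W (\<lambda>\<omega>. y0 + obs ?i \<omega>)"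
        using Y_obs[OF s] Y(1)[OF s] sW so by (intro ip_cong_AE) (auto intro: sqint_measurable)
      also have "\<dots> = ip M ?W (obs ?i)"
        using sW so mean_B[OF W] by (simp add: ip_add_right ip_const_right)
      also have "\<dots> = ip M ?W (time_integral (\<lambda>r. ?i r * G r) X) + ip M ?W (wiener_integral M B (\<lambda>r. ?i r * D r) T)"
        unfolding obs_def[abs_def]
        by (intro ip_add_right time_integral_sqint[OF X kern_sqint[OF kernG[OF k]]] wiener_sqint[OF kernD[OF k]] sW)
      also have "ip M ?W (time_integral (\<lambda>r. ?i r * G r) X) = 0"
        by (rule time_integral_X_perp_B[OF W kern_sqint[OF kernG[OF k]]])
      also have "ip M ?W (wiener_integral M B (\<lambda>r. ?i r * D r) T) = ip lborel (\<lambda>u. h u * D u) (\<lambda>r. ?i r * D r)"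
        by (rule wiener_isometry[OF kernD[OF h(1)] kernD[OF k]])
      also have "\<dots> = 0"
      proof -
        have z: "h u * D u * (?i u * D u) = 0" for u using h(2)[of u] 2(1) by (auto simp: indicator_def)
        show ?thesis unfolding ip_def z by simp
      qed
      finally show ?thesis using 2 by simp
    qed
  qed
  moreover have "ip M (X r) ?W = 0" by (rule X_perp_B[OF W])
  ultimately show ?thesis unfolding Xt_def[abs_def]
    using sqX sqXh sW by (simp add: ip_diff_left ip_commute[of M "Xh r" ?W])
qed

text \<open>Split the kernel at r. The part after r is future noise and contributes nothing. For the
  part up to r the error is orthogonal to the innovation integral, so the noise term is minus the
  drift term.\<close>

lemma Xt_wiener:
  assumes g: "kern T g"
  shows "ip M (Xt r) (wiener_integral M B (\<lambda>u. g u * D u) T)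
    = - (LINT u|lborel. indicator {..r} u * (g u * G u * ip M (Xt r) (Xt u)))"
proof (cases "r \<in> {0..T}")
  case False
  then show ?thesis by (simp add: Xt_zero)
next
  case r: True
  define g1 where "g1 u = indicator {0..r} u * g u" for u
  define g2 where "g2 u = g u - g1 u" for u
  have g1: "kern T g1" unfolding g1_def by (rule kern_indicator_mult[OF g]) simp
  have g1r: "kern r g1" using g1 r by (auto simp: kern_def g1_def)
  have g2: "kern T g2" unfolding g2_def by (rule kern_diff[OF g g1])
  let ?W = "\<lambda>f. wiener_integral M B (\<lambda>u. f u * D u) T"
  note sW = wiener_sqint[OF kernD[OF g]] wiener_sqint[OF kernD[OF g1]] wiener_sqint[OF kernD[OF g2]]
  have "(\<lambda>u. g u * D u) = (\<lambda>u. g1 u * D u + 1 * (g2 u * D u))" by (simp add: g2_def fun_eq_iff algebra_simps)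
  then have ae: "AE \<omega> in M. ?W g \<omega> = ?W g1 \<omega> + 1 * ?W g2 \<omega>"
    using wiener_linear[OF kernD[OF g1] kernD[OF g2], of 1] by simp
  have "ip M (Xt r) (?W g) = ip M (Xt r) (\<lambda>\<omega>. ?W g1 \<omega> + 1 * ?W g2 \<omega>)"
    using ae sW sqXt[of r] by (intro ip_cong_AE) (auto intro: sqint_measurable)
  also have "\<dots> = ip M (Xt r) (?W g1) + ip M (Xt r) (?W g2)" using sW sqXt by (simp add: ip_add_right)
  also have "ip M (Xt r) (?W g2) = 0"
    by (rule Xt_perp_future[OF r g2]) (simp add: g2_def g1_def)
  also have "ip M (Xt r) (?W g1) = - ip M (Xt r) (time_integral (\<lambda>u. g1 u * G u) Xt)"
  proof -
    note a = kern_sqint[OF kernG[OF g1]]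
    have "ip M (Xt r) (innov g1) = 0" by (rule Xt_perp[OF r innov_cspan[OF r g1r]])
    then show ?thesis unfolding innov_def[abs_def]
      using time_integral_sqint[OF Xt a] sW sqXt by (simp add: ip_add_right)
  qed
  also have "ip M (Xt r) (time_integral (\<lambda>u. g1 u * G u) Xt) = (LINT u|lborel. g1 u * G u * ip M (Xt r) (Xt u))"
    by (rule time_integral_ip(2)[OF Xt kern_sqint[OF kernG[OF g1]] sqXt])
  also have "\<dots> = (LINT u|lborel. indicator {..r} u * (g u * G u * ip M (Xt r) (Xt u)))"
  proof (rule Bochner_Integration.integral_cong[OF refl])
    fix u show "g1 u * G u * ip M (Xt r) (Xt u) = indicator {..r} u * (g u * G u * ip M (Xt r) (Xt u))"
      using g by (cases "0 \<le> u") (auto simp: g1_def kern_def indicator_def)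
  qed
  finally show ?thesis by simp
qed

text \<open>By Cauchy-Schwarz the kernel is dominated by a function of r times a function of u, each
  integrable as a product of two square-integrable functions of time.\<close>

lemma covariance_kernel_integrable:
  assumes a: "kern T a" and b: "kern T b"
  shows "integrable (lborel \<Otimes>\<^sub>M lborel) (\<lambda>(r, u). a r * (b u * ip M (Xt r) (Xt u)))"
proof -
  have m[measurable]: "(\<lambda>(s, \<omega>). Xt s \<omega>) \<in> borel_measurable (lborel \<Otimes>\<^sub>M M)" using Xt by (simp add: l2process_def)
  have ab[measurable]: "a \<in> borel_measurable borel" "b \<in> borel_measurable borel"
    using kern_sqint[OF a] kern_sqint[OF b] by (auto simp: sqint_def)
  have "(\<lambda>p. LINT \<omega>|M. Xt (fst p) \<omega> * Xt (snd p) \<omega>) \<in> borel_measurable (lborel \<Otimes>\<^sub>M lborel)" by measurable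
  then have [measurable]: "(\<lambda>p. ip M (Xt (fst p)) (Xt (snd p))) \<in> borel_measurable (lborel \<Otimes>\<^sub>M lborel)"
    by (simp add: ip_def)
  define n where "n r = sqrt (norm_sq M (Xt r))" for r
  have [measurable]: "(\<lambda>r. LINT \<omega>|M. Xt r \<omega> * Xt r \<omega>) \<in> borel_measurable lborel" by measurable
  then have [measurable]: "n \<in> borel_measurable lborel" unfolding n_def[abs_def] ip_def by simp
  have sn: "sqint lborel n"
    using l2process_norm_sq[OF Xt] by (simp add: sqint_def n_def[abs_def])
  have ia: "integrable lborel (\<lambda>r. \<bar>a r * n r\<bar>)" and ib: "integrable lborel (\<lambda>u. \<bar>b u * n u\<bar>)"
    by (intro integrable_abs sqint_integrable_mult kern_sqint[OF a] kern_sqint[OF b] sn)+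
  have "integrable (lborel \<Otimes>\<^sub>M lborel) (\<lambda>(r, u). \<bar>a r * n r\<bar> * \<bar>b u * n u\<bar>)"
  proof (rule lborel_pair.Fubini_integrable)
    show "integrable lborel (\<lambda>r. LINT u|lborel. norm (case (r, u) of (r, u) \<Rightarrow> \<bar>a r * n r\<bar> * \<bar>b u * n u\<bar>))"
      using ia by (simp add: abs_mult)
    show "AE r in lborel. integrable lborel (\<lambda>u. case (r, u) of (r, u) \<Rightarrow> \<bar>a r * n r\<bar> * \<bar>b u * n u\<bar>)"
      using ib by simp
  qed measurable
  then show ?thesis
  proof (rule Bochner_Integration.integrable_bound)
    have "(\<lambda>p. a (fst p) * (b (snd p) * ip M (Xt (fst p)) (Xt (snd p)))) \<in> borel_measurable (lborel \<Otimes>\<^sub>M lborel)" by measurable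
    then show "(\<lambda>(r, u). a r * (b u * ip M (Xt r) (Xt u))) \<in> borel_measurable (lborel \<Otimes>\<^sub>M lborel)"
      by (simp add: case_prod_unfold)
    have "\<bar>a r * (b u * ip M (Xt r) (Xt u))\<bar> \<le> \<bar>a r * n r\<bar> * \<bar>b u * n u\<bar>" for r u
    proof -
      have "\<bar>ip M (Xt r) (Xt u)\<bar> \<le> n r * n u" unfolding n_def by (rule ip_abs_le[OF sqXt sqXt])
      then have "\<bar>a r\<bar> * \<bar>b u\<bar> * \<bar>ip M (Xt r) (Xt u)\<bar> \<le> \<bar>a r\<bar> * \<bar>b u\<bar> * (n r * n u)"
        by (intro mult_left_mono) auto
      moreover have "0 \<le> n r" "0 \<le> n u" by (auto simp: n_def)
      ultimately show ?thesis by (simp add: abs_mult mult_ac)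
    qed
    then show "AE p in lborel \<Otimes>\<^sub>M lborel. norm (case p of (r, u) \<Rightarrow> a r * (b u * ip M (Xt r) (Xt u)))
        \<le> norm (case p of (r, u) \<Rightarrow> \<bar>a r * n r\<bar> * \<bar>b u * n u\<bar>)"
      by (auto simp: case_prod_unfold abs_mult)
  qed
qed

text \<open>The innovation process has the same second-order structure as the noise: the cross terms between
  drift and noise cancel the drift term, because the filtering error is orthogonal to past innovations.\<close>

lemma innov_isometry:
  assumes f: "kern T f" and g: "kern T g"
  shows "ip M (innov f) (innov g) = ip lborel (\<lambda>s. f s * D s) (\<lambda>s. g s * D s)"
proof -
  let ?a = "\<lambda>s. f s * G s" and ?b = "\<lambda>s. g s * G s"
  let ?A = "time_integral ?a Xt" and ?B = "time_integral ?b Xt"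
  let ?V = "wiener_integral M B (\<lambda>s. f s * D s) T" and ?W = "wiener_integral M B (\<lambda>s. g s * D s) T"
  let ?K = "\<lambda>r u. ip M (Xt r) (Xt u)"
  note a = kern_sqint[OF kernG[OF f]] and b = kern_sqint[OF kernG[OF g]]
  note sA = time_integral_sqint[OF Xt a] and sB = time_integral_sqint[OF Xt b]
  note sV = wiener_sqint[OF kernD[OF f]] and sW = wiener_sqint[OF kernD[OF g]]
  define \<Phi> where "\<Phi> r u = ?a r * (?b u * ?K r u)" for r u
  have AB: "ip M ?A ?B = (LINT r|lborel. LINT u|lborel. \<Phi> r u)"
  proof -
    have e: "ip M ?B (Xt r) = (LINT u|lborel. ?b u * ?K r u)" for r
      using time_integral_ip(2)[OF Xt b sqXt[of r]] by (simp only: ip_commute[of M ?B "Xt r"])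
    have "ip M ?A ?B = (LINT r|lborel. ?a r * ip M ?B (Xt r))"
      using time_integral_ip(2)[OF Xt a sB] by (simp only: ip_commute[of M ?A ?B])
    then show ?thesis unfolding e by (simp add: \<Phi>_def)
  qed
  have AW: "ip M ?A ?W = - (LINT r|lborel. LINT u|lborel. indicator {..r} u * \<Phi> r u)"
  proof -
    have "ip M ?W (Xt r) = - (LINT u|lborel. indicator {..r} u * (?b u * ?K r u))" for r
      using Xt_wiener[OF g, of r] by (simp only: ip_commute[of M ?W "Xt r"])
    then have e: "?a r * ip M ?W (Xt r) = - (LINT u|lborel. indicator {..r} u * \<Phi> r u)" for r
      unfolding \<Phi>_def by (simp only: mult_minus_right integral_mult_right_zero[symmetric] mult.left_commute)
    have "ip M ?A ?W = (LINT r|lborel. ?a r * ip M ?W (Xt r))"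
      using time_integral_ip(2)[OF Xt a sW] by (simp only: ip_commute[of M ?A ?W])
    then show ?thesis unfolding e by simp
  qed
  have VB: "ip M ?V ?B = - (LINT u|lborel. LINT r|lborel. indicator {..u} r * \<Phi> r u)"
  proof -
    have "ip M ?V (Xt u) = - (LINT r|lborel. indicator {..u} r * (?a r * ?K r u))" for u
      using Xt_wiener[OF f, of u] unfolding ip_commute[of M "Xt u"] .
    then have e: "?b u * ip M ?V (Xt u) = - (LINT r|lborel. indicator {..u} r * \<Phi> r u)" for u
      unfolding \<Phi>_def by (simp only: mult_minus_right integral_mult_right_zero[symmetric]) (simp only: mult_ac)
    have "ip M ?V ?B = (LINT u|lborel. ?b u * ip M ?V (Xt u))"
      by (rule time_integral_ip(2)[OF Xt b sV])
    then show ?thesis unfolding e by simp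
  qed
  have "ip M (innov f) (innov g) = ip M ?A ?B + ip M ?A ?W + ip M ?V ?B + ip M ?V ?W"
    unfolding innov_def[abs_def] using sA sB sV sW by (simp add: ip_add_left ip_add_right)
  \<comment> \<open>\<open>?A\<close> against \<open>?B\<close> is the integral of
    \<open>\<Phi>\<close> over the whole square, and the two mixed terms are minus its integrals
    over the two triangles.\<close>
  also have "\<dots> = ip M ?V ?W"
  proof -
    have "integrable (lborel \<Otimes>\<^sub>M lborel) (\<lambda>(r, u). \<Phi> r u)"
      using covariance_kernel_integrable[OF kernG[OF f] kernG[OF g]] by (simp only: \<Phi>_def)
    from integral_triangle[OF this] show ?thesis unfolding AB AW VB by linarith
  qed
  also have "\<dots> = ip lborel (\<lambda>s. f s * D s) (\<lambda>s. g s * D s)"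
    by (rule wiener_isometry[OF kernD[OF f] kernD[OF g]])
  finally show ?thesis .
qed

section \<open>Coercivity of the observation integral and completeness of the innovations\<close>

lemma obs_coercive:
  assumes f: "kern T f"
  shows "\<delta>\<^sup>2 * norm_sq lborel f \<le> norm_sq M (\<lambda>\<omega>. c + obs f \<omega>)"
proof -
  let ?A = "time_integral (\<lambda>s. f s * G s) X" and ?W = "wiener_integral M B (\<lambda>s. f s * D s) T"
  note a = kern_sqint[OF kernG[OF f]]
  note sA = time_integral_sqint[OF X a] and sW = wiener_sqint[OF kernD[OF f]]
  have W: "?W \<in> cspan M (B ` {0..T})" by (rule wiener_cspan[OF kernD[OF f]])
  \<comment> \<open>The constant and the signal part are orthogonal to the noise, so the norm of the
    sum is at least that of the noise part, where the lower bound on \<open>D\<close> recovers the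
    kernel.\<close>
  have WA: "ip M ?W (\<lambda>\<omega>. c + ?A \<omega>) = 0"
    using sA sW time_integral_X_perp_B[OF W a] mean_B[OF W] by (simp add: ip_add_right ip_const_right)
  have "\<delta>\<^sup>2 * norm_sq lborel f \<le> norm_sq lborel (\<lambda>s. f s * D s)"
    unfolding ip_def integral_mult_right_zero[symmetric]
  proof (rule integral_mono)
    show "integrable lborel (\<lambda>s. \<delta>\<^sup>2 * (f s * f s))" "integrable lborel (\<lambda>s. f s * D s * (f s * D s))"
      using sqint_integrable_mult[OF kern_sqint[OF f] kern_sqint[OF f]]
        sqint_integrable_mult[OF kern_sqint[OF kernD[OF f]] kern_sqint[OF kernD[OF f]]] by auto
    fix s
    show "\<delta>\<^sup>2 * (f s * f s) \<le> f s * D s * (f s * D s)"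
    proof (cases "s \<in> {0..T}")
      case True
      then have "\<delta>\<^sup>2 \<le> (D s)\<^sup>2" using \<delta>(1) \<delta>(2)[OF True] by (simp add: abs_le_square_iff[symmetric])
      then have "\<delta>\<^sup>2 * (f s)\<^sup>2 \<le> (D s)\<^sup>2 * (f s)\<^sup>2" by (intro mult_right_mono) auto
      then show ?thesis by (simp add: power2_eq_square mult_ac)
    next
      case False
      then show ?thesis using f by (auto simp: kern_def)
    qed
  qed
  also have "\<dots> = norm_sq M ?W" by (rule wiener_isometry[OF kernD[OF f] kernD[OF f], symmetric])
  also have "\<dots> \<le> norm_sq M (\<lambda>\<omega>. (c + ?A \<omega>) + ?W \<omega>)"
  proof -
    have sc: "sqint M (\<lambda>\<omega>. c + ?A \<omega>)" using sA by simp
    have "norm_sq M (\<lambda>\<omega>. (c + ?A \<omega>) + ?W \<omega>)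
      = norm_sq M (\<lambda>\<omega>. c + ?A \<omega>) + 2 * ip M ?W (\<lambda>\<omega>. c + ?A \<omega>) + norm_sq M ?W"
      unfolding ip_add_left[OF sc sW sqint_add[OF sc sW]] ip_add_right[OF sc sW sc] ip_add_right[OF sc sW sW]
        ip_commute[of M "\<lambda>\<omega>. c + ?A \<omega>" ?W] by simp
    then show ?thesis using WA ip_nonneg[of M "\<lambda>\<omega>. c + ?A \<omega>"] by simp
  qed
  finally show ?thesis by (simp add: obs_def[abs_def] add.assoc)
qed

text \<open>Writing finite combinations with an explicit kernel makes \<open>obs_coercive\<close>
  applicable, so the kernel is controlled by the norm of the variable.\<close>

lemma lspan_ysys_obs:
  assumes r: "r \<in> {0..T}" and y: "y \<in> lspan (ysys r)"
  shows "\<exists>c f. kern r f \<and> (AE \<omega> in M. y \<omega> = c + obs f \<omega>)"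
  using y
proof induction
  case lspan_zero
  have k: "kern r (\<lambda>_. 0)" "kern T (\<lambda>_. 0)" using r T0 by (auto simp: kern_def)
  \<comment> \<open>The chosen version of the integral of the zero kernel may differ from 0 on a
    null set; the norm bound makes it vanish almost surely.\<close>
  have "norm_sq M (obs (\<lambda>_. 0)) = 0" using obs_bound[OF k(2)] ip_nonneg[of M "obs (\<lambda>_. 0)"] by simp
  from ip_eq_0_AE[OF obs_sqint[OF k(2)] this] show ?case using k by (intro exI[of _ 0] exI[of _ "\<lambda>_. 0"]) auto
next
  case (lspan_step y g a)
  then obtain c f where IH: "kern r f" "AE \<omega> in M. y \<omega> = c + obs f \<omega>" by blast
  have fT: "kern T f" using kern_mono[OF IH(1)] r by simp
  consider "g = (\<lambda>_. 1)" | s where "s \<in> {0..r}" "g = Y s" using lspan_step(2) unfolding ysys_def by auto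
  then show ?case
  proof cases
    case 1
    have "AE \<omega> in M. y \<omega> + a * g \<omega> = (c + a) + obs f \<omega>" using IH(2) by eventually_elim (simp add: 1)
    then show ?thesis using IH(1) by blast
  next
    case 2
    then have s: "s \<in> {0..T}" using r by auto
    let ?i = "indicator {0..s} :: real \<Rightarrow> real"
    have k: "kern r ?i" "kern T ?i" using kern_mono[OF kern_ind[OF s]] 2 s by auto
    have kr: "kern r (\<lambda>u. f u + a * ?i u)" by (intro kern_add kern_cmult IH k)
    have "AE \<omega> in M. y \<omega> + a * g \<omega> = (c + a * y0) + obs (\<lambda>u. f u + a * ?i u) \<omega>"
      using IH(2) Y_obs[OF s] obs_linear[OF fT k(2), of a]
    proof eventually_elim
      case (elim \<omega>)
      then show ?case by (simp add: 2 distrib_left)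
    qed
    then show ?thesis using kr by blast
  qed
qed

text \<open>Both sides are continuous in mean square, so a bound on the finite span persists on its
  closure.\<close>

lemma cspan_bound:
  assumes S: "\<And>g. g \<in> S \<Longrightarrow> sqint M g" and \<eta>: "sqint M \<eta>"
    and b: "\<And>y. y \<in> lspan S \<Longrightarrow> \<bar>ip M \<eta> y\<bar> \<le> C * sqrt (norm_sq M y)" and y: "y \<in> cspan M S"
  shows "\<bar>ip M \<eta> y\<bar> \<le> C * sqrt (norm_sq M y)"
proof -
  obtain u where u: "\<And>n. u n \<in> lspan S" "l2conv M u y"
    by (rule cspan_approx[of S M y, OF S y]) (assumption, rule that)
  have l1: "(\<lambda>n. \<bar>ip M (u n) \<eta>\<bar>) \<longlonglongrightarrow> \<bar>ip M y \<eta>\<bar>" by (intro tendsto_rabs l2conv_ip u \<eta>)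
  have l2: "(\<lambda>n. C * sqrt (norm_sq M (u n))) \<longlonglongrightarrow> C * sqrt (norm_sq M y)"
    by (intro tendsto_intros l2conv_ip2 u)
  have le: "\<bar>ip M (u n) \<eta>\<bar> \<le> C * sqrt (norm_sq M (u n))" for n
    using b[OF u(1)[of n]] unfolding ip_commute[of M \<eta> "u n"] .
  have "\<bar>ip M y \<eta>\<bar> \<le> C * sqrt (norm_sq M y)" by (rule LIMSEQ_le[OF l1 l2]) (use le in blast)
  then show ?thesis unfolding ip_commute[of M \<eta> y] .
qed

lemma Xh_norm: "s \<in> {0..T} \<Longrightarrow> norm_sq M (Xh s) \<le> norm_sq M (X s)"
  using Xt_norm[of s] ip_nonneg[of M "Xt s"] by linarith

text \<open>For y = c + int f dY only the term int f G E[\<eta> Xhat] du survives, and it runs over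
  [s,r] alone. Coercivity bounds the norm of f by that of y over \<open>\<delta>\<close>, so the a
  priori constant \<open>\<kappa>\<close> is improved by a factor that is small on short
  intervals.\<close>

lemma orthogonal_contraction:
  assumes r: "r \<in> {0..T}" and \<eta>: "sqint M \<eta>" "(LINT \<omega>|M. \<eta> \<omega>) = 0"
    and o: "\<And>f. kern r f \<Longrightarrow> ip M \<eta> (innov f) = 0"
    and z: "\<And>u. 0 \<le> u \<Longrightarrow> u < s \<Longrightarrow> ip M \<eta> (Xh u) = 0"
    and \<kappa>: "0 \<le> \<kappa>" "\<And>u. u \<in> {0..r} \<Longrightarrow> \<bar>ip M \<eta> (Xh u)\<bar> \<le> \<kappa> * sqrt (norm_sq M (X u))"
    and y: "y \<in> cspan M (ysys r)"
  shows "\<bar>ip M \<eta> y\<bar> \<le> \<kappa> * (K / \<delta> * sqrt (LINT u|lborel. indicator {s..r} u * norm_sq M (X u))) * sqrt (norm_sq M y)"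
proof (rule cspan_bound[of "ysys r", OF _ \<eta>(1) _ y])
  show "sqint M g" if "g \<in> ysys r" for g by (rule ysys_sqint[OF r that])
  fix y assume "y \<in> lspan (ysys r)"
  then obtain c f where f: "kern r f" and y: "AE \<omega> in M. y \<omega> = c + obs f \<omega>"
    using lspan_ysys_obs[OF r] by blast
  have sy: "sqint M y" using \<open>y \<in> lspan (ysys r)\<close> ysys_sqint[OF r] by (rule sqint_lspan)
  have fT: "kern T f" using kern_mono[OF f] r by simp
  note so = obs_sqint[OF fT]
  have K0: "0 \<le> K" using G(2)[of 0] by linarith
  let ?J = "LINT u|lborel. indicator {s..r} u * norm_sq M (X u)"
  define e where "e u = indicator {s..r} u * ip M \<eta> (Xh u)" for u
  have e: "kern T e" unfolding e_def by (rule kern_indicator_mult[OF l2process_ip_kern[OF T0 Xh(1) \<eta>(1)]]) simp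
  have yo: "ip M \<eta> y = ip M \<eta> (\<lambda>\<omega>. c + obs f \<omega>)" "norm_sq M y = norm_sq M (\<lambda>\<omega>. c + obs f \<omega>)"
    using y sy so \<eta>(1) by (intro ip_cong_AE; auto intro: sqint_measurable)+
  have "ip M \<eta> y = ip M \<eta> (obs f)"
    unfolding yo(1) using so \<eta> by (simp add: ip_add_right ip_const_right)
  also have "\<dots> = ip M \<eta> (innov f) + ip M \<eta> (time_integral (\<lambda>u. f u * G u) Xh)"
  proof -
    note sT = time_integral_sqint[OF Xh(1) kern_sqint[OF kernG[OF fT]]]
    have "AE \<omega> in M. obs f \<omega> = innov f \<omega> + time_integral (\<lambda>u. f u * G u) Xh \<omega>"
      using innov_obs[OF fT] by eventually_elim simp
    then have "ip M \<eta> (obs f) = ip M \<eta> (\<lambda>\<omega>. innov f \<omega> + time_integral (\<lambda>u. f u * G u) Xh \<omega>)"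
      using so sT innov_sqint[OF fT] \<eta>(1) by (intro ip_cong_AE) (auto intro: sqint_measurable)
    then show ?thesis using sT innov_sqint[OF fT] \<eta>(1) by (simp add: ip_add_right)
  qed
  also have "\<dots> = (LINT u|lborel. f u * G u * ip M \<eta> (Xh u))"
    using o[OF f] time_integral_ip(2)[OF Xh(1) kern_sqint[OF kernG[OF fT]] \<eta>(1)] by simp
  also have "\<dots> = ip lborel (\<lambda>u. f u * G u) e" unfolding ip_def[of lborel]
  proof (rule Bochner_Integration.integral_cong[OF refl])
    fix u
    show "f u * G u * ip M \<eta> (Xh u) = f u * G u * e u"
      using f z[of u] by (cases "0 \<le> u"; cases "u < s"; cases "u \<le> r") (auto simp: e_def kern_def)
  qed
  finally have "\<bar>ip M \<eta> y\<bar> \<le> sqrt (norm_sq lborel (\<lambda>u. f u * G u)) * sqrt (norm_sq lborel e)"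
    using ip_abs_le[OF kern_sqint[OF kernG[OF fT]] kern_sqint[OF e]] by simp
  \<comment> \<open>The first factor uses the bound on \<open>G\<close> and coercivity, the second
    the a priori bound on the inner products with \<open>Xh\<close>.\<close>
  also have "\<dots> \<le> (K * (sqrt (norm_sq M y) / \<delta>)) * (\<kappa> * sqrt ?J)"
  proof (rule mult_mono)
    have "norm_sq lborel (\<lambda>u. f u * G u) \<le> K\<^sup>2 * norm_sq lborel f"
      using G by (intro ip_bounded_mult_le kern_sqint[OF fT]) auto
    also have "\<dots> \<le> K\<^sup>2 * (norm_sq M y / \<delta>\<^sup>2)"
      using obs_coercive[OF fT, of c] \<delta>(1) unfolding yo(2)[symmetric]
      by (intro mult_left_mono) (auto simp: field_simps)
    finally have "sqrt (norm_sq lborel (\<lambda>u. f u * G u)) \<le> sqrt (K\<^sup>2 * (norm_sq M y / \<delta>\<^sup>2))" by simp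
    then show "sqrt (norm_sq lborel (\<lambda>u. f u * G u)) \<le> K * (sqrt (norm_sq M y) / \<delta>)"
      using K0 \<delta>(1) by (simp add: real_sqrt_mult real_sqrt_divide)
    have "norm_sq lborel e \<le> (LINT u|lborel. \<kappa>\<^sup>2 * (indicator {s..r} u * norm_sq M (X u)))"
      unfolding ip_def[of lborel]
    proof (rule integral_mono)
      show "integrable lborel (\<lambda>u. e u * e u)" by (intro sqint_integrable_mult kern_sqint[OF e])
      show "integrable lborel (\<lambda>u. \<kappa>\<^sup>2 * (indicator {s..r} u * norm_sq M (X u)))"
        using integrable_mult_indicator[OF _ l2process_norm_sq[OF X], of "{s..r}"] by simp
      fix u
      show "e u * e u \<le> \<kappa>\<^sup>2 * (indicator {s..r} u * norm_sq M (X u))"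
      proof (cases "u \<in> {s..r} \<and> 0 \<le> u")
        case True
        then have "\<bar>ip M \<eta> (Xh u)\<bar> \<le> \<bar>\<kappa> * sqrt (norm_sq M (X u))\<bar>" using \<kappa>(2)[of u] by auto
        then have "(ip M \<eta> (Xh u))\<^sup>2 \<le> (\<kappa> * sqrt (norm_sq M (X u)))\<^sup>2" by (simp only: abs_le_square_iff)
        then show ?thesis using True by (simp add: e_def power_mult_distrib power2_eq_square[of "ip M \<eta> (Xh u)"])
      next
        case False
        then have "e u = 0" using e by (auto simp: kern_def e_def)
        then show ?thesis by (simp add: indicator_def)
      qed
    qed
    then have "sqrt (norm_sq lborel e) \<le> sqrt (\<kappa>\<^sup>2 * ?J)" by simp
    then show "sqrt (norm_sq lborel e) \<le> \<kappa> * sqrt ?J" using \<kappa>(1) by (simp add: real_sqrt_mult)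
  qed (use K0 \<delta>(1) in auto)
  also have "\<dots> = \<kappa> * (K / \<delta> * sqrt ?J) * sqrt (norm_sq M y)" by simp
  finally show "\<bar>ip M \<eta> y\<bar> \<le> \<kappa> * (K / \<delta> * sqrt ?J) * sqrt (norm_sq M y)" .
qed

text \<open>Starting from Cauchy-Schwarz, each round of the contraction halves the constant. The
  bound required by the next round is the current one applied to \<open>Xh u\<close>, whose norm is
  at most that of \<open>X u\<close>.\<close>

lemma orthogonal_small_interval:
  assumes r: "r \<in> {0..T}" and \<eta>: "sqint M \<eta>" "(LINT \<omega>|M. \<eta> \<omega>) = 0"
    and o: "\<And>f. kern r f \<Longrightarrow> ip M \<eta> (innov f) = 0"
    and z: "\<And>u. 0 \<le> u \<Longrightarrow> u < s \<Longrightarrow> ip M \<eta> (Xh u) = 0"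
    and small: "K / \<delta> * sqrt (LINT u|lborel. indicator {s..r} u * norm_sq M (X u)) \<le> 1 / 2"
    and y: "y \<in> cspan M (ysys r)"
  shows "ip M \<eta> y = 0"
proof -
  have b: "\<bar>ip M \<eta> y\<bar> \<le> (1/2)^n * sqrt (norm_sq M \<eta>) * sqrt (norm_sq M y)" if "y \<in> cspan M (ysys r)" for n y
    using that
  proof (induction n arbitrary: y)
    case 0
    then show ?case using ip_abs_le[OF \<eta>(1) cspan_sqint[OF 0]] by simp
  next
    case (Suc n)
    have "\<bar>ip M \<eta> y\<bar> \<le> ((1/2)^n * sqrt (norm_sq M \<eta>)) * (K / \<delta> * sqrt (LINT u|lborel. indicator {s..r} u * norm_sq M (X u))) * sqrt (norm_sq M y)"
    proof (rule orthogonal_contraction[OF r \<eta> o z _ _ Suc.prems])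
      fix u assume u: "u \<in> {0..r}"
      then have uT: "u \<in> {0..T}" using r by auto
      have "Xh u \<in> cspan M (ysys r)" using Xh_cspan[OF uT] ysys_mono[of u r] u by auto
      from Suc.IH[OF this] have "\<bar>ip M \<eta> (Xh u)\<bar> \<le> (1/2)^n * sqrt (norm_sq M \<eta>) * sqrt (norm_sq M (Xh u))" .
      also have "\<dots> \<le> (1/2)^n * sqrt (norm_sq M \<eta>) * sqrt (norm_sq M (X u))"
        using Xh_norm[OF uT] by (intro mult_left_mono) auto
      finally show "\<bar>ip M \<eta> (Xh u)\<bar> \<le> (1/2)^n * sqrt (norm_sq M \<eta>) * sqrt (norm_sq M (X u))" .
    qed auto
    also have "\<dots> \<le> ((1/2)^n * sqrt (norm_sq M \<eta>)) * (1/2) * sqrt (norm_sq M y)"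
      by (intro mult_right_mono mult_left_mono small) auto
    finally show ?case by simp
  qed
  have "(\<lambda>n. (1/2)^n * sqrt (norm_sq M \<eta>) * sqrt (norm_sq M y)) \<longlonglongrightarrow> 0 * sqrt (norm_sq M \<eta>) * sqrt (norm_sq M y)"
    by (intro tendsto_intros LIMSEQ_power_zero) auto
  then have "\<bar>ip M \<eta> y\<bar> \<le> 0" using b[OF y] by (intro LIMSEQ_le_const) auto
  then show ?thesis by simp
qed

text \<open>As E[X^2] is merely integrable in time, the admissible length depends on the starting
  point; dominated convergence over [s, s + 1/(n+1)] supplies it.\<close>

lemma small_interval_ex:
  assumes "0 < \<epsilon>"
  obtains r where "s < r" "(LINT u|lborel. indicator {s..r} u * norm_sq M (X u)) < \<epsilon>"
proof -
  let ?h = "\<lambda>u. norm_sq M (X u)"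
  have "(\<lambda>n. LINT u|lborel. indicator {s..s + 1 / real (Suc n)} u * ?h u) \<longlonglongrightarrow> (LINT u|lborel. indicator {s} u * ?h u)"
  proof (rule integral_dominated_convergence[where w = ?h])
    have [measurable]: "?h \<in> borel_measurable borel" using l2process_norm_sq[OF X] by auto
    show "(\<lambda>u. indicator {s} u * ?h u) \<in> borel_measurable lborel" by measurable
    show "(\<lambda>u. indicator {s..s + 1 / real (Suc n)} u * ?h u) \<in> borel_measurable lborel" for n by measurable
    show "integrable lborel ?h" by (rule l2process_norm_sq[OF X])
    show "AE u in lborel. norm (indicator {s..s + 1 / real (Suc n)} u * ?h u) \<le> ?h u" for n
      by (auto simp: indicator_def)
    have "(\<lambda>n. indicator {s..s + 1 / real (Suc n)} u * ?h u) \<longlonglongrightarrow> indicator {s} u * ?h u" for u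
    proof (rule tendsto_eventually)
      show "\<forall>\<^sub>F n in sequentially. indicator {s..s + 1 / real (Suc n)} u * ?h u = indicator {s} u * ?h u"
      proof (cases "s < u")
        case True
        obtain N where N: "1 / (u - s) < real N" using reals_Archimedean2 by blast
        have "indicator {s..s + 1 / real (Suc n)} u * ?h u = indicator {s} u * ?h u" if "N \<le> n" for n
        proof -
          have "1 / (u - s) < real (Suc n)" using N that by linarith
          then have "1 / real (Suc n) < u - s" using True by (simp add: field_simps)
          then show ?thesis using True by simp
        qed
        then show ?thesis by (auto simp: eventually_sequentially)
      qed (auto simp: indicator_def)
    qed
    then show "AE u in lborel. (\<lambda>n. indicator {s..s + 1 / real (Suc n)} u * ?h u) \<longlonglongrightarrow> indicator {s} u * ?h u" by simp
  qed
  moreover have "(LINT u|lborel. indicator {s} u * ?h u) = 0"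
  proof (rule integral_eq_zero_AE)
    have "AE u in lborel. u \<noteq> s" by (rule AE_lborel_singleton)
    then show "AE u in lborel. indicator {s} u * ?h u = 0" by eventually_elim simp
  qed
  ultimately have "\<forall>\<^sub>F n in sequentially. (LINT u|lborel. indicator {s..s + 1 / real (Suc n)} u * ?h u) < \<epsilon>"
    using assms by (intro order_tendstoD) auto
  then obtain n where "(LINT u|lborel. indicator {s..s + 1 / real (Suc n)} u * ?h u) < \<epsilon>"
    by (auto simp: eventually_sequentially)
  then show ?thesis by (intro that[of "s + 1 / real (Suc n)"]) auto
qed

text \<open>The innovations carry all the information of the observations: a Gronwall argument propagates
  orthogonality to the innovations over successive short intervals.\<close>

lemma orthogonal_to_innovations:
  assumes R: "R \<in> {0..T}" and \<eta>: "sqint M \<eta>" "(LINT \<omega>|M. \<eta> \<omega>) = 0"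
    and o: "\<And>f. kern R f \<Longrightarrow> ip M \<eta> (innov f) = 0" and y: "y \<in> cspan M (ysys R)"
  shows "ip M \<eta> y = 0"
proof -
  \<comment> \<open>Admitting -1 makes the set nonempty for free, as {0..-1} is empty, and the
    initial interval is then treated like any other.\<close>
  define A where "A = {r \<in> {-1..R}. \<forall>u\<in>{0..r}. ip M \<eta> (Xh u) = 0}"
  have A1: "-1 \<in> A" using R by (auto simp: A_def)
  have bdd: "bdd_above A" by (rule bdd_aboveI[of _ R]) (auto simp: A_def)
  define \<rho> where "\<rho> = Sup A"
  have \<rho>: "-1 \<le> \<rho>" "\<rho> \<le> R"
    unfolding \<rho>_def using cSup_upper[OF A1 bdd] A1 by (auto intro!: cSup_least simp: A_def)
  have z: "ip M \<eta> (Xh u) = 0" if u: "0 \<le> u" "u < \<rho>" for u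
  proof -
    obtain r where "r \<in> A" "u < r" using u(2) less_cSup_iff[OF _ bdd] A1 unfolding \<rho>_def by blast
    then show ?thesis using u(1) by (auto simp: A_def)
  qed
  have K0: "0 \<le> K" using G(2)[of 0] by linarith
  \<comment> \<open>Chosen so that K / \<delta> times the root of \<open>\<epsilon>\<close> equals K
    / (2 (K + 1)), at most 1/2; K + 1 avoids dividing by 0 when K = 0.\<close>
  define \<epsilon> where "\<epsilon> = (\<delta> / (2 * (K + 1)))\<^sup>2"
  have \<epsilon>0: "0 < \<epsilon>" using \<delta>(1) K0 by (simp add: \<epsilon>_def)
  have small: "K / \<delta> * sqrt J \<le> 1 / 2" if "0 \<le> J" "J \<le> \<epsilon>" for J
  proof -
    have "sqrt J \<le> \<delta> / (2 * (K + 1))" using real_sqrt_le_mono[OF that(2)] K0 \<delta>(1) by (simp add: \<epsilon>_def)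
    then have "K / \<delta> * sqrt J \<le> K / \<delta> * (\<delta> / (2 * (K + 1)))" using K0 \<delta>(1) by (intro mult_left_mono) auto
    also have "\<dots> \<le> 1 / 2" using K0 \<delta>(1) by (simp add: field_simps)
    finally show ?thesis .
  qed
  obtain r where r: "\<rho> < r" and J: "(LINT u|lborel. indicator {\<rho>..r} u * norm_sq M (X u)) < \<epsilon>"
    using small_interval_ex[OF \<epsilon>0] by blast
  define r' where "r' = min r R"
  have J': "(LINT u|lborel. indicator {\<rho>..r'} u * norm_sq M (X u)) \<le> \<epsilon>"
  proof -
    have "(LINT u|lborel. indicator {\<rho>..r'} u * norm_sq M (X u)) \<le> (LINT u|lborel. indicator {\<rho>..r} u * norm_sq M (X u))"
    proof (rule integral_mono)
      have "integrable lborel (\<lambda>u. indicator {\<rho>..r} u * norm_sq M (X u))" for r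
        using integrable_mult_indicator[OF _ l2process_norm_sq[OF X], of "{\<rho>..r}"] by simp
      then show "integrable lborel (\<lambda>u. indicator {\<rho>..r'} u * norm_sq M (X u))"
        "integrable lborel (\<lambda>u. indicator {\<rho>..r} u * norm_sq M (X u))" by blast+
      show "indicator {\<rho>..r'} u * norm_sq M (X u) \<le> indicator {\<rho>..r} u * norm_sq M (X u)" for u
        by (intro mult_right_mono) (auto simp: indicator_def r'_def)
    qed
    then show ?thesis using J by simp
  qed
  have J0: "0 \<le> (LINT u|lborel. indicator {\<rho>..r'} u * norm_sq M (X u))" by simp
  have zero: "ip M \<eta> y = 0" if "0 \<le> r'" "y \<in> cspan M (ysys r')" for y
  proof -
    have rT: "r' \<in> {0..T}" using that R by (auto simp: r'_def)
    show ?thesis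
    proof (rule orthogonal_small_interval[OF rT \<eta> _ z small[OF J0 J'] that(2)])
      fix f assume "kern r' f"
      then have "kern R f" by (rule kern_mono) (simp add: r'_def)
      then show "ip M \<eta> (innov f) = 0" by (rule o)
    qed auto
  qed
  have "r' \<in> A"
  proof -
    have "ip M \<eta> (Xh u) = 0" if u: "u \<in> {0..r'}" for u
    proof (rule zero)
      have "u \<in> {0..T}" using u R by (auto simp: r'_def)
      from Xh_cspan[OF this] show "Xh u \<in> cspan M (ysys r')" using u ysys_mono by auto
    qed (use u in auto)
    then show ?thesis using \<rho> r R by (auto simp: A_def r'_def)
  qed
  \<comment> \<open>If \<open>r\<close> were at most \<open>R\<close>, then r' = r would be a member
    of \<open>A\<close> above its supremum. Hence r' = R, and \<open>zero\<close> covers all of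
    [0,R].\<close>
  then have "r' \<le> \<rho>" unfolding \<rho>_def by (rule cSup_upper[OF _ bdd])
  then have "r' = R" using r \<rho> by (auto simp: r'_def min_def split: if_splits)
  then show ?thesis using zero y R by auto
qed

section \<open>The gain, the filter equation and the Riccati equation\<close>

definition gain :: "real \<Rightarrow> real \<Rightarrow> real" where
  "gain s r = indicator {0..s} r * (G r / (D r)\<^sup>2 * ip M (X s) (Xt r))"

lemma gain_kern: assumes s: "s \<in> {0..T}" shows "kern s (gain s)"
proof -
  define g where "g r = indicator {0..T} r * (G r / (D r)\<^sup>2)" for r
  have [measurable]: "g \<in> borel_measurable borel" unfolding g_def using G(1) D(1) by measurable
  have K0: "0 \<le> K" using G(2)[of 0] by linarith
  have "\<bar>g r\<bar> \<le> K / \<delta>\<^sup>2" for r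
  proof (cases "r \<in> {0..T}")
    case True
    then have d: "\<delta>\<^sup>2 \<le> (D r)\<^sup>2" using \<delta>(1) \<delta>(2)[OF True] by (simp add: abs_le_square_iff[symmetric])
    have "\<bar>g r\<bar> = \<bar>G r\<bar> / (D r)\<^sup>2" using True by (simp add: g_def abs_divide)
    also have "\<dots> \<le> K / \<delta>\<^sup>2" using G(2)[of r] d \<delta>(1) K0 by (intro frac_le) auto
    finally show ?thesis .
  qed (use K0 in \<open>simp add: g_def\<close>)
  then have "kern T (\<lambda>r. ip M (X s) (Xt r) * g r)"
    by (intro kern_bounded_mult[OF l2process_ip_kern[OF T0 Xt sqX]]) auto
  from kern_indicator_mult[OF this, of "{0..s}"] have "kern T (\<lambda>r. indicator {0..s} r * (ip M (X s) (Xt r) * g r))" by simp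
  moreover have "gain s = (\<lambda>r. indicator {0..s} r * (ip M (X s) (Xt r) * g r))"
    using s by (auto simp: gain_def g_def fun_eq_iff indicator_def)
  ultimately have "kern T (gain s)" by (simp only:)
  moreover have "gain s r = 0" if "r \<notin> {0..s}" for r using that by (simp add: gain_def)
  ultimately show ?thesis using s by (simp only: kern_def atLeastAtMost_iff) blast
qed

text \<open>The noise part drops out because the signal at any time is orthogonal to the
  noise.\<close>

lemma innov_X:
  assumes f: "kern T f" shows "ip M (X t) (innov f) = (LINT r|lborel. f r * G r * ip M (X t) (Xt r))"
proof -
  note a = kern_sqint[OF kernG[OF f]]
  have "ip M (X t) (wiener_integral M B (\<lambda>r. f r * D r) T) = 0" by (rule X_perp_B[OF wiener_cspan[OF kernD[OF f]]])
  then show ?thesis unfolding innov_def[abs_def]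
    using time_integral_ip(2)[OF Xt a sqX] time_integral_sqint[OF Xt a] wiener_sqint[OF kernD[OF f]] sqX
    by (simp add: ip_add_right)
qed

text \<open>The factor 1 / D^2 in the gain is there to cancel the D^2 of the innovation isometry.
  The difference of the two sides is then orthogonal to the innovations and lies in the observation
  span, hence is orthogonal to itself.\<close>

theorem filter_equation:
  assumes s: "s \<in> {0..T}"
  shows "AE \<omega> in M. Xh s \<omega> = (LINT \<omega>|M. X s \<omega>) + innov (gain s) \<omega>"
proof -
  define m where "m = (LINT \<omega>|M. X s \<omega>)"
  have k: "kern T (gain s)" using kern_mono[OF gain_kern[OF s]] s by simp
  define \<eta> where "\<eta> \<omega> = Xh s \<omega> - (m + innov (gain s) \<omega>)" for \<omega>
  have sm: "sqint M (\<lambda>\<omega>. m + innov (gain s) \<omega>)" using innov_sqint[OF k] by simp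
  have s\<eta>: "sqint M \<eta>" unfolding \<eta>_def[abs_def] using sqXh sm by simp
  have "Xh s \<omega> = X s \<omega> - Xt s \<omega>" for \<omega> by (simp add: Xt_def)
  then have mh: "(LINT \<omega>|M. Xh s \<omega>) = m"
    using sqX sqXt Xt_mean by (simp add: m_def sqint_integrable)
  have m\<eta>: "(LINT \<omega>|M. \<eta> \<omega>) = 0"
    unfolding \<eta>_def using sqXh innov_sqint[OF k] innov_mean[OF k] mh
    by (simp add: sqint_integrable prob_space)
  have c\<eta>: "\<eta> \<in> cspan M (ysys s)" unfolding \<eta>_def[abs_def]
    by (intro cspan_diff cspan_add Xh_cspan[OF s] innov_cspan[OF s gain_kern[OF s]] const_cspan) (simp add: ysys_def)
  have "norm_sq M \<eta> = 0"
  proof (rule orthogonal_to_innovations[OF s s\<eta> m\<eta> _ c\<eta>])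
    fix f assume f: "kern s f"
    have fT: "kern T f" using kern_mono[OF f] s by simp
    have "ip M (Xt s) (innov f) = 0" by (rule Xt_perp[OF s innov_cspan[OF s f]])
    \<comment> \<open>The error is orthogonal to innovations up to s, so the estimate may be
      replaced by the signal.\<close>
    then have h: "ip M (Xh s) (innov f) = ip M (X s) (innov f)"
      unfolding Xt_def[abs_def] using sqX sqXh innov_sqint[OF fT] by (simp add: ip_diff_left)
    have "ip M (innov (gain s)) (innov f) = ip lborel (\<lambda>r. gain s r * D r) (\<lambda>r. f r * D r)"
      by (rule innov_isometry[OF k fT])
    also have "\<dots> = (LINT r|lborel. f r * G r * ip M (X s) (Xt r))" unfolding ip_def[of lborel]
    proof (rule Bochner_Integration.integral_cong[OF refl])
      fix r
      show "gain s r * D r * (f r * D r) = f r * G r * ip M (X s) (Xt r)"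
      proof (cases "r \<in> {0..s}")
        case True
        then have "D r \<noteq> 0" using \<delta>(1) \<delta>(2)[of r] s by auto
        then show ?thesis using True by (simp add: gain_def power2_eq_square)
      next
        case False
        then show ?thesis using f by (auto simp: kern_def)
      qed
    qed
    finally have "ip M (innov (gain s)) (innov f) = ip M (X s) (innov f)" by (simp add: innov_X[OF fT])
    then have "ip M (\<lambda>\<omega>. m + innov (gain s) \<omega>) (innov f) = ip M (X s) (innov f)"
      using innov_sqint[OF k] innov_sqint[OF fT] innov_mean[OF fT]
      by (simp add: ip_add_left ip_commute[of M "\<lambda>_. m"] ip_const_right)
    then show "ip M \<eta> (innov f) = 0"
      unfolding \<eta>_def[abs_def] using h sqXh sm innov_sqint[OF fT] by (simp add: ip_diff_left)
  qed
  from ip_eq_0_AE[OF s\<eta> this] show ?thesis unfolding \<eta>_def m_def by eventually_elim simp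
qed

text \<open>E[X(t) Xhat(s)] is computed from the filter equation at s; the mean term in it turns the
  second moment into the covariance.\<close>

theorem riccati_equation:
  assumes s: "s \<in> {0..T}"
  shows "ip M (X t) (Xt s) = covariance M (X t) (X s) - (LINT r|lborel. gain s r * G r * ip M (X t) (Xt r))"
proof -
  have k: "kern T (gain s)" using kern_mono[OF gain_kern[OF s]] s by simp
  let ?m = "LINT \<omega>|M. X s \<omega>" and ?mt = "LINT \<omega>|M. X t \<omega>"
  have "ip M (X t) (Xh s) = ip M (X t) (\<lambda>\<omega>. ?m + innov (gain s) \<omega>)"
    using filter_equation[OF s] sqX[of t] sqXh[of s] innov_sqint[OF k]
    by (intro ip_cong_AE) (auto intro: sqint_measurable)
  also have "\<dots> = ?m * ?mt + (LINT r|lborel. gain s r * G r * ip M (X t) (Xt r))"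
    using innov_X[OF k, of t] sqX innov_sqint[OF k] by (simp add: ip_add_right ip_const_right)
  finally have h: "ip M (X t) (Xh s) = ?m * ?mt + (LINT r|lborel. gain s r * G r * ip M (X t) (Xt r))" .
  have "covariance M (X t) (X s) = ip M (\<lambda>\<omega>. X t \<omega> - ?mt) (\<lambda>\<omega>. X s \<omega> - ?m)" by (simp add: covariance_def ip_def)
  also have "\<dots> = ip M (X t) (\<lambda>\<omega>. X s \<omega> - ?m) - ?mt * (LINT \<omega>|M. X s \<omega> - ?m)"
    using sqX by (simp add: ip_diff_left ip_commute[of M "\<lambda>_. ?mt"] ip_const_right del: Bochner_Integration.integral_diff)
  also have "(LINT \<omega>|M. X s \<omega> - ?m) = 0" using sqX by (simp add: sqint_integrable prob_space)
  also have "ip M (X t) (\<lambda>\<omega>. X s \<omega> - ?m) - ?mt * 0 = ip M (X t) (X s) - ?m * ?mt"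
    using sqX by (simp add: ip_diff_right ip_const_right)
  finally show ?thesis using h sqX sqXh unfolding Xt_def[abs_def] by (simp add: ip_diff_right)
qed

end

section \<open>The filtering equation\<close>

context prob_space
begin

text \<open>Jensen's inequality gives square integrability. Testing the conditional expectation
  against itself shows that its squared norm is its inner product with \<open>f\<close>, and
  Cauchy-Schwarz finishes.\<close>

lemma real_cond_exp_sqint:
  assumes sub: "subalgebra M F" and f: "sqint M f"
  shows "sqint M (real_cond_exp M F f)" "norm_sq M (real_cond_exp M F f) \<le> norm_sq M f"
proof -
  interpret SF: sigma_finite_subalgebra M F
    by (rule sigma_finite_subalgebra_of_subalgebra[OF sub])
  let ?e = "real_cond_exp M F f"
  have "integrable M (\<lambda>x. (?e x)\<^sup>2)"
    using f sqint_integrable[OF f]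
    by (intro SF.integrable_convex_cond_exp[where I = UNIV and q = "\<lambda>x. x\<^sup>2"])
       (auto simp: sqint_def convex_power2 emeasure_space_1)
  then show se: "sqint M ?e" by (simp add: sqint_def)
  have "norm_sq M ?e = ip M ?e f"
    unfolding ip_def using sqint_integrable_mult[OF se f] f
    by (intro SF.real_cond_exp_intg(2)) (auto simp: sqint_def)
  then have "(norm_sq M ?e)\<^sup>2 \<le> norm_sq M ?e * norm_sq M f"
    using ip_Cauchy_Schwarz[OF se f] by simp
  then show "norm_sq M ?e \<le> norm_sq M f"
    using ip_nonneg[of M ?e] by (cases "norm_sq M ?e = 0") (auto simp: power2_eq_square)
qed

lemma generated_sigma_mono:
  assumes "S \<subseteq> S'" shows "sets (generated_sigma M S) \<subseteq> sets (generated_sigma M S')"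
proof -
  have "sigma_sets (space M) (\<Union>Z\<in>S. {Z -` A \<inter> space M | A. A \<in> sets borel})
      \<subseteq> sigma_sets (space M) (\<Union>Z\<in>S'. {Z -` A \<inter> space M | A. A \<in> sets borel})"
    using assms by (intro sigma_sets_mono') blast
  then show ?thesis unfolding generated_sigma_def by (subst (1 2) sets_measure_of) auto
qed

lemma space_generated_sigma: "space (generated_sigma M S) = space M"
  unfolding generated_sigma_def by (rule space_measure_of) auto

lemma generated_sigma_mono_measurable:
  assumes "S \<subseteq> S'" "f \<in> borel_measurable (generated_sigma M S)"
  shows "f \<in> borel_measurable (generated_sigma M S')"
  using assms generated_sigma_mono[OF assms(1)] unfolding measurable_def space_generated_sigma by auto

text \<open>Intersections of an event of \<open>Z\<close> with one of \<open>S1\<close> generate the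
  larger sigma-algebra. They factorise against \<open>S2\<close> because \<open>Z\<close> is
  independent of the two families jointly and \<open>S1\<close> is independent of
  \<open>S2\<close>.\<close>

lemma indep_set_generated_sigma_insert:
  assumes Z: "Z \<in> borel_measurable M" and S1: "\<And>g. g \<in> S1 \<Longrightarrow> g \<in> borel_measurable M"
    and S2: "\<And>g. g \<in> S2 \<Longrightarrow> g \<in> borel_measurable M"
    and i12: "indep_set (sets (generated_sigma M S1)) (sets (generated_sigma M S2))"
    and iZ: "indep_set (sets (generated_sigma M {Z})) (sets (generated_sigma M (S1 \<union> S2)))"
  shows "indep_set (sets (generated_sigma M (insert Z S1))) (sets (generated_sigma M S2))"
proof -
  let ?A = "generated_sigma M {Z}" and ?B1 = "generated_sigma M S1" and ?B2 = "generated_sigma M S2"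
  let ?B = "generated_sigma M (S1 \<union> S2)"
  define P where "P = {a \<inter> b | a b. a \<in> sets ?A \<and> b \<in> sets ?B1}"
  have sA: "subalgebra M ?A" and sB1: "subalgebra M ?B1" and sB2: "subalgebra M ?B2"
    using Z S1 S2 by (auto intro!: generated_sigma_measurable(1))
  have AM: "sets ?A \<subseteq> events" "sets ?B1 \<subseteq> events" "sets ?B2 \<subseteq> events" using sA sB1 sB2 by (auto simp: subalgebra_def)
  have B1B: "sets ?B1 \<subseteq> sets ?B" and B2B: "sets ?B2 \<subseteq> sets ?B" by (auto intro!: generated_sigma_mono)
  have prob1: "prob (a \<inter> b \<inter> c) = prob (a \<inter> b) * prob c"
    if "a \<in> sets ?A" "b \<in> sets ?B1" "c \<in> sets ?B2" for a b c
  proof -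
    have bc: "b \<inter> c \<in> sets ?B" using that B1B B2B by (intro sets.Int) auto
    have "prob (a \<inter> b \<inter> c) = prob (a \<inter> (b \<inter> c))" by (simp add: Int_assoc)
    also have "\<dots> = prob a * (prob b * prob c)"
      using indep_setD[OF iZ that(1) bc] indep_setD[OF i12 that(2,3)] by simp
    also have "prob a * (prob b * prob c) = prob (a \<inter> b) * prob c"
      using indep_setD[OF iZ that(1), of b] that(2) B1B by auto
    finally show ?thesis .
  qed
  have "indep_set P (sets ?B2)"
    unfolding indep_sets2_eq P_def using prob1 AM by (auto simp del: space_generated_sigma)
  moreover have "Int_stable P"
  proof (rule Int_stableI)
    fix x y assume "x \<in> P" "y \<in> P"
    then obtain a b a' b' where "x = a \<inter> b" "y = a' \<inter> b'" "a \<in> sets ?A" "a' \<in> sets ?A" "b \<in> sets ?B1" "b' \<in> sets ?B1"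
      unfolding P_def by blast
    then have "x \<inter> y = (a \<inter> a') \<inter> (b \<inter> b')" "a \<inter> a' \<in> sets ?A" "b \<inter> b' \<in> sets ?B1" by auto
    then show "x \<inter> y \<in> P" unfolding P_def by blast
  qed
  moreover have "Int_stable (sets ?B2)" by (auto simp: Int_stable_def)
  ultimately have "indep_set (sigma_sets (space M) P) (sigma_sets (space M) (sets ?B2))"
    by (rule indep_set_sigma_sets)
  then show ?thesis unfolding indep_set_def
  proof (rule indep_sets_mono_sets)
    \<comment> \<open>Taking the whole space as the other factor puts both families of generators
      into \<open>P\<close>.\<close>
    have "g -` E \<inter> space M \<in> P" if "g \<in> insert Z S1" "E \<in> sets borel" for g and E :: "real set"
    proof (cases "g = Z")
      case True
      have "Z \<in> borel_measurable ?A" by (rule generated_sigma_measurable(2)) (use Z in auto)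
      from measurable_sets[OF this that(2)] have "Z -` E \<inter> space M \<in> sets ?A" by (simp add: space_generated_sigma)
      moreover have "space M \<in> sets ?B1" using sets.top[of ?B1] by (simp add: space_generated_sigma)
      ultimately have "(Z -` E \<inter> space M) \<inter> space M \<in> P" unfolding P_def by blast
      then show ?thesis using True by simp
    next
      case False
      then have "g \<in> borel_measurable ?B1" using that S1 by (intro generated_sigma_measurable(2)) auto
      from measurable_sets[OF this that(2)] have "g -` E \<inter> space M \<in> sets ?B1" by (simp add: space_generated_sigma)
      moreover have "space M \<in> sets ?A" using sets.top[of ?A] by (simp add: space_generated_sigma)
      ultimately have "space M \<inter> (g -` E \<inter> space M) \<in> P" unfolding P_def by blast
      then show ?thesis by (simp add: Int_commute)
    qed
    then have "(\<Union>Z\<in>insert Z S1. {Z -` A \<inter> space M | A. A \<in> sets borel}) \<subseteq> P" by blast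
    from sigma_sets_mono'[OF this] have "sets (generated_sigma M (insert Z S1)) \<subseteq> sigma_sets (space M) P"
      unfolding generated_sigma_def by (subst sets_measure_of) auto
    moreover have "sets ?B2 \<subseteq> sigma_sets (space M) (sets ?B2)" by auto
    ultimately show "(case i of True \<Rightarrow> sets (generated_sigma M (insert Z S1)) | False \<Rightarrow> sets ?B2)
      \<subseteq> (case i of True \<Rightarrow> sigma_sets (space M) P | False \<Rightarrow> sigma_sets (space M) (sets ?B2))" for i
      by (cases i) auto
  qed
qed

text \<open>Joint measurability is given for nonnegative times; composition with
  \<open>max 0\<close> extends it to the line without changing the values that the indicator
  keeps.\<close>

lemma jointly_measurable_cutoff:
  assumes "jointly_measurable M V"
  shows "(\<lambda>(s, \<omega>). indicator {0..t} s * V s \<omega>) \<in> borel_measurable (lborel \<Otimes>\<^sub>M M)"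
proof -
  have m: "(\<lambda>s::real. max 0 s) \<in> measurable lborel (restrict_space borel {0..})"
    by (rule measurable_restrict_space2) auto
  have [measurable]: "(\<lambda>p. V (max 0 (fst p)) (snd p)) \<in> borel_measurable (lborel \<Otimes>\<^sub>M M)"
  proof -
    have "(\<lambda>p. (max (0::real) (fst p), snd p)) \<in> measurable (lborel \<Otimes>\<^sub>M M) (restrict_space borel {0..} \<Otimes>\<^sub>M M)"
    proof (rule measurable_Pair)
      show "(\<lambda>p. max (0::real) (fst p)) \<in> measurable (lborel \<Otimes>\<^sub>M M) (restrict_space borel {0..})"
        using measurable_compose[of fst "lborel \<Otimes>\<^sub>M M" lborel "\<lambda>s. max 0 s", OF _ m] by simp
    qed simp
    from measurable_compose[OF this assms[unfolded jointly_measurable_def]] show ?thesis by simp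
  qed
  have "(\<lambda>p. indicator {0..t} (fst p) * V (max 0 (fst p)) (snd p)) \<in> borel_measurable (lborel \<Otimes>\<^sub>M M)" by measurable
  also have "(\<lambda>p. indicator {0..t} (fst p) * V (max 0 (fst p)) (snd p)) = (\<lambda>(s, \<omega>). indicator {0..t} s * V s \<omega>)"
    by (auto simp: fun_eq_iff indicator_def)
  finally show ?thesis .
qed

end

theorem theorem4p5:
  fixes M :: "'a measure"
    and B1 B2 X Y Xhat :: "real \<Rightarrow> 'a \<Rightarrow> real"
    and X0 :: "'a \<Rightarrow> real"
    and G D :: "real \<Rightarrow> real"
  assumes "prob_space M"
    and "brownian_motion M B1" and "brownian_motion M B2"
    and "prob_space.indep_set M
           (sets (generated_sigma M (B1 ` {0..}))) (sets (generated_sigma M (B2 ` {0..})))"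
    and "gaussian_rv M X0"
    and "prob_space.indep_set M
           (sets (generated_sigma M {X0})) (sets (generated_sigma M (B1 ` {0..} \<union> B2 ` {0..})))"
    and "gaussian_process M X" and "jointly_measurable M X"
    and "AE \<omega> in M. X 0 \<omega> = X0 \<omega>"
    and "\<And>t. t \<ge> 0 \<Longrightarrow> X t \<in> borel_measurable (generated_sigma M (insert X0 (B1 ` {0..t})))"
    and "\<And>T. T > 0 \<Longrightarrow> set_integrable lborel {0..T} (\<lambda>t. LINT \<omega>|M. (X t \<omega>)\<^sup>2)"
    and "set_borel_measurable borel {0..} G" and "bounded (G ` {0..})"
    and "set_borel_measurable borel {0..} D" and "bounded (D ` {0..})"
    and "\<exists>\<delta>>0. \<forall>t\<ge>0. \<delta> \<le> \<bar>D t\<bar>"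
    and "\<And>t. t \<ge> 0 \<Longrightarrow> Y t \<in> borel_measurable M"
    and "\<And>t. t \<ge> 0 \<Longrightarrow>
           AE \<omega> in M. Y t \<omega> = (LINT \<omega>'|M. X0 \<omega>') + obs_integral M G D X B2 (\<lambda>_. 1) t \<omega>"
    and "measurable_cond_exp M (obs_filtration M Y) X Xhat"
  defines "H \<equiv> error_fun M X Xhat"
  shows "(\<forall>t\<ge>0. AE \<omega> in M. Xhat t \<omega> =
            (LINT \<omega>'|M. X t \<omega>')
            - (LINT s:{0..t}|lborel. (G s)\<^sup>2 / (D s)\<^sup>2 * H t s * Xhat s \<omega>)
            + obs_integral M G D X B2 (\<lambda>s. G s / (D s)\<^sup>2 * H t s) t \<omega>)
       \<and> (\<forall>s t. 0 \<le> s \<and> s \<le> t \<longrightarrow>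
            H t s = covariance M (X t) (X s)
              - (LINT r:{0..s}|lborel. (G r)\<^sup>2 / (D r)\<^sup>2 * H t r * H s r))"
proof -
  note prob = assms(1) and bm1 = assms(2) and bm2 = assms(3) and ind12 = assms(4) and gX0 = assms(5)
    and indX0 = assms(6) and gX = assms(7) and jX = assms(8) and adX = assms(10) and iX = assms(11)
    and mG = assms(12) and bG = assms(13) and mD = assms(14) and bD = assms(15) and dD = assms(16)
    and mY = assms(17) and Yeq = assms(18) and Xhat = assms(19)
  interpret prob_space M by (rule prob)
  \<comment> \<open>The initial value and \<open>B1\<close> over all times: the signal is measurable
    for this sigma-algebra, which is independent of \<open>B2\<close>.\<close>
  define FX where "FX = generated_sigma M (insert X0 (B1 ` {0..}))"
  have mX0: "X0 \<in> borel_measurable M" using gX0 by (simp add: gaussian_rv_def)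
  have mB: "B1 s \<in> borel_measurable M" "B2 s \<in> borel_measurable M" if "0 \<le> s" for s
    using that bm1 bm2 by (auto simp: brownian_motion_def)
  have FX: "subalgebra M FX" unfolding FX_def using mX0 mB by (intro generated_sigma_measurable(1)) auto
  have FX_indep: "indep_set (sets FX) (sets (generated_sigma M (B2 ` {0..})))"
    unfolding FX_def by (rule indep_set_generated_sigma_insert[OF mX0 _ _ ind12 indX0]) (use mB in auto)
  have X_FX: "X s \<in> borel_measurable FX" if "0 \<le> s" for s
    unfolding FX_def by (rule generated_sigma_mono_measurable[OF _ adX[OF that]]) auto
  have gc: "gauss_char M (\<lambda>\<omega>. \<Sum>s\<in>J. c s * X s \<omega>)" if "finite J" "J \<subseteq> {0..}" for J c
    by (rule gaussian_rv_gauss_char) (use gX[unfolded gaussian_process_def, rule_format, of J c] that in simp)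
  have sX: "sqint M (X s)" if "0 \<le> s" for s using gauss_char_sqint[OF gc[of "{s}" "\<lambda>_. 1"]] that by simp
  obtain K1 where K1: "\<And>s. 0 \<le> s \<Longrightarrow> \<bar>G s\<bar> \<le> K1" using bG by (auto simp: bounded_iff)
  obtain K2 where K2: "\<And>s. 0 \<le> s \<Longrightarrow> \<bar>D s\<bar> \<le> K2" using bD by (auto simp: bounded_iff)
  obtain \<delta> where \<delta>: "0 < \<delta>" "\<And>s. 0 \<le> s \<Longrightarrow> \<delta> \<le> \<bar>D s\<bar>" using dD by blast
  have sub: "subalgebra M (generated_sigma M (Y ` {0..s}))" for s
    by (rule generated_sigma_measurable(1)) (use mY in auto)
  have Xh: "AE \<omega> in M. Xhat s \<omega> = real_cond_exp M (generated_sigma M (Y ` {0..s})) (X s) \<omega>" if "0 \<le> s" for s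
    using Xhat that by (simp add: measurable_cond_exp_def obs_filtration_def)
  define K where "K = max 0 (max K1 K2)"
  \<comment> \<open>\<open>linear_filter\<close> expects processes on the whole line that vanish
    outside the horizon, and coefficients bounded everywhere. Each t \<ge> 0 serves as its own
    horizon.\<close>
  define cut where "cut t V s \<omega> = indicator {0..t} s * V s \<omega>" for t :: real and V :: "real \<Rightarrow> 'a \<Rightarrow> real" and s \<omega>
  define cut1 where "cut1 t g s = indicator {0..t} s * g s" for t :: real and g :: "real \<Rightarrow> real" and s
  have cut: "cut t V s = V s" if "s \<in> {0..t}" for t V s using that by (simp add: cut_def fun_eq_iff)
  have cut1: "cut1 t g s = g s" if "s \<in> {0..t}" for t g s using that by (simp add: cut1_def)
  have LF: "linear_filter M B2 FX (cut t X) (cut t Xhat) Y (cut1 t G) (cut1 t D) t K \<delta> (LINT \<omega>|M. X0 \<omega>)"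
    if t: "0 \<le> t" for t
  proof -
    have sqcut: "sqint M (cut t X s)" for s
      using sX[of s] by (cases "s \<in> {0..t}") (auto simp: cut cut_def[abs_def])
    have lX: "l2process M t (cut t X)"
      unfolding l2process_def
    proof (intro conjI allI impI)
      show "(\<lambda>(s, \<omega>). cut t X s \<omega>) \<in> borel_measurable (lborel \<Otimes>\<^sub>M M)"
        unfolding cut_def by (rule jointly_measurable_cutoff[OF jX])
      \<comment> \<open>Integrability is given for positive horizons; passing through t + 1 covers t
        = 0.\<close>
      have "set_integrable lborel {0..t} (\<lambda>s. LINT \<omega>|M. (X s \<omega>)\<^sup>2)"
        by (rule set_integrable_subset[OF iX[of "t + 1"]]) (use t in auto)
      moreover have "indicator {0..t} s *\<^sub>R (LINT \<omega>|M. (X s \<omega>)\<^sup>2) = norm_sq M (cut t X s)" for s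
        by (cases "s \<in> {0..t}") (auto simp: cut_def[abs_def] ip_def power2_eq_square)
      ultimately show "integrable lborel (\<lambda>s. norm_sq M (cut t X s))" by (simp add: set_integrable_def)
    qed (use sqcut in \<open>auto simp: cut_def\<close>)
    have lXh: "l2process M t (cut t Xhat)"
    proof (rule l2process_dominated[OF lX])
      have jXh: "jointly_measurable M Xhat" using Xhat by (simp add: measurable_cond_exp_def)
      show m: "(\<lambda>(s, \<omega>). cut t Xhat s \<omega>) \<in> borel_measurable (lborel \<Otimes>\<^sub>M M)"
        unfolding cut_def by (rule jointly_measurable_cutoff[OF jXh])
      \<comment> \<open>A conditional expectation contracts the norm, so the estimate inherits
        integrability in time from the signal.\<close>
      have *: "sqint M (cut t Xhat s) \<and> norm_sq M (cut t Xhat s) \<le> norm_sq M (cut t X s)" for s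
      proof (cases "s \<in> {0..t}")
        case True
        then have s: "0 \<le> s" by simp
        let ?e = "real_cond_exp M (generated_sigma M (Y ` {0..s})) (X s)"
        have "(\<lambda>\<omega>. case (s, \<omega>) of (s, \<omega>) \<Rightarrow> cut t Xhat s \<omega>) \<in> borel_measurable M"
          by (rule measurable_compose[OF measurable_Pair1' m]) simp
        then have mm: "Xhat s \<in> borel_measurable M" using cut[OF True, of Xhat] by simp
        note e = real_cond_exp_sqint[OF sub sX[OF s], of s]
        have "sqint M (Xhat s)" by (rule sqint_AE[OF e(1) mm Xh[OF s]])
        moreover have "norm_sq M (Xhat s) = norm_sq M ?e"
          using Xh[OF s] mm e(1) by (intro ip_cong_AE) (auto intro: sqint_measurable)
        ultimately show ?thesis using e(2) cut[OF True] by simp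
      next
        case False
        then show ?thesis by (simp add: cut_def[abs_def])
      qed
      show "sqint M (cut t Xhat s)" "norm_sq M (cut t Xhat s) \<le> norm_sq M (cut t X s)" for s
        using * by blast+
      show "cut t Xhat s \<omega> = 0" if "s \<notin> {0..t}" for s \<omega> using that by (simp add: cut_def)
    qed
    have mcut1: "cut1 t g \<in> borel_measurable borel" if "set_borel_measurable borel {0..} g" for g
    proof -
      have "(\<lambda>s. indicator {0..t} s * (indicator {0..} s *\<^sub>R g s)) \<in> borel_measurable borel"
        using that by (intro borel_measurable_times) (auto simp: set_borel_measurable_def)
      also have "(\<lambda>s. indicator {0..t} s * (indicator {0..} s *\<^sub>R g s)) = cut1 t g"
        by (auto simp: cut1_def fun_eq_iff indicator_def)
      finally show ?thesis .
    qed
    show ?thesis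
    proof (unfold_locales, goal_cases)
      show "brownian_motion M B2" by (rule bm2)
      show "0 \<le> t" by (rule t)
      show "subalgebra M FX" by (rule FX)
      show "indep_set (sets FX) (sets (generated_sigma M (B2 ` {0..})))" by (rule FX_indep)
      show "l2process M t (cut t X)" by (rule lX)
      show "cut t X s \<in> borel_measurable FX" for s
        using X_FX[of s] by (cases "s \<in> {0..t}") (auto simp: cut cut_def[abs_def])
      show "gauss_char M f" if "f \<in> lspan (cut t X ` {0..t})" for f
      proof -
        have "cut t X ` {0..t} = X ` {0..t}" using cut by (intro image_cong) auto
        with that have "f \<in> lspan (X ` {0..t})" by simp
        then obtain J c where "finite J" "J \<subseteq> {0..t}" "f = (\<lambda>\<omega>. \<Sum>s\<in>J. c s * X s \<omega>)"
          by (rule lspan_imageE)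
        then show ?thesis using gc[of J c] by force
      qed
      show "cut1 t G \<in> borel_measurable borel" "cut1 t D \<in> borel_measurable borel" using mcut1 mG mD by auto
      show "\<bar>cut1 t G s\<bar> \<le> K" "\<bar>cut1 t D s\<bar> \<le> K" for s
        using K1[of s] K2[of s] by (auto simp: cut1_def K_def indicator_def)
      show "0 < \<delta>" by (rule \<delta>)
      show "\<delta> \<le> \<bar>cut1 t D s\<bar>" if "s \<in> {0..t}" for s using \<delta>(2)[of s] that by (simp add: cut1)
      show "Y s \<in> borel_measurable M" if "s \<in> {0..t}" for s using mY that by simp
      show "AE \<omega> in M. Y s \<omega> = (LINT \<omega>|M. X0 \<omega>) +
         ((LINT r|lborel. indicator {0..s} r * cut1 t G r * cut t X r \<omega>) + wiener_integral M B2 (cut1 t D) s \<omega>)"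
        if s: "s \<in> {0..t}" for s
      proof -
        have "wiener_integral M B2 (\<lambda>r. 1 * D r) s = wiener_integral M B2 (cut1 t D) s"
          by (rule wiener_integral_cong) (use s in \<open>simp add: cut1\<close>)
        moreover have "(LINT r:{0..s}|lborel. 1 * (G r * X r \<omega>)) = (LINT r|lborel. indicator {0..s} r * cut1 t G r * cut t X r \<omega>)" for \<omega>
          unfolding set_lebesgue_integral_def
          by (intro Bochner_Integration.integral_cong) (use s in \<open>auto simp: indicator_def cut1_def cut_def\<close>)
        ultimately show ?thesis using Yeq[of s] s unfolding obs_integral_def by simp
      qed
      show "l2process M t (cut t Xhat)" by (rule lXh)
      show "AE \<omega> in M. cut t Xhat s \<omega> = real_cond_exp M (generated_sigma M (Y ` {0..s})) (cut t X s) \<omega>"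
        if "s \<in> {0..t}" for s using Xh[of s] that by (simp add: cut)
    qed
  qed
  have I: "AE \<omega> in M. Xhat t \<omega> =
            (LINT \<omega>'|M. X t \<omega>')
            - (LINT s:{0..t}|lborel. (G s)\<^sup>2 / (D s)\<^sup>2 * H t s * Xhat s \<omega>)
            + obs_integral M G D X B2 (\<lambda>s. G s / (D s)\<^sup>2 * H t s) t \<omega>" if t: "0 \<le> t" for t
  proof -
    interpret L: linear_filter M B2 FX "cut t X" "cut t Xhat" Y "cut1 t G" "cut1 t D" t K \<delta> "LINT \<omega>|M. X0 \<omega>"
      by (rule LF[OF t])
    have tt: "t \<in> {0..t}" using t by simp
    have H: "H t s = ip M (cut t X t) (L.Xt s)" if "s \<in> {0..t}" for s
      using cut[OF tt, of X] cut[OF that, of X] cut[OF that, of Xhat] unfolding H_def error_fun_def ip_def L.Xt_def by simp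
    have g: "L.gain t s = indicator {0..t} s * (G s / (D s)\<^sup>2 * H t s)" for s
      unfolding L.gain_def using H[of s] by (cases "s \<in> {0..t}") (auto simp: cut1)
    have k: "kern t (L.gain t)" by (rule L.gain_kern[OF tt])
    \<comment> \<open>The integrands agree on [0,t], so even the chosen versions of the two
      integrals coincide.\<close>
    have w: "wiener_integral M B2 (\<lambda>s. L.gain t s * cut1 t D s) t = wiener_integral M B2 (\<lambda>s. G s / (D s)\<^sup>2 * H t s * D s) t"
      by (rule wiener_integral_cong) (simp add: g cut1)
    have i1: "time_integral (\<lambda>r. L.gain t r * cut1 t G r) (cut t X) \<omega> = (LINT s:{0..t}|lborel. G s / (D s)\<^sup>2 * H t s * (G s * X s \<omega>))" for \<omega>
      unfolding time_integral_def set_lebesgue_integral_def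
      by (intro Bochner_Integration.integral_cong) (auto simp: g indicator_def cut1_def cut_def)
    have i2: "time_integral (\<lambda>r. L.gain t r * cut1 t G r) (cut t Xhat) \<omega> = (LINT s:{0..t}|lborel. (G s)\<^sup>2 / (D s)\<^sup>2 * H t s * Xhat s \<omega>)" for \<omega>
      unfolding time_integral_def set_lebesgue_integral_def
      by (intro Bochner_Integration.integral_cong) (auto simp: g indicator_def cut1_def cut_def power2_eq_square)
    \<comment> \<open>Splitting the innovation integral into observations minus estimated drift
      produces both integral terms.\<close>
    show ?thesis
      using L.filter_equation[OF tt] L.innov_obs[OF k]
    proof eventually_elim
      case (elim \<omega>)
      then show ?case using cut[OF tt] by (simp add: L.obs_def i1 i2 w obs_integral_def)
    qed
  qed
  have II: "H t s = covariance M (X t) (X s) - (LINT r:{0..s}|lborel. (G r)\<^sup>2 / (D r)\<^sup>2 * H t r * H s r)"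
    if s: "0 \<le> s" "s \<le> t" for s t
  proof -
    have t: "0 \<le> t" using s by simp
    interpret L: linear_filter M B2 FX "cut t X" "cut t Xhat" Y "cut1 t G" "cut1 t D" t K \<delta> "LINT \<omega>|M. X0 \<omega>"
      by (rule LF[OF t])
    have ss: "s \<in> {0..t}" and tt: "t \<in> {0..t}" using s by auto
    have H: "H u r = ip M (cut t X u) (L.Xt r)" if "u \<in> {0..t}" "r \<in> {0..t}" for u r
      using cut[OF that(1), of X] cut[OF that(2), of X] cut[OF that(2), of Xhat]
      unfolding H_def error_fun_def ip_def L.Xt_def by simp
    \<comment> \<open>The gain contributes G / D^2 times H(s,r), the signal drift G times
      H(t,r).\<close>
    have "(LINT r|lborel. L.gain s r * cut1 t G r * ip M (cut t X t) (L.Xt r))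
        = (LINT r:{0..s}|lborel. (G r)\<^sup>2 / (D r)\<^sup>2 * H t r * H s r)"
      unfolding set_lebesgue_integral_def
    proof (rule Bochner_Integration.integral_cong[OF refl])
      fix r
      show "L.gain s r * cut1 t G r * ip M (cut t X t) (L.Xt r) = indicator {0..s} r *\<^sub>R ((G r)\<^sup>2 / (D r)\<^sup>2 * H t r * H s r)"
      proof (cases "r \<in> {0..s}")
        case True
        then have r: "r \<in> {0..t}" using s by auto
        show ?thesis using True by (simp add: L.gain_def cut1[OF r] H[OF ss r] H[OF tt r] power2_eq_square)
      qed (simp add: L.gain_def)
    qed
    then show ?thesis using L.riccati_equation[OF ss, of t] by (simp add: H[OF tt ss] cut[OF ss] cut[OF tt])
  qed
  show ?thesis using I II by blast
qed

end
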